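(* Let $N\ge3$ and $2^*=\frac{2N}{N-2}$. For $a>0$ let $m(a)=\inf_{u\in\mathcal{P}'(a)}I(u)$. Then for the function $a\mapsto m(a)$ on $(0,+\infty)$: (1) if $4+\frac4N<p<2\cdot2^*$, then $m(a)$ is positive and lower semicontinuous; (2) if $4+\frac4N<p<2^*$, then $m(a)\to0^+$ as $a\to+\infty$; (3) if $4+\frac4N<p<2\cdot2^*$, then $m(a)\to+\infty$ as $a\to0^+$.
   Context: Functions are real-valued, and $\gamma_p=\frac{N(p-2)}{2p}$. The functionals and sets are $$I(u)=\frac12\int_{\mathbb{R}^N}|\nabla u|^2+\int_{\mathbb{R}^N}|u|^2|\nabla u|^2-\frac1p\int_{\mathbb{R}^N}|u|^p,$$ $$P(u)=\int_{\mathbb{R}^N}|\nabla u|^2+(N+2)\int_{\mathbb{R}^N}|u|^2|\nabla u|^2-\gamma_p\int_{\mathbb{R}^N}|u|^p,$$ $$\mathcal{S}'(a)=\Big\{u\in H^1(\mathbb{R}^N)\ \Big|\ \int_{\mathbb{R}^N}|u|^2|\nabla u|^2<+\infty,\ \int_{\mathbb{R}^N}|u|^2=a^2\Big\},\qquad \mathcal{P}'(a)=\{u\in\mathcal{S}'(a)\ |\ P(u)=0\}.$$ *)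

theory Defs
  imports "HOL-Analysis.Analysis"
begin

text \<open>The dimension \<open>N\<close> is \<^term>\<open>CARD('n)\<close>, and $\mathbb{R}^N$ is \<^typ>\<open>real ^ 'n\<close>.\<close>

section \<open>Test functions, weak gradients and the Sobolev space\<close>

primrec C_k :: "nat \<Rightarrow> (real ^ 'n \<Rightarrow> real) \<Rightarrow> bool" where
  "C_k 0 f \<longleftrightarrow> continuous_on UNIV f"
| "C_k (Suc k) f \<longleftrightarrow>
     (\<forall>x. f differentiable (at x)) \<and> (\<forall>v. C_k k (\<lambda>x. frechet_derivative f (at x) v))"

definition test_function :: "(real ^ 'n \<Rightarrow> real) \<Rightarrow> bool" where
  "test_function \<phi> \<longleftrightarrow> (\<forall>k. C_k k \<phi>) \<and> compact (closure {x. \<phi> x \<noteq> 0})"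

definition locally_integrable :: "(real ^ 'n \<Rightarrow> 'b::euclidean_space) \<Rightarrow> bool" where
  "locally_integrable f \<longleftrightarrow>
     f \<in> borel_measurable lebesgue \<and> (\<forall>K. compact K \<longrightarrow> set_integrable lebesgue K f)"

definition has_weak_gradient :: "(real ^ 'n \<Rightarrow> real) \<Rightarrow> (real ^ 'n \<Rightarrow> real ^ 'n) \<Rightarrow> bool" where
  "has_weak_gradient u G \<longleftrightarrow> locally_integrable u \<and> locally_integrable G \<and>
     (\<forall>\<phi> i. test_function \<phi> \<longrightarrow>
        (\<integral>x. u x * frechet_derivative \<phi> (at x) (axis i 1) \<partial>lebesgue)
          = - (\<integral>x. G x $ i * \<phi> x \<partial>lebesgue))"

text \<open>A weak gradient is unique only up to null sets; \<open>weak_gradient\<close> picks a representative,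
  on which no integral below depends.\<close>

definition weak_gradient :: "(real ^ 'n \<Rightarrow> real) \<Rightarrow> real ^ 'n \<Rightarrow> real ^ 'n" where
  "weak_gradient u = (SOME G. has_weak_gradient u G)"

text \<open>Elements of $H^1$ are represented by functions rather than by classes modulo equality
  almost everywhere.\<close>

definition sobolev_H1 :: "(real ^ 'n \<Rightarrow> real) set" where
  "sobolev_H1 = {u. u \<in> borel_measurable lebesgue \<and> integrable lebesgue (\<lambda>x. (u x)\<^sup>2) \<and>
     (\<exists>G. has_weak_gradient u G) \<and>
     integrable lebesgue (\<lambda>x. (norm (weak_gradient u x))\<^sup>2)}"

section \<open>The functionals and the constrained minimization problem\<close>

definition gamma_exp :: "nat \<Rightarrow> real \<Rightarrow> real" where
  "gamma_exp N p = real N * (p - 2) / (2 * p)"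

definition critical_exponent :: "nat \<Rightarrow> real" where
  "critical_exponent N = 2 * real N / (real N - 2)"

definition energy :: "real \<Rightarrow> (real ^ 'n \<Rightarrow> real) \<Rightarrow> real" where
  "energy p u =
     1 / 2 * (\<integral>x. (norm (weak_gradient u x))\<^sup>2 \<partial>lebesgue)
     + (\<integral>x. \<bar>u x\<bar>\<^sup>2 * (norm (weak_gradient u x))\<^sup>2 \<partial>lebesgue)
     - 1 / p * (\<integral>x. \<bar>u x\<bar> powr p \<partial>lebesgue)"

definition pohozaev :: "real \<Rightarrow> (real ^ 'n \<Rightarrow> real) \<Rightarrow> real" where
  "pohozaev p u =
     (\<integral>x. (norm (weak_gradient u x))\<^sup>2 \<partial>lebesgue)
     + (real CARD('n) + 2) * (\<integral>x. \<bar>u x\<bar>\<^sup>2 * (norm (weak_gradient u x))\<^sup>2 \<partial>lebesgue)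
     - gamma_exp CARD('n) p * (\<integral>x. \<bar>u x\<bar> powr p \<partial>lebesgue)"

definition mass_sphere :: "real \<Rightarrow> (real ^ 'n \<Rightarrow> real) set" where
  "mass_sphere a = {u \<in> sobolev_H1.
     integrable lebesgue (\<lambda>x. \<bar>u x\<bar>\<^sup>2 * (norm (weak_gradient u x))\<^sup>2) \<and>
     (\<integral>x. \<bar>u x\<bar>\<^sup>2 \<partial>lebesgue) = a\<^sup>2}"

definition pohozaev_set :: "real \<Rightarrow> real \<Rightarrow> (real ^ 'n \<Rightarrow> real) set" where
  "pohozaev_set p a = {u \<in> mass_sphere a. pohozaev p u = 0}"

text \<open>The infimum is taken in \<^typ>\<open>ereal\<close>, where it is meaningful without knowing beforehand
  that the set is nonempty and the energy bounded below on it. The first argument only carries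
  the dimension.\<close>

definition ground_level :: "'n::finite itself \<Rightarrow> real \<Rightarrow> real \<Rightarrow> ereal" where
  "ground_level _ p a = (INF u \<in> (pohozaev_set p a :: (real ^ 'n \<Rightarrow> real) set). ereal (energy p u))"

definition lower_semicontinuous_on :: "'a::topological_space set \<Rightarrow> ('a \<Rightarrow> ereal) \<Rightarrow> bool" where
  "lower_semicontinuous_on S f \<longleftrightarrow> (\<forall>x\<in>S. f x \<le> Liminf (at x within S) f)"

end

theory Submission
  imports Defs
begin

text \<open>
  Everything rests on a Gagliardo--Nirenberg inequality
  $\int |u|^p \le M a^{p-4\beta} (\int u^2|\nabla u|^2)^\beta$ with $\beta = N(p-2)/(2(N+2)) > 1$ and
  $p - 4\beta > 0$ on $\mathcal{S}'(a)$. Combined with $P(u) = 0$ it bounds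
  $\int u^2|\nabla u|^2$, and hence $I(u)$, from below by a negative power of $a$; this gives
  positivity of $m$ and its divergence at $0$. Conversely, $u \in \mathcal{P}'(b)$ multiplied by
  $s = a/b$ and then dilated lies in $\mathcal{P}'(a)$, and $P(u) = 0$ bounds the dilation parameter
  by a function of $s$ alone, so $m(a) \le \kappa(a/b)\, m(b)$ with an explicit factor $\kappa$.
  As $\kappa(s) \to 1$ for $s \to 1$, $m$ is lower semicontinuous, and as $\kappa(s) \to 0$ for
  $s \to \infty$ when $p < 2^*$, $m$ vanishes at infinity.

  By scaling, the inequality is only needed for $a = 1$ and $\int u^2|\nabla u|^2 \le 1$. A weak
  gradient determines the increments of $u$, hence of $v = u^2$, along almost every line, so that
  $v(\cdot + y) - v$ is $O(|y|)$ in $L^2$. This passes to truncations of $v$, and a Nash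
  type inequality for them turns it into a recursion for the measures of the sets
  $\{v \ge 2^k\}$, whose decay controls every $L^q$ norm of $v$ with $q < 2^*$.
\<close>

section \<open>Smooth bump functions\<close>

text \<open>The obstacle is regularity: \<open>u\<close> is only weakly differentiable, and a chain
  rule for its square or a Sobolev inequality would call for smooth approximation. Increments avoid
  this: their estimates need only Fubini, Cauchy-Schwarz and translation invariance, and truncation
  never enlarges them. What comes out is a weak-type bound at the critical exponent \<sigma>: the
  set where v \<ge> 2^k has measure at most K 2^(-\<sigma> k). This suffices because p/2 < \<sigma>
  strictly, so that the dyadic sum for the integral of v^(p/2) is geometric. The exponents come from
  two scalings. A mass-preserving dilation by t multiplies the Dirichlet, quasilinear and L^p
  integrals by t^2, t^(N+2) and t^r with r = N(p-2)/2; multiplying the function by s gives s^2, s^4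
  and s^p. Then \<beta> = r/(N+2), so \<beta> > 1 means p > 4 + 4/N, and p - 4\<beta> > 0 means that
  p lies below twice the critical exponent. Balancing s^p t^r against s^2 t^2 and s^4 t^(N+2) gives
  the two branches of the dilation bound, and p below the critical exponent makes both decay faster
  than 1/s.\<close>

primrec Dk :: "nat \<Rightarrow> (real \<Rightarrow> real) \<Rightarrow> bool" where
  "Dk 0 f \<longleftrightarrow> continuous_on UNIV f"
| "Dk (Suc k) f \<longleftrightarrow> (\<exists>f'. (\<forall>x. (f has_real_derivative f' x) (at x)) \<and> Dk k f')"

definition smooth :: "(real \<Rightarrow> real) \<Rightarrow> bool" where
  "smooth f \<longleftrightarrow> (\<forall>k. Dk k f)"

lemma Dk_continuous: "Dk k f \<Longrightarrow> continuous_on UNIV f"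
proof (cases k)
  case (Suc m)
  moreover assume "Dk k f"
  ultimately obtain f' where "\<forall>x. (f has_real_derivative f' x) (at x)" by auto
  then show ?thesis by (metis DERIV_isCont continuous_at_imp_continuous_on)
qed auto

lemma Dk_Suc_imp: "Dk (Suc k) f \<Longrightarrow> Dk k f"
proof (induction k arbitrary: f)
  case 0
  then show ?case using Dk_continuous[of "Suc 0"] by simp
next
  case (Suc k)
  then obtain f' where "\<forall>x. (f has_real_derivative f' x) (at x)" "Dk (Suc k) f'" by auto
  with Suc.IH show ?case by auto
qed

lemma Dk_add: "Dk k f \<Longrightarrow> Dk k g \<Longrightarrow> Dk k (\<lambda>x. f x + g x)"
proof (induction k arbitrary: f g)
  case (Suc k)
  then obtain f' g' where "\<forall>x. (f has_real_derivative f' x) (at x)" "Dk k f'"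
    "\<forall>x. (g has_real_derivative g' x) (at x)" "Dk k g'" by auto
  with Suc.IH show ?case
    by (auto intro!: exI[of _ "\<lambda>x. f' x + g' x"] derivative_eq_intros)
qed (auto intro: continuous_intros)

lemma Dk_mult: "Dk k f \<Longrightarrow> Dk k g \<Longrightarrow> Dk k (\<lambda>x. f x * g x)"
proof (induction k arbitrary: f g)
  case (Suc k)
  from Suc.prems obtain f' g' where *: "\<forall>x. (f has_real_derivative f' x) (at x)" "Dk k f'"
    "\<forall>x. (g has_real_derivative g' x) (at x)" "Dk k g'" by auto
  have "Dk k (\<lambda>x. f' x * g x + g' x * f x)"
    using * Suc.prems[THEN Dk_Suc_imp] by (intro Dk_add Suc.IH) auto
  with * show ?case
    by (auto intro!: exI[of _ "\<lambda>x. f' x * g x + g' x * f x"] derivative_eq_intros)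
qed (auto intro: continuous_intros)

lemma Dk_const: "Dk k (\<lambda>x. c)"
  by (induction k arbitrary: c) (auto intro!: exI[of _ "\<lambda>_. 0"])

lemma Dk_affine: "Dk k f \<Longrightarrow> Dk k (\<lambda>x. f (c * x + d))"
proof (induction k arbitrary: f)
  case 0
  have "continuous_on UNIV (\<lambda>x. f (c * x + d))"
    by (rule continuous_on_compose2[of UNIV f]) (use 0 in \<open>auto intro!: continuous_intros\<close>)
  then show ?case by simp
next
  case (Suc k)
  then obtain f' where *: "\<forall>x. (f has_real_derivative f' x) (at x)" "Dk k f'" by auto
  have "((\<lambda>x. f (c * x + d)) has_real_derivative f' (c * x + d) * c) (at x)" for x
    by (rule DERIV_chain2[of f]) (use * in \<open>auto intro!: derivative_eq_intros\<close>)
  then show ?case using * Suc.IH[of f']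
    by (auto intro!: exI[of _ "\<lambda>x. f' (c * x + d) * c"] Dk_mult Dk_const)
qed

lemma smooth_mult: "smooth f \<Longrightarrow> smooth g \<Longrightarrow> smooth (\<lambda>x. f x * g x)"
  and smooth_affine: "smooth f \<Longrightarrow> smooth (\<lambda>x. f (c * x + d))"
  by (auto simp: smooth_def Dk_mult Dk_affine)

lemma smooth_continuous: "smooth f \<Longrightarrow> continuous_on UNIV f"
  by (auto simp: smooth_def intro: Dk_continuous)

text \<open>\<open>Dk\<close> supplies a derivative for each order separately; uniqueness of
  derivatives identifies them all with one function, which is therefore smooth.\<close>

lemma smooth_derivative: "smooth f \<Longrightarrow> \<exists>f'. (\<forall>x. (f has_real_derivative f' x) (at x)) \<and> smooth f'"
proof -
  assume f: "smooth f"
  then have "Dk (Suc 0) f" unfolding smooth_def by blast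
  then obtain f' where f': "\<forall>x. (f has_real_derivative f' x) (at x)" by auto
  have "Dk k f'" for k
  proof -
    have "Dk (Suc k) f" using f unfolding smooth_def by blast
    then obtain g where "\<forall>x. (f has_real_derivative g x) (at x)" "Dk k g" by auto
    moreover from this f' have "g = f'" by (auto intro!: ext DERIV_unique)
    ultimately show ?thesis by simp
  qed
  with f' show ?thesis by (auto simp: smooth_def)
qed

lemma smooth_antiderivative:
  assumes "\<And>x. (F has_real_derivative f x) (at x)" "smooth f"
  shows "smooth F"
proof -
  have "Dk (Suc k) F" for k
    using assms unfolding smooth_def Dk.simps by blast
  then have "Dk k F" for k by (rule Dk_Suc_imp)
  then show ?thesis by (simp add: smooth_def)
qed

text \<open>The derivatives of $e^{-1/t}$ have the form $P(1/t)e^{-1/t}$ with a polynomial $P$.\<close>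

definition flat :: "real poly \<Rightarrow> real \<Rightarrow> real" where
  "flat P t = (if t > 0 then poly P (1 / t) * exp (- (1 / t)) else 0)"

lemma poly_exp_tendsto_0: "((\<lambda>s. poly P s * exp (- s)) \<longlongrightarrow> (0::real)) at_top"
proof -
  have "((\<lambda>s. \<Sum>i\<le>degree P. coeff P i * (s ^ i / exp s)) \<longlongrightarrow> (\<Sum>i\<le>degree P. coeff P i * 0)) at_top"
    by (intro tendsto_intros tendsto_power_div_exp_0)
  then show ?thesis by (simp add: poly_altdef exp_minus sum_distrib_right divide_inverse mult.assoc)
qed

text \<open>Put s = 1/t: then d/dt = -s^2 d/ds, and P(s) e^(-s) has s-derivative (P' - P)(s) e^(-s),
  which explains the new polynomial s^2 (P - P'). At t = 0 the right difference quotient is s P(s)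
  e^(-s) with s tending to infinity.\<close>

lemma flat_has_derivative:
  "(flat P has_real_derivative flat ([:0, 0, 1:] * (P - pderiv P)) t) (at t)"
proof -
  consider "t > 0" | "t < 0" | "t = 0" by linarith
  then show ?thesis
  proof cases
    case 1
    have "((\<lambda>t. poly P (1 / t) * exp (- (1 / t))) has_real_derivative
        flat ([:0, 0, 1:] * (P - pderiv P)) t) (at t)"
      using 1 by (auto intro!: derivative_eq_intros simp: flat_def field_simps power2_eq_square)
    then show ?thesis
      by (rule has_field_derivative_transform_within_open[of _ _ _ "{0<..}"])
        (use 1 in \<open>auto simp: flat_def\<close>)
  next
    case 2
    have "((\<lambda>t. 0::real) has_real_derivative 0) (at t)" by simp
    then have "(flat P has_real_derivative 0) (at t)"
      by (rule has_field_derivative_transform_within_open[of _ _ _ "{..<0}"])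
        (use 2 in \<open>auto simp: flat_def\<close>)
    then show ?thesis using 2 by (simp add: flat_def)
  next
    case 3
    have "((\<lambda>h. flat P h / h) \<longlongrightarrow> 0) (at_right 0)"
    proof (rule Lim_transform_eventually)
      have "((\<lambda>h. poly (pCons 0 P) (inverse h) * exp (- (inverse h))) \<longlongrightarrow> (0::real)) (at_right 0)"
        by (rule filterlim_compose[OF poly_exp_tendsto_0 filterlim_inverse_at_top_right])
      then show "((\<lambda>h. inverse h * poly P (inverse h) * exp (- (inverse h))) \<longlongrightarrow> (0::real)) (at_right 0)"
        by simp
      show "\<forall>\<^sub>F x in at_right 0. inverse x * poly P (inverse x) * exp (- inverse x) = flat P x / x"
        by (intro eventually_at_rightI[of 0 1]) (auto simp: flat_def field_simps)
    qed
    moreover have "((\<lambda>h. flat P h / h) \<longlongrightarrow> 0) (at_left 0)"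
      by (rule Lim_transform_eventually[OF tendsto_const])
        (intro eventually_at_leftI[of "-1" 0], auto simp: flat_def)
    ultimately have "((\<lambda>h. flat P h / h) \<longlongrightarrow> 0) (at 0)"
      by (simp add: filterlim_split_at)
    then show ?thesis using 3 by (simp add: DERIV_def flat_def)
  qed
qed

lemma smooth_flat: "smooth (flat P)"
proof -
  have "Dk k (flat P)" for k
  proof (induction k arbitrary: P)
    case 0
    then show ?case
      using DERIV_continuous[OF flat_has_derivative] by (auto intro!: continuous_at_imp_continuous_on)
  next
    case (Suc k)
    then show ?case using flat_has_derivative by auto
  qed
  then show ?thesis by (simp add: smooth_def)
qed

text \<open>The parameter \<open>n\<close> steepens the profile: exp(-1/((n+1) d)) tends to 1 for d
  > 0, so these functions approximate interval indicators from inside. \<open>Suc n\<close> keeps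
  the slope positive, and the arguments are spelled as c * t + d to match
  \<open>smooth_affine\<close>.\<close>

definition bump :: "nat \<Rightarrow> real \<Rightarrow> real \<Rightarrow> real \<Rightarrow> real" where
  "bump n a b t = flat 1 (real (Suc n) * t + - (real (Suc n) * a)) * flat 1 ((- real (Suc n)) * t + real (Suc n) * b)"

lemma smooth_bump: "smooth (bump n a b)"
proof -
  have "bump n a b = (\<lambda>t. flat 1 (real (Suc n) * t + - (real (Suc n) * a)) * flat 1 ((- real (Suc n)) * t + real (Suc n) * b))"
    by (auto simp: bump_def)
  then show ?thesis
    by (simp only:) (intro smooth_mult smooth_affine smooth_flat)
qed

lemma flat_1: "0 \<le> flat 1 t" "flat 1 t \<le> 1" "flat 1 t > 0 \<longleftrightarrow> t > 0" "t \<le> 0 \<Longrightarrow> flat 1 t = 0"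
  by (auto simp: flat_def)

lemma bump_bounds: "0 \<le> bump n a b t" "bump n a b t \<le> 1"
  unfolding bump_def using flat_1 by (auto intro: mult_le_one)

lemma bump_pos_iff: "bump n a b t > 0 \<longleftrightarrow> a < t \<and> t < b"
proof -
  have "0 < real (Suc n) * t + - (real (Suc n) * a) \<longleftrightarrow> a < t"
    "0 < (- real (Suc n)) * t + real (Suc n) * b \<longleftrightarrow> t < b"
    by (auto simp del: of_nat_Suc)
  then show ?thesis unfolding bump_def
    using flat_1 by (metis (no_types, lifting) zero_less_mult_iff not_less)
qed

lemma bump_zero: "t \<notin> {a..b} \<Longrightarrow> bump n a b t = 0"
  using bump_pos_iff[of n a b t] bump_bounds(1)[of n a b t] by force

lemma bump_tendsto: "(\<lambda>n. bump n a b t) \<longlonglongrightarrow> indicator {a<..<b} t"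
proof (cases "a < t \<and> t < b")
  case True
  have *: "(\<lambda>n. flat 1 (real (Suc n) * d)) \<longlonglongrightarrow> 1" if "d > 0" for d
  proof -
    have "(\<lambda>n. exp (- (inverse (real (Suc n)) * (1 / d)))) \<longlonglongrightarrow> exp (- (0 * (1 / d)))"
      by (intro tendsto_intros LIMSEQ_inverse_real_of_nat)
    moreover have "flat 1 (real (Suc n) * d) = exp (- (inverse (real (Suc n)) * (1 / d)))" for n
      using that by (auto simp: flat_def field_simps simp del: of_nat_Suc)
    ultimately show ?thesis by simp
  qed
  have "bump n a b t = flat 1 (real (Suc n) * (t - a)) * flat 1 (real (Suc n) * (b - t))" for n
    by (simp add: bump_def algebra_simps)
  with tendsto_mult[OF *[of "t - a"] *[of "b - t"]] True show ?thesis by simp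
next
  case False
  then have "bump n a b t = 0" for n
    using bump_pos_iff[of n a b t] bump_bounds(1)[of n a b t] by force
  with False show ?thesis by (auto simp: indicator_def)
qed

section \<open>Smooth functions of several variables as products of one-variable functions\<close>

lemma C_k_continuous: "C_k k f \<Longrightarrow> continuous_on UNIV f"
  by (cases k) (auto intro!: differentiable_imp_continuous_on simp: differentiable_on_def intro: differentiable_at_withinI)

lemma C_k_Suc_imp: "C_k (Suc k) f \<Longrightarrow> C_k k f"
proof (induction k arbitrary: f)
  case 0
  then show ?case using C_k_continuous[of "Suc 0"] by simp
next
  case (Suc k)
  have "C_k k (\<lambda>x. frechet_derivative f (at x) v)" for v
    by (rule Suc.IH) (use Suc.prems in \<open>simp del: C_k.simps(1)\<close>)
  with Suc.prems show ?case by simp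
qed

lemma C_k_SucI:
  assumes "\<And>x. (f has_derivative f' x) (at x)" "\<And>v. C_k k (\<lambda>x. f' x v)"
  shows "C_k (Suc k) f"
proof -
  have "frechet_derivative f (at x) = f' x" for x
    using assms(1) by (metis frechet_derivative_at)
  with assms show ?thesis by (auto simp: differentiable_def)
qed

lemma C_k_SucD:
  assumes "C_k (Suc k) f"
  shows "(f has_derivative frechet_derivative f (at x)) (at x)" "C_k k (\<lambda>x. frechet_derivative f (at x) v)"
  using assms by (auto simp: frechet_derivative_works)

lemma C_k_const: "C_k k (\<lambda>x. c)"
proof (induction k arbitrary: c)
  case (Suc k)
  show ?case by (rule C_k_SucI[OF has_derivative_const]) (rule Suc.IH)
qed auto

lemma C_k_add: "C_k k f \<Longrightarrow> C_k k g \<Longrightarrow> C_k k (\<lambda>x. f x + g x)"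
proof (induction k arbitrary: f g)
  case (Suc k)
  show ?case
    by (rule C_k_SucI, rule has_derivative_add[OF Suc.prems[THEN C_k_SucD(1)]])
      (intro Suc.IH Suc.prems[THEN C_k_SucD(2)])
qed (auto intro: continuous_intros)

lemma C_k_mult: "C_k k f \<Longrightarrow> C_k k g \<Longrightarrow> C_k k (\<lambda>x. f x * g x)"
proof (induction k arbitrary: f g)
  case (Suc k)
  show ?case
    by (rule C_k_SucI, rule has_derivative_mult[OF Suc.prems[THEN C_k_SucD(1)]])
      (intro C_k_add Suc.IH Suc.prems[THEN C_k_SucD(2)] Suc.prems[THEN C_k_Suc_imp])
qed (auto intro: continuous_intros)

lemma has_derivative_coord:
  assumes "(f has_real_derivative D) (at (x $ i))"
  shows "((\<lambda>x. f (x $ i)) has_derivative (\<lambda>v. D * v $ i)) (at x)"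
proof -
  have "((\<lambda>x. x $ i) has_derivative (\<lambda>v. v $ i)) (at x)"
    by (intro bounded_linear_imp_has_derivative bounded_linear_vec_nth)
  from has_derivative_compose[OF this assms[unfolded has_field_derivative_def]] show ?thesis .
qed

lemma C_k_coord: "Dk k f \<Longrightarrow> C_k k (\<lambda>x. f (x $ i))"
proof (induction k arbitrary: f)
  case 0
  have "continuous_on UNIV (\<lambda>x::real^'a. f (x $ i))"
    by (rule continuous_on_compose2[of UNIV f]) (use 0 in \<open>auto intro!: continuous_intros\<close>)
  then show ?case by simp
next
  case (Suc k)
  then obtain f' where *: "\<forall>x. (f has_real_derivative f' x) (at x)" "Dk k f'" by auto
  have "((\<lambda>x. f (x $ i)) has_derivative (\<lambda>v. f' (x $ i) * v $ i)) (at x)" for x :: "real^'a"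
    by (rule has_derivative_coord) (use * in blast)
  then show ?case
    by (rule C_k_SucI) (intro C_k_mult C_k_const Suc.IH *)
qed

lemma C_k_prod: "finite S \<Longrightarrow> (\<And>j. j \<in> S \<Longrightarrow> C_k k (f j)) \<Longrightarrow> C_k k (\<lambda>x. \<Prod>j\<in>S. f j x)"
  by (induction S rule: finite_induct) (auto intro!: C_k_mult C_k_const)

lemma C_k_scale: "C_k k f \<Longrightarrow> C_k k (\<lambda>x. f (c *\<^sub>R x))"
proof (induction k arbitrary: f)
  case 0
  have "continuous_on UNIV (\<lambda>x. f (c *\<^sub>R x))"
    by (rule continuous_on_compose2[of UNIV f]) (use 0 in \<open>auto intro!: continuous_intros\<close>)
  then show ?case by simp
next
  case (Suc k)
  have "((\<lambda>x. f (c *\<^sub>R x)) has_derivative (\<lambda>v. frechet_derivative f (at (c *\<^sub>R x)) (c *\<^sub>R v))) (at x)" for x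
    by (rule has_derivative_compose[where f="\<lambda>x. c *\<^sub>R x" and g=f])
     (auto intro!: derivative_eq_intros C_k_SucD(1)[OF Suc.prems])
  then show ?case
    by (rule C_k_SucI) (intro Suc.IH[where f="\<lambda>x. frechet_derivative f (at x) (c *\<^sub>R _)"] C_k_SucD(2)[OF Suc.prems])
qed

definition tensor :: "('n \<Rightarrow> real \<Rightarrow> real) \<Rightarrow> real ^ 'n \<Rightarrow> real" where
  "tensor \<psi> x = (\<Prod>j\<in>UNIV. \<psi> j (x $ j))"

lemma tensor_zero:
  assumes "\<And>j t. t \<notin> {a $ j..b $ j} \<Longrightarrow> \<psi> j t = 0" "x \<notin> cbox a b"
  shows "tensor \<psi> x = 0"
  using assms by (auto simp: tensor_def mem_box_cart)

lemma test_function_tensor: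
  assumes "\<And>j. smooth (\<psi> j)" "\<And>j t. t \<notin> {a $ j..b $ j} \<Longrightarrow> \<psi> j t = 0"
  shows "test_function (tensor \<psi> :: real ^ 'n \<Rightarrow> real)"
proof -
  have "{x. tensor \<psi> x \<noteq> 0} \<subseteq> cbox a b" using tensor_zero[of a b \<psi>] assms(2) by blast
  then have "bounded {x. tensor \<psi> x \<noteq> 0}" by (rule bounded_subset[OF bounded_cbox])
  moreover have "C_k k (tensor \<psi>)" for k
    unfolding tensor_def[abs_def] using assms(1) by (intro C_k_prod C_k_coord) (auto simp: smooth_def)
  ultimately show ?thesis by (simp add: test_function_def)
qed

text \<open>A partial derivative touches a single factor, so it maps tensors to tensors. Prescribing
  a partial derivative thus reduces to finding an antiderivative in one variable.\<close>

lemma tensor_derivative: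
  assumes "\<And>j x. (\<psi> j has_real_derivative \<psi>' j x) (at x)"
  shows "frechet_derivative (tensor \<psi>) (at x) (axis i 1) = tensor (\<psi>(i := \<psi>' i)) x"
proof -
  have d: "((\<lambda>x. \<psi> j (x $ j)) has_derivative (\<lambda>v. \<psi>' j (x $ j) * v $ j)) (at x)" for j
    by (rule has_derivative_coord) (rule assms)
  have "(tensor \<psi> has_derivative (\<lambda>v. \<Sum>j\<in>UNIV. (\<psi>' j (x $ j) * v $ j) * (\<Prod>k\<in>UNIV - {j}. \<psi> k (x $ k)))) (at x)"
    unfolding tensor_def[abs_def] using d by (intro has_derivative_prod) auto
  then have "frechet_derivative (tensor \<psi>) (at x) (axis i 1) =
     (\<Sum>j\<in>UNIV. (\<psi>' j (x $ j) * axis i 1 $ j) * (\<Prod>k\<in>UNIV - {j}. \<psi> k (x $ k)))"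
    by (simp add: frechet_derivative_at[symmetric])
  also have "\<dots> = (\<Sum>j\<in>UNIV. if j = i then (\<psi>' j (x $ j)) * (\<Prod>k\<in>UNIV - {j}. \<psi> k (x $ k)) else 0)"
    by (rule sum.cong) (auto simp: axis_def)
  also have "\<dots> = \<psi>' i (x $ i) * (\<Prod>k\<in>UNIV - {i}. \<psi> k (x $ k))" by simp
  also have "\<dots> = tensor (\<psi>(i := \<psi>' i)) x"
    unfolding tensor_def by (subst (2) prod.remove[of _ i]) (auto intro!: prod.cong)
  finally show ?thesis .
qed

section \<open>The fundamental lemma and borel representatives\<close>

lemma norm_less_imp_mem_box:
  fixes x :: "'a::euclidean_space"
  assumes "norm x < c"
  shows "x \<in> box (- c *\<^sub>R One) (c *\<^sub>R One)"
proof -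
  have "\<bar>x \<bullet> b\<bar> < c" if "b \<in> Basis" for b
    using Basis_le_norm[OF that, of x] assms by linarith
  then show ?thesis by (auto simp: mem_box abs_less_iff) (smt (verit))
qed

text \<open>Centred boxes of integer half-width exhaust the space, and countably many null sets form
  a null set.\<close>

lemma AE_locally:
  fixes P :: "'a::euclidean_space \<Rightarrow> bool"
  assumes "\<And>a b. AE x in lborel. x \<in> box a b \<longrightarrow> P x"
  shows "AE x in lborel. P x"
proof -
  have "AE x in lborel. \<forall>n::nat. x \<in> box (- real n *\<^sub>R One) (real n *\<^sub>R One) \<longrightarrow> P x"
    using assms by (subst AE_all_countable) blast
  then show ?thesis
  proof (rule AE_mp, intro AE_I2 impI)
    fix x :: 'a
    assume *: "\<forall>n::nat. x \<in> box (- real n *\<^sub>R One) (real n *\<^sub>R One) \<longrightarrow> P x"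
    obtain k :: nat where "norm x < real k" using reals_Archimedean2 by blast
    with * show "P x" using norm_less_imp_mem_box by blast
  qed
qed

text \<open>Boxes are stable under intersection and generate the Borel sets, so a Dynkin argument
  spreads the vanishing to all Borel sets; uniqueness of densities then compares \<open>W\<close>
  with 0.\<close>

lemma AE_zero_if_box_integrals_zero:
  fixes W :: "'a::euclidean_space \<Rightarrow> real"
  assumes W: "integrable lborel W" and 0: "\<And>a b. (\<integral>x. indicator (box a b) x * W x \<partial>lborel) = 0"
  shows "AE x in lborel. W x = 0"
proof -
  have [measurable]: "W \<in> borel_measurable borel" using borel_measurable_integrable[OF W] by simp
  have dom: "integrable lborel (\<lambda>x. indicator A x * W x)" if "A \<in> sets borel" for A
    using integrable_mult_indicator[of A lborel W] that W by simp
  \<comment> \<open>The complement case of the induction needs the integral over the whole space,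
    obtained by exhausting it with boxes.\<close>
  have tot: "(\<integral>x. W x \<partial>lborel) = 0"
  proof (rule LIMSEQ_unique)
    show "(\<lambda>n. \<integral>x. indicator (box (- real n *\<^sub>R One) (real n *\<^sub>R One)) x * W x \<partial>lborel) \<longlonglongrightarrow> (\<integral>x. W x \<partial>lborel)"
    proof (rule integral_dominated_convergence[where w="\<lambda>x. \<bar>W x\<bar>"])
      show "AE x in lborel. (\<lambda>i. indicator (box (- real i *\<^sub>R One) (real i *\<^sub>R One)) x * W x) \<longlonglongrightarrow> W x"
      proof (rule AE_I2)
        fix x :: 'a
        obtain k :: nat where k: "norm x < real k" using reals_Archimedean2 by blast
        have "x \<in> box (- real i *\<^sub>R One) (real i *\<^sub>R One)" if "i \<ge> k" for i
          using k that by (intro norm_less_imp_mem_box) simp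
        then have "\<forall>\<^sub>F i in sequentially. W x = indicator (box (- real i *\<^sub>R One) (real i *\<^sub>R One)) x * W x"
          by (intro eventually_sequentiallyI[of k]) auto
        then show "(\<lambda>i. indicator (box (- real i *\<^sub>R One) (real i *\<^sub>R One)) x * W x) \<longlonglongrightarrow> W x"
          by (rule Lim_transform_eventually[OF tendsto_const])
      qed
      show "\<And>i. AE x in lborel. norm (indicator (box (- real i *\<^sub>R One) (real i *\<^sub>R One)) x * W x) \<le> \<bar>W x\<bar>"
        by (rule AE_I2) (auto simp: indicator_def)
    qed (use W in \<open>auto intro: borel_measurable_integrable\<close>)
  qed (simp only: 0 tendsto_const)
  have "(\<integral>x. indicator A x * W x \<partial>lborel) = 0" if A: "A \<in> sets borel" for A
  proof -
    have "Int_stable  (range (\<lambda>(a, b). box a b :: 'a set))"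
      by (auto simp: Int_stable_def box_Int_box)
    moreover have "(range (\<lambda>(a, b). box a b)) \<subseteq> Pow (UNIV :: 'a set)" by auto
    moreover have "A \<in> sigma_sets UNIV (range (\<lambda>(a, b). box a b))"
       using A unfolding borel_eq_box by simp
    ultimately show ?thesis
    proof (induction rule: sigma_sets_induct_disjoint)
      case (basic A) then show ?case using 0 by auto
    next
      case empty then show ?case by simp
    next
      case (compl A)
      then have [measurable]: "A \<in> sets borel" by (simp add: borel_eq_box)
      have "(\<integral>x. indicator (UNIV - A) x * W x \<partial>lborel) = (\<integral>x. W x - indicator A x * W x \<partial>lborel)"
        by (rule Bochner_Integration.integral_cong) (auto simp: indicator_def)
      also have "\<dots> = 0" using compl tot W dom[of A] by simp
      finally show ?case .
    next
      case (union F)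
      then have F[measurable]: "\<And>i. F i \<in> sets borel" by (simp add: borel_eq_box subset_eq)
      have disj: "F i \<inter> F j = {}" if "i \<noteq> j" for i j
        using union(1) that by (auto simp: disjoint_family_on_def)
      have "set_integrable lborel (\<Union>i. F i) W" unfolding set_integrable_def using dom[of "\<Union>i. F i"] by simp
      from lebesgue_integral_countable_add[OF _ disj this]
      have "(\<integral>x. indicator (\<Union>i. F i) x * W x \<partial>lborel) = (\<Sum>i. \<integral>x. indicator (F i) x * W x \<partial>lborel)"
        unfolding set_lebesgue_integral_def by simp
      then show ?case using union.IH by simp
    qed
  qed
  then show ?thesis
    using density_unique_real[of lborel W "\<lambda>_. 0"] W by (simp add: set_lebesgue_integral_def)
qed

definition box_bump :: "nat \<Rightarrow> real ^ 'n \<Rightarrow> real ^ 'n \<Rightarrow> real ^ 'n \<Rightarrow> real" where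
  "box_bump n a b = tensor (\<lambda>j. bump n (a $ j) (b $ j))"

lemma test_function_box_bump: "test_function (box_bump n a b)"
  unfolding box_bump_def by (rule test_function_tensor[of _ a b]) (auto intro: smooth_bump bump_zero)

lemma test_function_continuous: "test_function \<phi> \<Longrightarrow> continuous_on UNIV \<phi>"
  unfolding test_function_def using C_k_continuous by blast

lemma test_function_borel: "test_function \<phi> \<Longrightarrow> \<phi> \<in> borel_measurable borel"
  by (rule borel_measurable_continuous_onI) (rule test_function_continuous)

lemma test_function_derivative:
  assumes "test_function \<phi>"
  shows "(\<phi> has_derivative frechet_derivative \<phi> (at x)) (at x)"
    "continuous_on UNIV (\<lambda>x. frechet_derivative \<phi> (at x) v)"
    "(\<lambda>x. frechet_derivative \<phi> (at x) v) \<in> borel_measurable borel"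
proof -
  have *: "C_k (Suc 0) \<phi>" using assms unfolding test_function_def by blast
  show "(\<phi> has_derivative frechet_derivative \<phi> (at x)) (at x)" using C_k_SucD(1)[OF *] .
  show "continuous_on UNIV (\<lambda>x. frechet_derivative \<phi> (at x) v)" using C_k_SucD(2)[OF *] by simp
  then show "(\<lambda>x. frechet_derivative \<phi> (at x) v) \<in> borel_measurable borel"
    by (rule borel_measurable_continuous_onI)
qed

lemma box_bump_borel [measurable]: "box_bump n a b \<in> borel_measurable borel"
  by (rule test_function_borel[OF test_function_box_bump])

lemma box_bump_bounds: "0 \<le> box_bump n a b x" "box_bump n a b x \<le> indicator (cbox a b) x"
proof -
  show "0 \<le> box_bump n a b x" unfolding box_bump_def tensor_def by (intro prod_nonneg) (auto simp: bump_bounds)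
  have "box_bump n a b x \<le> 1" unfolding box_bump_def tensor_def by (intro prod_le_1) (auto simp: bump_bounds)
  moreover have "x \<notin> cbox a b \<Longrightarrow> box_bump n a b x = 0"
    unfolding box_bump_def by (rule tensor_zero[of a b]) (auto intro: bump_zero)
  ultimately show "box_bump n a b x \<le> indicator (cbox a b) x" by (cases "x \<in> cbox a b") auto
qed

lemma abs_mult_box_bump: "\<bar>w * box_bump n a b x\<bar> \<le> \<bar>indicator (cbox a b) x * w\<bar>"
proof -
  have "\<bar>box_bump n a b x\<bar> \<le> indicator (cbox a b) x"
    using box_bump_bounds[where n=n and a=a and b=b and x=x] by auto
  from mult_left_mono[OF this, of "\<bar>w\<bar>"] show ?thesis by (simp add: abs_mult mult.commute)
qed

lemma integrable_mult_box_bump: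
  assumes "w \<in> borel_measurable borel" "integrable lborel (\<lambda>x. indicator (cbox a b) x * w x)"
  shows "integrable lborel (\<lambda>x. w x * box_bump n a b x)"
  by (rule Bochner_Integration.integrable_bound[OF assms(2)])
    (use assms(1) in simp, simp only: real_norm_def abs_mult_box_bump AE_I2)

lemma box_bump_pos: "x \<in> box a b \<Longrightarrow> box_bump n a b x > 0"
  unfolding box_bump_def tensor_def by (intro prod_pos) (auto simp: bump_pos_iff mem_box_cart)

lemma box_bump_tendsto: "(\<lambda>n. box_bump n a b x) \<longlonglongrightarrow> indicator (box a b) x"
proof -
  have "(\<lambda>n. box_bump n a b x) \<longlonglongrightarrow> (\<Prod>j\<in>UNIV. indicator {a $ j<..<b $ j} (x $ j))"
    unfolding box_bump_def tensor_def by (intro tendsto_prod bump_tendsto)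
  also have "(\<Prod>j\<in>UNIV. indicator {a $ j<..<b $ j} (x $ j)) = (indicator (box a b) x :: real)"
  proof (cases "x \<in> box a b")
    case True
    then show ?thesis by (auto simp: mem_box_cart intro!: prod.neutral)
  next
    case False
    then obtain j where "x $ j \<notin> {a $ j<..<b $ j}" by (auto simp: mem_box_cart)
    then show ?thesis using False by (auto intro!: prod_zero exI[of _ j])
  qed
  finally show ?thesis .
qed

text \<open>The bumps converge to box indicators under the dominating function given by the closed
  box, so all box integrals of \<open>w\<close> vanish. Localizing to one box makes \<open>w\<close>
  integrable, and since two boxes intersect in a box the localized function still has vanishing box
  integrals.\<close>

lemma fundamental_lemma:
  fixes w :: "real ^ 'n \<Rightarrow> real"
  assumes w: "w \<in> borel_measurable borel"
    and int: "\<And>a b. integrable lborel (\<lambda>x. indicator (cbox a b) x * w x)"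
    and 0: "\<And>n a b. (\<integral>x. w x * box_bump n a b x \<partial>lborel) = 0"
  shows "AE x in lborel. w x = 0"
proof (rule AE_locally)
  note [measurable] = w
  have int': "integrable lborel (\<lambda>x. indicator (box a b) x * w x)" for a b
    by (rule Bochner_Integration.integrable_bound[OF int[of a b]]) (use box_subset_cbox in \<open>auto simp: indicator_def\<close>)
  have box0: "(\<integral>x. indicator (box a b) x * w x \<partial>lborel) = 0" for a b
  proof (rule LIMSEQ_unique)
    show "(\<lambda>n. \<integral>x. w x * box_bump n a b x \<partial>lborel) \<longlonglongrightarrow> (\<integral>x. indicator (box a b) x * w x \<partial>lborel)"
    proof (rule integral_dominated_convergence[where w="\<lambda>x. \<bar>indicator (cbox a b) x * w x\<bar>"])
      show "AE x in lborel. (\<lambda>i. w x * box_bump i a b x) \<longlonglongrightarrow> indicator (box a b) x * w x"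
        by (rule AE_I2) (simp only: mult.commute[of _ "w _"] tendsto_mult_left box_bump_tendsto)
      show "\<And>i. AE x in lborel. norm (w x * box_bump i a b x) \<le> \<bar>indicator (cbox a b) x * w x\<bar>"
        by (intro AE_I2) (simp add: abs_mult_box_bump)
    qed (use int[of a b] in auto)
  qed (simp only: 0 tendsto_const)
  fix a b :: "real ^ 'n"
  have "AE x in lborel. indicator (box a b) x * w x = 0"
  proof (rule AE_zero_if_box_integrals_zero[OF int'])
    fix c d :: "real ^ 'n"
    have "indicator (box c d) x * (indicator (box a b) x * w x) = indicator (box c d \<inter> box a b) x * w x" for x
      by (simp add: indicator_def)
    then show "(\<integral>x. indicator (box c d) x * (indicator (box a b) x * w x) \<partial>lborel) = 0"
      by (simp only: box_Int_box box0)
  qed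
  then show "AE x in lborel. x \<in> box a b \<longrightarrow> w x = 0" by eventually_elim (auto simp: indicator_def)
qed

text \<open>Componentwise and over \<open>lborel\<close>: Borel representatives make maps such as
  (s, x) \<mapsto> g (x + s e) measurable for the product measure, which Fubini requires and
  Lebesgue measurability does not guarantee.\<close>

definition borel_weak_gradient :: "(real ^ 'n \<Rightarrow> real) \<Rightarrow> ('n \<Rightarrow> real ^ 'n \<Rightarrow> real) \<Rightarrow> bool" where
  "borel_weak_gradient u g \<longleftrightarrow> u \<in> borel_measurable borel \<and> (\<forall>i. g i \<in> borel_measurable borel) \<and>
    (\<forall>a b. integrable lborel (\<lambda>x. indicator (cbox a b) x * u x)) \<and>
    (\<forall>i a b. integrable lborel (\<lambda>x. indicator (cbox a b) x * g i x)) \<and>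
    (\<forall>\<phi> i. test_function \<phi> \<longrightarrow>
      (\<integral>x. u x * frechet_derivative \<phi> (at x) (axis i 1) \<partial>lborel) = - (\<integral>x. g i x * \<phi> x \<partial>lborel))"

lemma integral_lebesgue_eq_lborel:
  fixes f g :: "'a::euclidean_space \<Rightarrow> 'b::{banach, second_countable_topology}"
  assumes "f \<in> borel_measurable lebesgue" "g \<in> borel_measurable borel" "AE x in lborel. f x = g x"
  shows "(\<integral>x. f x \<partial>lebesgue) = (\<integral>x. g x \<partial>lborel)" "integrable lebesgue f \<longleftrightarrow> integrable lborel g"
proof -
  have g: "g \<in> borel_measurable lborel" using assms by simp
  then have gl: "g \<in> borel_measurable lebesgue" by (rule measurable_completion)
  have AE: "AE x in lebesgue. f x = g x" using assms by (simp add: AE_completion)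
  show "(\<integral>x. f x \<partial>lebesgue) = (\<integral>x. g x \<partial>lborel)"
    using integral_cong_AE[OF assms(1) gl AE] integral_completion[OF g] by simp
  show "integrable lebesgue f \<longleftrightarrow> integrable lborel g"
    using integrable_cong_AE[OF assms(1) gl AE] integrable_completion[OF g] by simp
qed

lemma locally_integrable_integrable_cbox:
  assumes "locally_integrable f"
  shows "integrable lebesgue (\<lambda>x. indicator (cbox a b) x *\<^sub>R f x)"
  using assms unfolding locally_integrable_def set_integrable_def using compact_cbox by blast

lemma has_weak_gradient_borel:
  fixes u :: "real ^ 'n \<Rightarrow> real"
  assumes "has_weak_gradient u G"
  obtains u' g where "borel_weak_gradient u' g" "AE x in lborel. u x = u' x" "AE x in lborel. \<forall>i. G x $ i = g i x"
proof -
  from assms have li: "locally_integrable u" "locally_integrable G" by (auto simp: has_weak_gradient_def)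
  then have mu: "u \<in> borel_measurable lebesgue" and mG: "G \<in> borel_measurable lebesgue"
    by (auto simp: locally_integrable_def)
  have mGi: "(\<lambda>x. G x $ i) \<in> borel_measurable lebesgue" for i
    by (rule measurable_compose[OF mG]) simp
  obtain u' where u': "u' \<in> borel_measurable lborel" "AE x in lborel. u x = u' x"
    using completion_ex_borel_measurable_real[OF mu] by blast
  have "\<forall>i. \<exists>g. g \<in> borel_measurable lborel \<and> (AE x in lborel. G x $ i = g x)"
    using completion_ex_borel_measurable_real[OF mGi] by blast
  then obtain g where g: "\<And>i. g i \<in> borel_measurable lborel" "\<And>i. AE x in lborel. G x $ i = g i x"
    by metis
  have b: "u' \<in> borel_measurable borel" "\<And>i. g i \<in> borel_measurable borel" using u' g by auto
  note [measurable] = b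
  have "borel_weak_gradient u' g"
    unfolding borel_weak_gradient_def
  proof (intro conjI allI impI b)
    fix a b :: "real ^ 'n"
    have "integrable lebesgue (\<lambda>x. indicator (cbox a b) x * u x)"
      using locally_integrable_integrable_cbox[OF li(1)] by simp
    moreover have "integrable lebesgue (\<lambda>x. indicator (cbox a b) x * u x) \<longleftrightarrow> integrable lborel (\<lambda>x. indicator (cbox a b) x * u' x)"
      by (rule integral_lebesgue_eq_lborel) (use u' mu in \<open>auto intro!: borel_measurable_times borel_measurable_indicator\<close>)
    ultimately show "integrable lborel (\<lambda>x. indicator (cbox a b) x * u' x)" by simp
    fix i
    have "integrable lebesgue (\<lambda>x. (indicator (cbox a b) x *\<^sub>R G x) $ i)"
      using integrable_bounded_linear[OF bounded_linear_vec_nth locally_integrable_integrable_cbox[OF li(2)]] .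
    then have "integrable lebesgue (\<lambda>x. indicator (cbox a b) x * (G x $ i))" by simp
    moreover have "integrable lebesgue (\<lambda>x. indicator (cbox a b) x * (G x $ i)) \<longleftrightarrow> integrable lborel (\<lambda>x. indicator (cbox a b) x * g i x)"
    proof (rule integral_lebesgue_eq_lborel)
      show "AE x in lborel. indicator (cbox a b) x * G x $ i = indicator (cbox a b) x * g i x"
        using g(2)[of i] by eventually_elim simp
    qed (use mGi in \<open>auto intro!: borel_measurable_times borel_measurable_indicator\<close>)
    ultimately show "integrable lborel (\<lambda>x. indicator (cbox a b) x * g i x)" by simp
  next
    fix \<phi> :: "real ^ 'n \<Rightarrow> real" and i assume \<phi>: "test_function \<phi>"
    note [measurable] = test_function_borel[OF \<phi>] test_function_derivative(3)[OF \<phi>]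
    have ml: "\<phi> \<in> borel_measurable lebesgue" "(\<lambda>x. frechet_derivative \<phi> (at x) v) \<in> borel_measurable lebesgue" for v
      by (rule measurable_completion; simp)+
    have "(\<integral>x. u x * frechet_derivative \<phi> (at x) (axis i 1) \<partial>lebesgue) = (\<integral>x. u' x * frechet_derivative \<phi> (at x) (axis i 1) \<partial>lborel)"
    proof (rule integral_lebesgue_eq_lborel)
      show "AE x in lborel. u x * frechet_derivative \<phi> (at x) (axis i 1) = u' x * frechet_derivative \<phi> (at x) (axis i 1)"
        using u'(2) by eventually_elim simp
    qed (use mu ml in auto)
    moreover have "(\<integral>x. G x $ i * \<phi> x \<partial>lebesgue) = (\<integral>x. g i x * \<phi> x \<partial>lborel)"
    proof (rule integral_lebesgue_eq_lborel)
      show "AE x in lborel. G x $ i * \<phi> x = g i x * \<phi> x"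
        using g(2)[of i] by eventually_elim simp
    qed (use mGi ml in auto)
    ultimately show "(\<integral>x. u' x * frechet_derivative \<phi> (at x) (axis i 1) \<partial>lborel) = - (\<integral>x. g i x * \<phi> x \<partial>lborel)"
      using assms \<phi> by (simp add: has_weak_gradient_def)
  qed
  moreover have "AE x in lborel. \<forall>i. G x $ i = g i x" using g(2) by (simp add: AE_all_countable eventually_all_finite)
  ultimately show thesis using that u'(2) by blast
qed

text \<open>Against a box bump both gradients give the same value, minus the integral of the
  function against the derivative of the bump; \<open>fundamental_lemma\<close> applies to their
  difference.\<close>

lemma borel_weak_gradient_unique:
  fixes u v :: "real ^ 'n \<Rightarrow> real"
  assumes "borel_weak_gradient u g" "borel_weak_gradient v h" "AE x in lborel. u x = v x"
  shows "AE x in lborel. g i x = h i x"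
proof -
  from assms have [measurable]: "u \<in> borel_measurable borel" "v \<in> borel_measurable borel"
    "g i \<in> borel_measurable borel" "h i \<in> borel_measurable borel"
    by (auto simp: borel_weak_gradient_def)
  have gi: "integrable lborel (\<lambda>x. indicator (cbox a b) x * g i x)"
    "integrable lborel (\<lambda>x. indicator (cbox a b) x * h i x)" for a b
    using assms by (auto simp: borel_weak_gradient_def)
  have "AE x in lborel. g i x - h i x = 0"
  proof (rule fundamental_lemma)
    show "integrable lborel (\<lambda>x. indicator (cbox a b) x * (g i x - h i x))" for a b
      using Bochner_Integration.integrable_diff[OF gi] by (simp add: algebra_simps)
    fix n and a b :: "real ^ 'n"
    let ?\<phi> = "box_bump n a b"
    note \<phi> = test_function_box_bump[of n a b]
    note [measurable] = test_function_borel[OF \<phi>] test_function_derivative(3)[OF \<phi>]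
    have i: "integrable lborel (\<lambda>x. g i x * ?\<phi> x)" "integrable lborel (\<lambda>x. h i x * ?\<phi> x)"
      using integrable_mult_box_bump[OF _ gi(1)] integrable_mult_box_bump[OF _ gi(2)] by auto
    have "- (\<integral>x. g i x * ?\<phi> x \<partial>lborel) = (\<integral>x. u x * frechet_derivative ?\<phi> (at x) (axis i 1) \<partial>lborel)"
      using assms(1) \<phi> by (simp add: borel_weak_gradient_def)
    also have "\<dots> = (\<integral>x. v x * frechet_derivative ?\<phi> (at x) (axis i 1) \<partial>lborel)"
    proof (rule integral_cong_AE)
      show "AE x in lborel. u x * frechet_derivative ?\<phi> (at x) (axis i 1) = v x * frechet_derivative ?\<phi> (at x) (axis i 1)"
        using assms(3) by eventually_elim simp
    qed auto
    also have "\<dots> = - (\<integral>x. h i x * ?\<phi> x \<partial>lborel)"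
      using assms(2) \<phi> by (simp add: borel_weak_gradient_def)
    finally show "(\<integral>x. (g i x - h i x) * ?\<phi> x \<partial>lborel) = 0"
      using i by (simp add: left_diff_distrib)
  qed auto
  then show ?thesis by simp
qed

text \<open>This is what makes the choice in \<open>weak_gradient\<close> immaterial for every
  integral of the gradient.\<close>

lemma has_weak_gradient_unique:
  assumes "has_weak_gradient u G" "has_weak_gradient u H"
  shows "AE x in lebesgue. G x = H x"
proof -
  obtain u1 g where 1: "borel_weak_gradient u1 g" "AE x in lborel. u x = u1 x" "AE x in lborel. \<forall>i. G x $ i = g i x"
    using has_weak_gradient_borel[OF assms(1)] .
  obtain u2 h where 2: "borel_weak_gradient u2 h" "AE x in lborel. u x = u2 x" "AE x in lborel. \<forall>i. H x $ i = h i x"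
    using has_weak_gradient_borel[OF assms(2)] .
  have "AE x in lborel. u1 x = u2 x" using 1(2) 2(2) by eventually_elim simp
  then have "AE x in lborel. \<forall>i. g i x = h i x"
    using borel_weak_gradient_unique[OF 1(1) 2(1)] by (simp add: eventually_all_finite)
  then have "AE x in lborel. G x = H x" using 1(3) 2(3) by eventually_elim (simp add: vec_eq_iff)
  then show ?thesis by (simp add: AE_completion)
qed

section \<open>Weak gradients along lines\<close>

lemma smooth_diff:
  assumes "smooth f" "smooth g"
  shows "smooth (\<lambda>x. f x - g x)"
proof -
  have "Dk k (\<lambda>x. f x + (- 1) * g x)" for k
    using assms by (intro Dk_add Dk_mult Dk_const) (auto simp: smooth_def)
  then show ?thesis by (simp add: smooth_def)
qed

lemma continuous_has_antiderivative:
  fixes f :: "real \<Rightarrow> real"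
  assumes "continuous_on UNIV f"
  shows "\<exists>F. \<forall>x. (F has_real_derivative f x) (at x)"
proof (intro exI allI)
  fix x :: real
  let ?b = "\<bar>x\<bar> + 1"
  have "((\<lambda>u. LBINT y=0..u. f y) has_vector_derivative f x) (at x within {-?b..?b})"
    using interval_integral_FTC2[of "-?b" 0 ?b f x] continuous_on_subset[OF assms] by (simp add: zero_ereal_def)
  moreover have "x \<in> interior {-?b..?b}" by auto
  ultimately show "((\<lambda>u. LBINT y=0..u. f y) has_real_derivative f x) (at x)"
    by (simp only: at_within_interior has_real_derivative_iff_has_vector_derivative)
qed

lemma tensor_split: "tensor \<psi> x = \<psi> i (x $ i) * (\<Prod>j\<in>UNIV - {i}. \<psi> j (x $ j))"
  unfolding tensor_def by (rule prod.remove) auto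

text \<open>Made to order for \<open>line_identity\<close>: testing an increment of \<open>u\<close>
  with a box bump z asks for a test function whose partial derivative is z minus its translate. It
  is the increment over \<open>h\<close> of an antiderivative of z in coordinate \<open>i\<close>;
  its integral form is the one that Fubini uses.\<close>

lemma shifted_bump_test_function:
  fixes a b :: "real ^ 'n"
  assumes "h \<ge> 0"
  obtains \<phi> where "test_function \<phi>"
    "\<And>x. frechet_derivative \<phi> (at x) (axis i 1) = box_bump n a b x - box_bump n a b (x - h *\<^sub>R axis i 1)"
    "\<And>x. \<phi> x = (\<integral>s. indicator {0..h} s * box_bump n a b (x - s *\<^sub>R axis i 1) \<partial>lborel)"
proof -
  define \<psi> where "\<psi> j = bump n (a $ j) (b $ j)" for j
  have s\<psi>: "smooth (\<psi> j)" for j unfolding \<psi>_def by (rule smooth_bump)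
  have z\<psi>: "\<psi> j t = 0" if "t \<notin> {a $ j..b $ j}" for j t
    unfolding \<psi>_def using that by (rule bump_zero)
  have bb: "box_bump n a b = tensor \<psi>" by (simp add: box_bump_def \<psi>_def[abs_def])
  obtain \<Psi> where \<Psi>: "\<And>x. (\<Psi> has_real_derivative \<psi> i x) (at x)"
    using continuous_has_antiderivative[OF smooth_continuous[OF s\<psi>[of i]]] by blast
  define \<Phi> where "\<Phi> t = \<Psi> t - \<Psi> (1 * t + - h)" for t
  define \<Phi>' where "\<Phi>' t = \<psi> i t - \<psi> i (t - h)" for t
  have s\<Psi>: "smooth \<Psi>" by (rule smooth_antiderivative[OF \<Psi> s\<psi>])
  have s\<Phi>: "smooth \<Phi>" unfolding \<Phi>_def[abs_def] by (intro smooth_diff smooth_affine s\<Psi>)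
  have d\<Phi>: "(\<Phi> has_real_derivative \<Phi>' t) (at t)" for t
  proof -
    have "((\<lambda>t. 1 * t + - h) has_real_derivative 1) (at t)" by (auto intro!: derivative_eq_intros)
    from DERIV_diff[OF \<Psi>[of t] DERIV_chain2[OF \<Psi>[of "1 * t + - h"] this]] show ?thesis
      unfolding \<Phi>_def[abs_def] \<Phi>'_def by simp
  qed
  have int\<Phi>: "(\<integral>s. indicator {0..h} s * \<psi> i (t - s) \<partial>lborel) = \<Phi> t" for t
  proof -
    have "(\<integral>s. \<psi> i (t - s) * indicator {0..h} s \<partial>lborel) = (- \<Psi> (t - h)) - (- \<Psi> (t - 0))"
    proof (rule integral_FTC_Icc_real[OF assms])
      show "((\<lambda>s. - \<Psi> (t - s)) has_real_derivative \<psi> i (t - s)) (at s)" for s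
      proof -
        have "((\<lambda>s. t - s) has_real_derivative - 1) (at s)" by (auto intro!: derivative_eq_intros)
        from DERIV_minus[OF DERIV_chain2[OF \<Psi>[of "t - s"] this]] show ?thesis by simp
      qed
      have "isCont (\<psi> i) y" for y using smooth_continuous[OF s\<psi>[of i]] by (simp add: continuous_on_eq_continuous_at)
      then show "isCont (\<lambda>s. \<psi> i (t - s)) s" for s
        by (rule isCont_o2[where g="\<psi> i" and f="\<lambda>s. t - s", rotated]) (simp add: continuous_diff)
    qed
    then show ?thesis by (simp add: \<Phi>_def mult.commute)
  qed
  have "test_function (tensor (\<psi>(i := \<Phi>)))"
  \<comment> \<open>The antiderivative \<open>\<Psi>\<close> itself need not have compact support,
    but its increment \<open>\<Phi>\<close> vanishes below \<open>a $ i\<close> and above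
    \<open>b $ i + h\<close>, hence the enlarged corner.\<close>
  proof (rule test_function_tensor[of _ a "b + h *\<^sub>R axis i 1"])
    show "smooth ((\<psi>(i := \<Phi>)) j)" for j using s\<psi> s\<Phi> by simp
    fix j t assume t: "t \<notin> {a $ j..(b + h *\<^sub>R axis i 1) $ j}"
    show "(\<psi>(i := \<Phi>)) j t = 0"
    proof (cases "j = i")
      case True
      have "indicator {0..h} s * \<psi> i (t - s) = 0" for s
        using t True z\<psi>[of "t - s" i] by (cases "s \<in> {0..h}") (auto simp: axis_def)
      then have "\<Phi> t = 0" unfolding int\<Phi>[symmetric] by (simp only: integral_zero)
      then show ?thesis using True by simp
    next
      case False
      then show ?thesis using t z\<psi> by (simp add: axis_def)
    qed
  qed
  moreover have "frechet_derivative (tensor (\<psi>(i := \<Phi>))) (at x) (axis i 1) = box_bump n a b x - box_bump n a b (x - h *\<^sub>R axis i 1)" for x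
  proof -
    have "\<forall>j. \<exists>d. \<forall>x. ((\<psi>(i := \<Phi>)) j has_real_derivative d x) (at x)"
      using smooth_derivative[OF s\<psi>] d\<Phi> by (auto simp: fun_upd_def) metis+
    then obtain d where d: "\<And>j x. ((\<psi>(i := \<Phi>)) j has_real_derivative d j x) (at x)" by metis
    have di: "d i = \<Phi>'" using d[of i] d\<Phi> by (auto intro!: ext intro: DERIV_unique)
    have "frechet_derivative (tensor (\<psi>(i := \<Phi>))) (at x) (axis i 1) = tensor ((\<psi>(i := \<Phi>))(i := d i)) x"
      using tensor_derivative[OF d] .
    also have "\<dots> = \<Phi>' (x $ i) * (\<Prod>j\<in>UNIV - {i}. \<psi> j (x $ j))"
      unfolding di tensor_split[where i=i] by simp
    also have "\<dots> = tensor \<psi> x - tensor \<psi> (x - h *\<^sub>R axis i 1)"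
    proof -
      have "(\<Prod>j\<in>UNIV - {i}. \<psi> j ((x - h *\<^sub>R axis i 1) $ j)) = (\<Prod>j\<in>UNIV - {i}. \<psi> j (x $ j))"
        by (rule prod.cong) (auto simp: axis_def)
      then show ?thesis unfolding tensor_split[where i=i] \<Phi>'_def by (simp add: algebra_simps axis_def)
    qed
    finally show ?thesis by (simp add: bb)
  qed
  moreover have "tensor (\<psi>(i := \<Phi>)) x = (\<integral>s. indicator {0..h} s * box_bump n a b (x - s *\<^sub>R axis i 1) \<partial>lborel)" for x
  proof -
    have "(\<Prod>j\<in>UNIV - {i}. \<psi> j ((x - s *\<^sub>R axis i 1) $ j)) = (\<Prod>j\<in>UNIV - {i}. \<psi> j (x $ j))" for s
      by (rule prod.cong) (auto simp: axis_def)
    then have "box_bump n a b (x - s *\<^sub>R axis i 1) = \<psi> i (x $ i - s) * (\<Prod>j\<in>UNIV - {i}. \<psi> j (x $ j))" for s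
      unfolding bb tensor_split[where i=i] by (simp add: axis_def)
    then have "(\<integral>s. indicator {0..h} s * box_bump n a b (x - s *\<^sub>R axis i 1) \<partial>lborel) =
      (\<integral>s. (indicator {0..h} s * \<psi> i (x $ i - s)) * (\<Prod>j\<in>UNIV - {i}. \<psi> j (x $ j)) \<partial>lborel)"
      by (simp add: mult.assoc)
    also have "\<dots> = \<Phi> (x $ i) * (\<Prod>j\<in>UNIV - {i}. \<psi> j (x $ j))"
      by (simp add: int\<Phi>)
    finally show ?thesis unfolding tensor_split[where i=i and \<psi>="\<psi>(i := \<Phi>)"] by simp
  qed
  ultimately show thesis using that by blast
qed

lemma nn_integral_translate:
  fixes f :: "'a::euclidean_space \<Rightarrow> ennreal"
  assumes [measurable]: "f \<in> borel_measurable borel"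
  shows "(\<integral>\<^sup>+x. f (x + c) \<partial>lborel) = (\<integral>\<^sup>+x. f x \<partial>lborel)"
  by (subst (2) lborel_distr_plus[symmetric, of c]) (simp add: nn_integral_distr add.commute)

lemma integral_translate:
  fixes f :: "'a::euclidean_space \<Rightarrow> real"
  assumes [measurable]: "f \<in> borel_measurable borel"
  shows "(\<integral>x. f (x + c) \<partial>lborel) = (\<integral>x. f x \<partial>lborel)"
  by (subst (2) lborel_distr_plus[symmetric, of c]) (simp add: integral_distr add.commute)

lemma integrable_translate:
  fixes f :: "'a::euclidean_space \<Rightarrow> real"
  assumes [measurable]: "f \<in> borel_measurable borel" and "integrable lborel f"
  shows "integrable lborel (\<lambda>x. f (x + c))"
  using assms(2) nn_integral_translate[of "\<lambda>x. ennreal (norm (f x))" c] by (simp add: integrable_iff_bounded)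

lemma shifted_cbox_subset:
  fixes a b e :: "'a::euclidean_space"
  obtains c where "\<And>s x. s \<in> {0..h} \<Longrightarrow> x \<in> cbox a b \<Longrightarrow> x + s *\<^sub>R e \<in> cbox (- c) c"
proof -
  have "compact ((\<lambda>(s, x). x + s *\<^sub>R e) ` ({0..h} \<times> cbox a b))"
    by (intro compact_continuous_image compact_Times) (auto intro!: continuous_intros simp: split_beta)
  then obtain c where "(\<lambda>(s, x). x + s *\<^sub>R e) ` ({0..h} \<times> cbox a b) \<subseteq> cbox (-c) c"
    using bounded_subset_cbox_symmetric compact_imp_bounded by metis
  with that show thesis by force
qed

lemma integrable_pair_bounded:
  fixes K :: "real \<Rightarrow> 'a::euclidean_space \<Rightarrow> real"
  assumes [measurable]: "(\<lambda>(s, x). K s x) \<in> borel_measurable (lborel \<Otimes>\<^sub>M lborel)"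
    and "\<And>s. (\<integral>\<^sup>+x. ennreal \<bar>K s x\<bar> \<partial>lborel) \<le> C * indicator {0..h} s" "C < \<infinity>"
  shows "integrable (lborel \<Otimes>\<^sub>M lborel) (\<lambda>(s, x). K s x)"
proof (rule integrableI_bounded)
  have "(\<integral>\<^sup>+z. ennreal (norm (case z of (s, x) \<Rightarrow> K s x)) \<partial>(lborel \<Otimes>\<^sub>M lborel)) =
    (\<integral>\<^sup>+s. (\<integral>\<^sup>+x. ennreal \<bar>K s x\<bar> \<partial>lborel) \<partial>lborel)"
    by (subst lborel.nn_integral_fst[symmetric]) auto
  also have "\<dots> \<le> (\<integral>\<^sup>+s. C * indicator {0..h} s \<partial>lborel)"
    by (intro nn_integral_mono assms)
  also have "\<dots> = C * emeasure lborel {0..h}" by (simp add: nn_integral_cmult_indicator)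
  also have "\<dots> < \<infinity>" using assms(3) by (auto simp: ennreal_mult_less_top emeasure_lborel_Icc_eq)
  finally show "(\<integral>\<^sup>+z. ennreal (norm (case z of (s, x) \<Rightarrow> K s x)) \<partial>(lborel \<Otimes>\<^sub>M lborel)) < \<infinity>" .
qed simp

lemma integrable_pair_line:
  fixes g :: "'a::euclidean_space \<Rightarrow> real"
  assumes [measurable]: "g \<in> borel_measurable borel"
    and int: "\<And>a b. integrable lborel (\<lambda>x. indicator (cbox a b) x * g x)"
  shows "integrable (lborel \<Otimes>\<^sub>M lborel) (\<lambda>(s, x). indicator {0..h} s * (indicator (cbox a b) x * g (x + s *\<^sub>R e)))"
proof -
  obtain c where c: "\<And>s x. s \<in> {0..h} \<Longrightarrow> x \<in> cbox a b \<Longrightarrow> x + s *\<^sub>R e \<in> cbox (- c) c"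
    using shifted_cbox_subset[of h a b e] by blast
  let ?C = "\<integral>\<^sup>+x. ennreal \<bar>indicator (cbox (-c) c) x * g x\<bar> \<partial>lborel"
  show ?thesis
  proof (rule integrable_pair_bounded)
    show "?C < \<infinity>" using int[of "-c" c] by (simp add: integrable_iff_bounded)
    fix s
    show "(\<integral>\<^sup>+x. ennreal \<bar>indicator {0..h} s * (indicator (cbox a b) x * g (x + s *\<^sub>R e))\<bar> \<partial>lborel) \<le> ?C * indicator {0..h} s"
    proof (cases "s \<in> {0..h}")
      case True
      then have "(\<integral>\<^sup>+x. ennreal \<bar>indicator {0..h} s * (indicator (cbox a b) x * g (x + s *\<^sub>R e))\<bar> \<partial>lborel)
        \<le> (\<integral>\<^sup>+x. ennreal \<bar>indicator (cbox (-c) c) (x + s *\<^sub>R e) * g (x + s *\<^sub>R e)\<bar> \<partial>lborel)"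
        using c by (intro nn_integral_mono ennreal_leI) (auto simp: indicator_def)
      also have "\<dots> = ?C" by (rule nn_integral_translate) simp
      finally show ?thesis using True by simp
    qed simp
  qed simp
qed

lemma AE_line_integrable:
  fixes g :: "'a::euclidean_space \<Rightarrow> real"
  assumes [measurable]: "g \<in> borel_measurable borel"
    and int: "\<And>a b. integrable lborel (\<lambda>x. indicator (cbox a b) x * g x)"
  shows "AE x in lborel. integrable lborel (\<lambda>s. indicator {0..h} s * g (x + s *\<^sub>R e))"
proof (rule AE_locally)
  fix a b :: 'a
  have "AE x in lborel. integrable lborel (\<lambda>s. indicator {0..h} s * (indicator (cbox a b) x * g (x + s *\<^sub>R e)))"
    by (rule lborel_pair.AE_integrable_snd) (rule integrable_pair_line[OF assms])
  then have "AE x in lborel. x \<in> cbox a b \<longrightarrow> integrable lborel (\<lambda>s. indicator {0..h} s * g (x + s *\<^sub>R e))"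
    by eventually_elim (intro impI, simp)
  then show "AE x in lborel. x \<in> box a b \<longrightarrow> integrable lborel (\<lambda>s. indicator {0..h} s * g (x + s *\<^sub>R e))"
    by eventually_elim (use box_subset_cbox in blast)
qed

lemma integral_pull_const:
  fixes p q :: "'a \<Rightarrow> real"
  shows "(\<integral>s. p s * (c * q s) \<partial>M) = c * (\<integral>s. p s * q s \<partial>M)"
proof -
  have "p s * (c * q s) = c * (p s * q s)" for s by simp
  then show ?thesis by (simp only: integral_mult_right_zero)
qed

text \<open>Tested with a box bump, the increment of \<open>u\<close> becomes, up to sign,
  \<open>u\<close> integrated against the derivative of the function from
  \<open>shifted_bump_test_function\<close>. The weak gradient identity turns this into an integral
  of \<open>g i\<close>, and Fubini with translation invariance recovers the right side. The
  exceptional null set depends on \<open>h\<close>.\<close>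

lemma line_identity:
  fixes u :: "real ^ 'n \<Rightarrow> real"
  assumes wg: "borel_weak_gradient u g" and h: "h \<ge> 0"
  shows "AE x in lborel. u (x + h *\<^sub>R axis i 1) - u x = (\<integral>s. indicator {0..h} s * g i (x + s *\<^sub>R axis i 1) \<partial>lborel)"
proof -
  let ?e = "axis i 1 :: real ^ 'n"
  from wg have [measurable]: "u \<in> borel_measurable borel" "g i \<in> borel_measurable borel"
    by (auto simp: borel_weak_gradient_def)
  have li: "integrable lborel (\<lambda>x. indicator (cbox a b) x * u x)"
    "integrable lborel (\<lambda>x. indicator (cbox a b) x * g i x)" for a b
    using wg by (auto simp: borel_weak_gradient_def)
  define L where "L x = (\<integral>s. indicator {0..h} s * g i (x + s *\<^sub>R ?e) \<partial>lborel)" for x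
  have [measurable]: "L \<in> borel_measurable borel" unfolding L_def[abs_def] by measurable
  have liL: "integrable lborel (\<lambda>x. indicator (cbox a b) x * L x)" for a b
  proof -
    have "integrable lborel (\<lambda>x. \<integral>s. indicator {0..h} s * (indicator (cbox a b) x * g i (x + s *\<^sub>R ?e)) \<partial>lborel)"
      by (rule lborel_pair.integrable_snd) (rule integrable_pair_line; simp add: li)
    then show ?thesis unfolding L_def integral_pull_const .
  qed
  have lis: "integrable lborel (\<lambda>x. indicator (cbox a b) x * u (x + h *\<^sub>R ?e))" for a b
  proof -
    obtain c where c: "\<And>s x. s \<in> {0..h} \<Longrightarrow> x \<in> cbox a b \<Longrightarrow> x + s *\<^sub>R ?e \<in> cbox (- c) c"
      using shifted_cbox_subset[of h a b ?e] by blast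
    have "integrable lborel (\<lambda>x. indicator (cbox (-c) c) (x + h *\<^sub>R ?e) * u (x + h *\<^sub>R ?e))"
      by (rule integrable_translate) (simp_all add: li)
    then show ?thesis
      by (rule Bochner_Integration.integrable_bound) (use c[of h] h in \<open>auto simp: indicator_def\<close>)
  qed
  have "AE x in lborel. u (x + h *\<^sub>R ?e) - u x - L x = 0"
  proof (rule fundamental_lemma)
    show "integrable lborel (\<lambda>x. indicator (cbox a b) x * (u (x + h *\<^sub>R ?e) - u x - L x))" for a b
      using Bochner_Integration.integrable_diff[OF Bochner_Integration.integrable_diff[OF lis li(1)] liL, of a b]
      by (simp only: right_diff_distrib)
    fix n and a b :: "real ^ 'n"
    obtain \<phi> where \<phi>: "test_function \<phi>"
      "\<And>x. frechet_derivative \<phi> (at x) ?e = box_bump n a b x - box_bump n a b (x - h *\<^sub>R ?e)"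
      "\<And>x. \<phi> x = (\<integral>s. indicator {0..h} s * box_bump n a b (x - s *\<^sub>R ?e) \<partial>lborel)"
      using shifted_bump_test_function[OF h, of i n a b] by blast
    let ?z = "box_bump n a b"
    have i1: "integrable lborel (\<lambda>x. u x * ?z x)" by (rule integrable_mult_box_bump) (simp_all add: li)
    have i2: "integrable lborel (\<lambda>x. u (x + h *\<^sub>R ?e) * ?z x)" by (rule integrable_mult_box_bump) (simp_all add: lis)
    have i3: "integrable lborel (\<lambda>x. L x * ?z x)" by (rule integrable_mult_box_bump) (simp_all add: liL)
    have t2: "(\<integral>x. u (x + h *\<^sub>R ?e) * ?z x \<partial>lborel) = (\<integral>x. u x * ?z (x - h *\<^sub>R ?e) \<partial>lborel)"
      using integral_translate[of "\<lambda>x. u x * ?z (x - h *\<^sub>R ?e)" "h *\<^sub>R ?e"] by simp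
    have i2': "integrable lborel (\<lambda>x. u x * ?z (x - h *\<^sub>R ?e))"
      using integrable_translate[OF _ i2, of "- (h *\<^sub>R ?e)"] by simp
    have "(\<integral>x. u x * ?z x \<partial>lborel) - (\<integral>x. u x * ?z (x - h *\<^sub>R ?e) \<partial>lborel) = (\<integral>x. u x * frechet_derivative \<phi> (at x) ?e \<partial>lborel)"
      unfolding \<phi>(2) using i1 i2' by (simp add: right_diff_distrib)
    also have "\<dots> = - (\<integral>x. g i x * \<phi> x \<partial>lborel)" using wg \<phi>(1) by (simp add: borel_weak_gradient_def)
    also have "(\<integral>x. g i x * \<phi> x \<partial>lborel) = (\<integral>x. (\<integral>s. indicator {0..h} s * (g i x * ?z (x - s *\<^sub>R ?e)) \<partial>lborel) \<partial>lborel)"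
      unfolding \<phi>(3) integral_pull_const ..
    also have "\<dots> = (\<integral>s. (\<integral>x. indicator {0..h} s * (g i x * ?z (x - s *\<^sub>R ?e)) \<partial>lborel) \<partial>lborel)"
    proof (rule lborel_pair.Fubini_integral)
      obtain c where c: "\<And>s x. s \<in> {0..h} \<Longrightarrow> x \<in> cbox a b \<Longrightarrow> x + s *\<^sub>R ?e \<in> cbox (- c) c"
        using shifted_cbox_subset[of h a b ?e] by blast
      let ?C = "\<integral>\<^sup>+x. ennreal \<bar>indicator (cbox (-c) c) x * g i x\<bar> \<partial>lborel"
      show "integrable (lborel \<Otimes>\<^sub>M lborel) (\<lambda>(s, x). indicator {0..h} s * (g i x * ?z (x - s *\<^sub>R ?e)))"
      proof (rule integrable_pair_bounded)
        show "?C < \<infinity>" using li(2)[of "-c" c] by (simp add: integrable_iff_bounded)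
        fix s
        show "(\<integral>\<^sup>+x. ennreal \<bar>indicator {0..h} s * (g i x * ?z (x - s *\<^sub>R ?e))\<bar> \<partial>lborel) \<le> ?C * indicator {0..h} s"
        proof (cases "s \<in> {0..h}")
          case True
          have "\<bar>g i x * ?z (x - s *\<^sub>R ?e)\<bar> \<le> \<bar>indicator (cbox (-c) c) x * g i x\<bar>" for x
          proof (rule order_trans[OF abs_mult_box_bump])
            show "\<bar>indicator (cbox a b) (x - s *\<^sub>R ?e) * g i x\<bar> \<le> \<bar>indicator (cbox (-c) c) x * g i x\<bar>"
              using c[OF True, of "x - s *\<^sub>R ?e"] by (auto simp: indicator_def)
          qed
          then show ?thesis using True by (auto intro!: nn_integral_mono ennreal_leI)
        qed simp
      qed simp
    qed
    also have "\<dots> = (\<integral>s. (\<integral>x. indicator {0..h} s * (g i (x + s *\<^sub>R ?e) * ?z x) \<partial>lborel) \<partial>lborel)"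
    proof -
      have "(\<integral>x. (g i x * ?z (x - s *\<^sub>R ?e)) \<partial>lborel) = (\<integral>x. (g i (x + s *\<^sub>R ?e) * ?z x) \<partial>lborel)" for s
        using integral_translate[of "\<lambda>x. (g i x * ?z (x - s *\<^sub>R ?e))" "s *\<^sub>R ?e"] by simp
      then show ?thesis by simp
    qed
    also have "\<dots> = (\<integral>x. (\<integral>s. indicator {0..h} s * (g i (x + s *\<^sub>R ?e) * ?z x) \<partial>lborel) \<partial>lborel)"
    proof (rule lborel_pair.Fubini_integral[symmetric])
      show "integrable (lborel \<Otimes>\<^sub>M lborel) (\<lambda>(s, x). indicator {0..h} s * (g i (x + s *\<^sub>R ?e) * ?z x))"
      proof (rule Bochner_Integration.integrable_bound[OF integrable_pair_line[where g="g i" and h=h and e="?e" and a=a and b=b]])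
        show "AE z in lborel \<Otimes>\<^sub>M lborel. norm (case z of (s, x) \<Rightarrow> indicator {0..h} s * (g i (x + s *\<^sub>R ?e) * ?z x))
          \<le> norm (case z of (s, x) \<Rightarrow> indicator {0..h} s * (indicator (cbox a b) x * g i (x + s *\<^sub>R ?e)))"
          using abs_mult_box_bump by (intro AE_I2) (auto simp: abs_mult[of "indicator _ _"] split: prod.split intro!: mult_left_mono simp del: abs_mult)
      qed (simp_all add: li)
    qed
    also have "\<dots> = (\<integral>x. L x * ?z x \<partial>lborel)"
      unfolding L_def by (simp add: mult.assoc[symmetric])
    finally show "(\<integral>x. (u (x + h *\<^sub>R ?e) - u x - L x) * ?z x \<partial>lborel) = 0"
      using i1 i2 i3 t2 by (simp add: left_diff_distrib)
  qed simp
  then show ?thesis unfolding L_def by simp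
qed

text \<open>The product \<open>\<gamma> \<sigma> * \<gamma> s\<close> is symmetric, so the
  half-planes \<sigma> \<le> s and s \<le> \<sigma> carry equal integrals, and they overlap only in
  the null diagonal. This is the integrated form of the derivative of a square.\<close>

lemma integral_mult_primitive:
  fixes \<gamma> :: "real \<Rightarrow> real"
  assumes \<gamma>: "integrable lborel \<gamma>"
  shows "integrable lborel (\<lambda>s. (\<integral>\<sigma>. indicator {..s} \<sigma> * \<gamma> \<sigma> \<partial>lborel) * \<gamma> s)" (is ?i)
    "2 * (\<integral>s. (\<integral>\<sigma>. indicator {..s} \<sigma> * \<gamma> \<sigma> \<partial>lborel) * \<gamma> s \<partial>lborel) = (\<integral>s. \<gamma> s \<partial>lborel)\<^sup>2" (is ?e)
proof -
  have [measurable]: "\<gamma> \<in> borel_measurable borel" using borel_measurable_integrable[OF \<gamma>] by simp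
  have pair: "integrable (lborel \<Otimes>\<^sub>M lborel) (\<lambda>(s, \<sigma>). \<gamma> \<sigma> * \<gamma> s)"
  proof (rule lborel_pair.Fubini_integrable)
    show "integrable lborel (\<lambda>s. \<integral>\<sigma>. norm (case (s, \<sigma>) of (s, \<sigma>) \<Rightarrow> \<gamma> \<sigma> * \<gamma> s) \<partial>lborel)"
      using \<gamma> by (simp add: abs_mult)
  qed (use \<gamma> in auto)
  let ?K = "\<lambda>s \<sigma>. (indicator {..s} \<sigma> * \<gamma> \<sigma>) * \<gamma> s"
  have pairK: "integrable (lborel \<Otimes>\<^sub>M lborel) (\<lambda>(s, \<sigma>). ?K s \<sigma>)"
    by (rule Bochner_Integration.integrable_bound[OF pair])
      (auto intro!: AE_I2 simp: indicator_def split: prod.split)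
  have intW: "integrable lborel (\<lambda>s. (\<integral>\<sigma>. indicator {..s} \<sigma> * \<gamma> \<sigma> \<partial>lborel) * \<gamma> s)"
    using lborel_pair.integrable_fst[OF pairK] by simp
  have "(\<integral>s. (\<integral>\<sigma>. indicator {..s} \<sigma> * \<gamma> \<sigma> \<partial>lborel) * \<gamma> s \<partial>lborel) = (\<integral>s. (\<integral>\<sigma>. ?K s \<sigma> \<partial>lborel) \<partial>lborel)"
    by simp
  also have "\<dots> = (\<integral>\<sigma>. (\<integral>s. ?K s \<sigma> \<partial>lborel) \<partial>lborel)"
    by (rule lborel_pair.Fubini_integral[OF pairK, symmetric])
  also have "\<dots> = (\<integral>\<sigma>. (\<integral>s. indicator {\<sigma>..} s * \<gamma> s \<partial>lborel) * \<gamma> \<sigma> \<partial>lborel)"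
  proof -
    have "?K s \<sigma> = (indicator {\<sigma>..} s * \<gamma> s) * \<gamma> \<sigma>" for s \<sigma> by (simp add: indicator_def)
    then show ?thesis by (simp only: integral_mult_left_zero)
  qed
  finally have swap: "(\<integral>s. (\<integral>\<sigma>. indicator {..s} \<sigma> * \<gamma> \<sigma> \<partial>lborel) * \<gamma> s \<partial>lborel) =
    (\<integral>\<sigma>. (\<integral>s. indicator {\<sigma>..} s * \<gamma> s \<partial>lborel) * \<gamma> \<sigma> \<partial>lborel)" .
  have dom: "integrable lborel (\<lambda>x. indicator A x * \<gamma> x)" if "A \<in> sets borel" for A
    using integrable_mult_indicator[of A lborel \<gamma>] that \<gamma> by simp
  have split: "(\<integral>\<sigma>. indicator {..s} \<sigma> * \<gamma> \<sigma> \<partial>lborel) + (\<integral>\<sigma>. indicator {s..} \<sigma> * \<gamma> \<sigma> \<partial>lborel) = (\<integral>\<sigma>. \<gamma> \<sigma> \<partial>lborel)" for s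
  proof -
    have "(\<integral>\<sigma>. indicator {..s} \<sigma> * \<gamma> \<sigma> \<partial>lborel) + (\<integral>\<sigma>. indicator {s..} \<sigma> * \<gamma> \<sigma> \<partial>lborel) =
      (\<integral>\<sigma>. indicator {..s} \<sigma> * \<gamma> \<sigma> + indicator {s..} \<sigma> * \<gamma> \<sigma> \<partial>lborel)"
      using dom by (intro Bochner_Integration.integral_add[symmetric]) auto
    also have "\<dots> = (\<integral>\<sigma>. \<gamma> \<sigma> \<partial>lborel)"
    proof (rule integral_cong_AE)
      show "AE \<sigma> in lborel. indicator {..s} \<sigma> * \<gamma> \<sigma> + indicator {s..} \<sigma> * \<gamma> \<sigma> = \<gamma> \<sigma>"
        using AE_lborel_singleton[of s] by eventually_elim (auto simp: indicator_def)
    qed simp_all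
    finally show ?thesis .
  qed
  have intW': "integrable lborel (\<lambda>s. (\<integral>\<sigma>. indicator {s..} \<sigma> * \<gamma> \<sigma> \<partial>lborel) * \<gamma> s)"
  proof -
    have "(\<integral>\<sigma>. indicator {s..} \<sigma> * \<gamma> \<sigma> \<partial>lborel) * \<gamma> s = (\<integral>\<sigma>. \<gamma> \<sigma> \<partial>lborel) * \<gamma> s - (\<integral>\<sigma>. indicator {..s} \<sigma> * \<gamma> \<sigma> \<partial>lborel) * \<gamma> s" for s
      using split[of s] by (simp add: algebra_simps flip: distrib_left)
    then show ?thesis using intW \<gamma> by simp
  qed
  have "2 * (\<integral>s. (\<integral>\<sigma>. indicator {..s} \<sigma> * \<gamma> \<sigma> \<partial>lborel) * \<gamma> s \<partial>lborel) =
    (\<integral>s. (\<integral>\<sigma>. indicator {..s} \<sigma> * \<gamma> \<sigma> \<partial>lborel) * \<gamma> s + (\<integral>\<sigma>. indicator {s..} \<sigma> * \<gamma> \<sigma> \<partial>lborel) * \<gamma> s \<partial>lborel)"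
    using swap intW intW' by simp
  also have "\<dots> = (\<integral>s. (\<integral>\<sigma>. \<gamma> \<sigma> \<partial>lborel) * \<gamma> s \<partial>lborel)"
    by (simp only: distrib_right[symmetric] split)
  also have "\<dots> = (\<integral>s. \<gamma> s \<partial>lborel)\<^sup>2" by (simp add: power2_eq_square)
  finally show ?e .
  show ?i by (rule intW)
qed

text \<open>No chain rule for weak gradients is needed: along almost every line \<open>u\<close> is the primitive of an
  integrable function, and the square of a primitive is handled by Fubini.\<close>

lemma line_identity_square:
  fixes u g :: "'a::euclidean_space \<Rightarrow> real"
  assumes [measurable]: "u \<in> borel_measurable borel" "g \<in> borel_measurable borel"
    and line: "\<And>h. h \<ge> 0 \<Longrightarrow> AE x in lborel. u (x + h *\<^sub>R e) - u x = (\<integral>s. indicator {0..h} s * g (x + s *\<^sub>R e) \<partial>lborel)"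
    and int: "\<And>h. AE x in lborel. integrable lborel (\<lambda>s. indicator {0..h} s * g (x + s *\<^sub>R e))"
    and h: "h \<ge> 0"
  shows "AE x in lborel. (u (x + h *\<^sub>R e))\<^sup>2 - (u x)\<^sup>2 =
    (\<integral>s. indicator {0..h} s * (2 * (u (x + s *\<^sub>R e) * g (x + s *\<^sub>R e))) \<partial>lborel)"
proof -
  \<comment> \<open>The line identity has a separate exceptional set for every \<open>s\<close>.
    Fubini exchanges the quantifiers: on almost every line the identity holds at almost every
    \<open>s\<close>.\<close>
  let ?P = "\<lambda>s x. s \<in> {0..h} \<longrightarrow> u (x + s *\<^sub>R e) - u x = (\<integral>\<sigma>. indicator {0..s} \<sigma> * g (x + \<sigma> *\<^sub>R e) \<partial>lborel)"
  have "AE s in lborel. AE x in lborel. ?P s x"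
  proof (rule AE_I2)
    fix s
    show "AE x in lborel. ?P s x"
    proof (cases "s \<in> {0..h}")
      case True
      then show ?thesis using line[of s] by simp
    next
      case False
      then show ?thesis by (intro AE_I2) blast
    qed
  qed
  moreover have "{z \<in> space (lborel \<Otimes>\<^sub>M lborel). ?P (fst z) (snd z)} \<in> sets (lborel \<Otimes>\<^sub>M lborel)"
  proof -
    \<comment> \<open>As a comparison, the indicator with moving endpoint is visibly measurable
      jointly in the endpoint and the variable.\<close>
    have ind: "indicator {0..s} \<sigma> = (if 0 \<le> \<sigma> \<and> \<sigma> \<le> s then 1 else 0 :: real)" for s \<sigma> :: real
      by (simp add: indicator_def)
    define F where "F z = (u (snd z + fst z *\<^sub>R e) - u (snd z)) - (\<integral>\<sigma>. indicator {0..fst z} \<sigma> * g (snd z + \<sigma> *\<^sub>R e) \<partial>lborel)" for z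
    have [measurable]: "F \<in> borel_measurable (lborel \<Otimes>\<^sub>M lborel)"
      unfolding F_def[abs_def] ind by measurable
    have "?P (fst z) (snd z) \<longleftrightarrow> (0 \<le> fst z \<and> fst z \<le> h \<longrightarrow> F z = 0)" for z
      unfolding F_def by simp
    then show ?thesis by (simp only:) measurable
  qed
  ultimately have "AE x in lborel. AE s in lborel. ?P s x"
    using lborel_pair.AE_commute[of ?P] by blast
  with line[OF h] int[of h] show ?thesis
  proof eventually_elim
    case (elim x)
    define \<gamma> where "\<gamma> s = indicator {0..h} s * g (x + s *\<^sub>R e)" for s
    have \<gamma>: "integrable lborel \<gamma>" unfolding \<gamma>_def using elim(2) .
    have [measurable]: "\<gamma> \<in> borel_measurable borel" unfolding \<gamma>_def by measurable
    \<comment> \<open>Since \<open>\<gamma>\<close> vanishes outside [0, h], the primitive from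
      minus infinity is the one from 0, so u (x + s e) = u x + W s for almost every s in
      [0, h].\<close>
    define W where "W s = (\<integral>\<sigma>. indicator {..s} \<sigma> * \<gamma> \<sigma> \<partial>lborel)" for s
    have ind: "indicator {..s} \<sigma> = (if \<sigma> \<le> s then 1 else 0 :: real)" for s \<sigma> :: real
      by (simp add: indicator_def)
    have [measurable]: "W \<in> borel_measurable borel" unfolding W_def[abs_def] ind by measurable
    have eq: "(\<integral>\<sigma>. indicator {0..s} \<sigma> * g (x + \<sigma> *\<^sub>R e) \<partial>lborel) = W s" if "s \<in> {0..h}" for s
      unfolding W_def \<gamma>_def by (rule Bochner_Integration.integral_cong) (use that in \<open>auto simp: indicator_def\<close>)
    have I: "(\<integral>s. \<gamma> s \<partial>lborel) = u (x + h *\<^sub>R e) - u x" unfolding \<gamma>_def using elim(1) by simp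
    have "(\<integral>s. indicator {0..h} s * (2 * (u (x + s *\<^sub>R e) * g (x + s *\<^sub>R e))) \<partial>lborel) =
      (\<integral>s. 2 * u x * \<gamma> s + 2 * (W s * \<gamma> s) \<partial>lborel)"
    proof (rule integral_cong_AE)
      show "AE s in lborel. indicator {0..h} s * (2 * (u (x + s *\<^sub>R e) * g (x + s *\<^sub>R e))) = 2 * u x * \<gamma> s + 2 * (W s * \<gamma> s)"
        using elim(3)
      proof eventually_elim
        case (elim s)
        show ?case
        proof (cases "s \<in> {0..h}")
          case True
          then have "u (x + s *\<^sub>R e) = u x + W s" using elim eq by (simp add: algebra_simps)
          then show ?thesis using True by (simp add: \<gamma>_def algebra_simps)
        qed (simp add: \<gamma>_def)
      qed
    qed measurable
    also have "\<dots> = 2 * u x * (\<integral>s. \<gamma> s \<partial>lborel) + 2 * (\<integral>s. W s * \<gamma> s \<partial>lborel)"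
      using \<gamma> integral_mult_primitive(1)[OF \<gamma>, folded W_def] by simp
    also have "\<dots> = 2 * u x * (\<integral>s. \<gamma> s \<partial>lborel) + (\<integral>s. \<gamma> s \<partial>lborel)\<^sup>2"
      using integral_mult_primitive(2)[OF \<gamma>, folded W_def] by simp
    also have "\<dots> = (u (x + h *\<^sub>R e))\<^sup>2 - (u x)\<^sup>2"
      unfolding I by (simp add: power2_eq_square algebra_simps)
    finally show ?case by simp
  qed
qed

section \<open>Mean-square estimates for translations\<close>

lemma integral_square_le:
  fixes f :: "real \<Rightarrow> real"
  assumes [measurable]: "f \<in> borel_measurable borel" and h: "h \<ge> 0"
  shows "ennreal ((\<integral>s. indicator {0..h} s * f s \<partial>lborel)\<^sup>2) \<le> ennreal h * (\<integral>\<^sup>+s. indicator {0..h} s * ennreal ((f s)\<^sup>2) \<partial>lborel)"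
proof -
  have "ennreal \<bar>\<integral>s. indicator {0..h} s * f s \<partial>lborel\<bar> \<le> (\<integral>\<^sup>+s. ennreal (norm (indicator {0..h} s * f s)) \<partial>lborel)"
  proof (cases "integrable lborel (\<lambda>s. indicator {0..h} s * f s)")
    case True
    then show ?thesis using integral_norm_bound_ennreal[OF True] by simp
  next
    \<comment> \<open>A function that is not integrable has Bochner integral 0 by convention, so the
      bound is trivial.\<close>
    case False
    then show ?thesis by (simp add: not_integrable_integral_eq)
  qed
  also have "\<dots> = (\<integral>\<^sup>+s. indicator {0..h} s * (indicator {0..h} s * ennreal \<bar>f s\<bar>) \<partial>lborel)"
    by (rule nn_integral_cong) (auto simp: indicator_def)
  finally have "ennreal \<bar>\<integral>s. indicator {0..h} s * f s \<partial>lborel\<bar> ^ 2 \<le> \<dots> ^ 2" by (rule power_mono) simp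
  also have "\<dots> \<le> (\<integral>\<^sup>+s. (indicator {0..h} s)\<^sup>2 \<partial>lborel) * (\<integral>\<^sup>+s. (indicator {0..h} s * ennreal \<bar>f s\<bar>)\<^sup>2 \<partial>lborel)"
    by (rule Cauchy_Schwarz_nn_integral) simp_all
  also have "(\<lambda>s. (indicator {0..h} s :: ennreal)\<^sup>2) = (\<lambda>s. indicator {0..h} s)"
    by (auto simp: indicator_def)
  also have "(\<lambda>s. (indicator {0..h} s * ennreal \<bar>f s\<bar>)\<^sup>2) = (\<lambda>s. indicator {0..h} s * ennreal ((f s)\<^sup>2))"
    by (auto simp: indicator_def ennreal_power)
  finally show ?thesis using h by (simp add: ennreal_power)
qed

text \<open>One factor \<open>h\<close> comes from Cauchy-Schwarz along the segment, the other from
  integrating over the segment after translation invariance has removed the shift.\<close>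

lemma translation_L2_bound:
  fixes v q :: "'a::euclidean_space \<Rightarrow> real"
  assumes [measurable]: "v \<in> borel_measurable borel" "q \<in> borel_measurable borel"
    and line: "AE x in lborel. v (x + h *\<^sub>R e) - v x = (\<integral>s. indicator {0..h} s * q (x + s *\<^sub>R e) \<partial>lborel)"
    and h: "h \<ge> 0"
  shows "(\<integral>\<^sup>+x. ennreal ((v (x + h *\<^sub>R e) - v x)\<^sup>2) \<partial>lborel) \<le> ennreal (h\<^sup>2) * (\<integral>\<^sup>+x. ennreal ((q x)\<^sup>2) \<partial>lborel)"
proof -
  have "(\<integral>\<^sup>+x. ennreal ((v (x + h *\<^sub>R e) - v x)\<^sup>2) \<partial>lborel) \<le>
    (\<integral>\<^sup>+x. ennreal h * (\<integral>\<^sup>+s. indicator {0..h} s * ennreal ((q (x + s *\<^sub>R e))\<^sup>2) \<partial>lborel) \<partial>lborel)"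
    by (rule nn_integral_mono_AE, use line in eventually_elim) (simp only:, rule integral_square_le, use h in simp_all)
  also have "\<dots> = ennreal h * (\<integral>\<^sup>+x. (\<integral>\<^sup>+s. indicator {0..h} s * ennreal ((q (x + s *\<^sub>R e))\<^sup>2) \<partial>lborel) \<partial>lborel)"
    by (rule nn_integral_cmult) simp
  also have "(\<integral>\<^sup>+x. (\<integral>\<^sup>+s. indicator {0..h} s * ennreal ((q (x + s *\<^sub>R e))\<^sup>2) \<partial>lborel) \<partial>lborel) =
    (\<integral>\<^sup>+s. (\<integral>\<^sup>+x. indicator {0..h} s * ennreal ((q (x + s *\<^sub>R e))\<^sup>2) \<partial>lborel) \<partial>lborel)"
    by (rule lborel_pair.Fubini'[where f="\<lambda>s x. indicator {0..h} s * ennreal ((q (x + s *\<^sub>R e))\<^sup>2)"]) measurable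
  also have "\<dots> = (\<integral>\<^sup>+s. indicator {0..h} s * (\<integral>\<^sup>+x. ennreal ((q x)\<^sup>2) \<partial>lborel) \<partial>lborel)"
    using nn_integral_translate[of "\<lambda>x. ennreal ((q x)\<^sup>2)"] by (simp add: nn_integral_cmult)
  also have "\<dots> = ennreal h * (\<integral>\<^sup>+x. ennreal ((q x)\<^sup>2) \<partial>lborel)"
    using h by (simp add: nn_integral_multc)
  finally show ?thesis using h by (simp add: power2_eq_square ennreal_mult mult.assoc)
qed

lemma nn_integral_square_add:
  fixes a b :: "'a \<Rightarrow> real"
  assumes [measurable]: "a \<in> borel_measurable M" "b \<in> borel_measurable M"
  shows "(\<integral>\<^sup>+x. ennreal ((a x + b x)\<^sup>2) \<partial>M) \<le> 2 * (\<integral>\<^sup>+x. ennreal ((a x)\<^sup>2) \<partial>M) + 2 * (\<integral>\<^sup>+x. ennreal ((b x)\<^sup>2) \<partial>M)"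
proof -
  have "(a x + b x)\<^sup>2 \<le> 2 * (a x)\<^sup>2 + 2 * (b x)\<^sup>2" for x
    using sum_squares_bound[of "a x" "b x"] by (simp add: power2_sum)
  then have "ennreal ((a x + b x)\<^sup>2) \<le> ennreal (2 * (a x)\<^sup>2 + 2 * (b x)\<^sup>2)" for x
    by (rule ennreal_leI)
  moreover have "ennreal (2 * (a x)\<^sup>2 + 2 * (b x)\<^sup>2) = 2 * ennreal ((a x)\<^sup>2) + 2 * ennreal ((b x)\<^sup>2)" for x
    by (simp add: ennreal_plus ennreal_mult')
  ultimately have "(\<integral>\<^sup>+x. ennreal ((a x + b x)\<^sup>2) \<partial>M) \<le> (\<integral>\<^sup>+x. 2 * ennreal ((a x)\<^sup>2) + 2 * ennreal ((b x)\<^sup>2) \<partial>M)"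
    by (intro nn_integral_mono) simp
  also have "\<dots> = 2 * (\<integral>\<^sup>+x. ennreal ((a x)\<^sup>2) \<partial>M) + 2 * (\<integral>\<^sup>+x. ennreal ((b x)\<^sup>2) \<partial>M)"
    by (simp add: nn_integral_add nn_integral_cmult)
  finally show ?thesis .
qed

text \<open>The shift is made one coordinate at a time. Each step doubles both contributions by
  (a+b)^2 \<le> 2a^2 + 2b^2, and 2 4^k + 2 \<le> 4^(k+1) gives the crude constant.\<close>

lemma cube_translation_L2_bound:
  fixes v :: "real ^ 'n \<Rightarrow> real"
  assumes [measurable]: "v \<in> borel_measurable borel"
    and axis: "\<And>i h. 0 \<le> h \<Longrightarrow> (\<integral>\<^sup>+x. ennreal ((v (x + h *\<^sub>R axis i 1) - v x)\<^sup>2) \<partial>lborel) \<le> ennreal (h\<^sup>2) * Q"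
    and y: "\<And>i. 0 \<le> y $ i" "\<And>i. y $ i \<le> r"
  shows "(\<integral>\<^sup>+x. ennreal ((v (x + y) - v x)\<^sup>2) \<partial>lborel) \<le> ennreal (4 ^ CARD('n) * r\<^sup>2) * Q"
proof -
  have "(\<integral>\<^sup>+x. ennreal ((v (x + (\<Sum>i\<in>F. (y $ i) *\<^sub>R axis i 1)) - v x)\<^sup>2) \<partial>lborel) \<le> ennreal (4 ^ card F * r\<^sup>2) * Q"
    if "finite F" for F
    using that
  proof (induction F rule: finite_induct)
    case empty
    then show ?case by simp
  next
    case (insert i F)
    let ?s = "\<Sum>i\<in>F. (y $ i) *\<^sub>R axis i 1" and ?t = "(y $ i) *\<^sub>R axis i 1"
    have "(\<integral>\<^sup>+x. ennreal ((v (x + (?t + ?s)) - v x)\<^sup>2) \<partial>lborel) =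
      (\<integral>\<^sup>+x. ennreal (((v ((x + ?t) + ?s) - v (x + ?t)) + (v (x + ?t) - v x))\<^sup>2) \<partial>lborel)"
      by (simp add: add.assoc)
    also have "\<dots> \<le> 2 * (\<integral>\<^sup>+x. ennreal ((v ((x + ?t) + ?s) - v (x + ?t))\<^sup>2) \<partial>lborel) + 2 * (\<integral>\<^sup>+x. ennreal ((v (x + ?t) - v x)\<^sup>2) \<partial>lborel)"
      by (rule nn_integral_square_add) simp_all
    also have "(\<integral>\<^sup>+x. ennreal ((v ((x + ?t) + ?s) - v (x + ?t))\<^sup>2) \<partial>lborel) = (\<integral>\<^sup>+x. ennreal ((v (x + ?s) - v x)\<^sup>2) \<partial>lborel)"
      by (rule nn_integral_translate[of "\<lambda>x. ennreal ((v (x + ?s) - v x)\<^sup>2)"]) simp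
    also have "2 * (\<integral>\<^sup>+x. ennreal ((v (x + ?s) - v x)\<^sup>2) \<partial>lborel) + 2 * (\<integral>\<^sup>+x. ennreal ((v (x + ?t) - v x)\<^sup>2) \<partial>lborel)
      \<le> 2 * (ennreal (4 ^ card F * r\<^sup>2) * Q) + 2 * (ennreal (r\<^sup>2) * Q)"
    proof (intro add_mono mult_left_mono insert.IH order_trans[OF axis] mult_right_mono ennreal_leI power_mono y)
    qed simp_all
    also have "\<dots> = ennreal (2 * (4 ^ card F * r\<^sup>2) + 2 * r\<^sup>2) * Q"
      by (simp add: ennreal_plus ennreal_mult distrib_right mult.assoc)
    also have "\<dots> \<le> ennreal (4 ^ card (insert i F) * r\<^sup>2) * Q"
    proof (intro mult_right_mono ennreal_leI)
      have "r\<^sup>2 \<le> 4 ^ card F * r\<^sup>2" by (simp add: mult_le_cancel_right1)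
      then show "2 * (4 ^ card F * r\<^sup>2) + 2 * r\<^sup>2 \<le> 4 ^ card (insert i F) * r\<^sup>2"
        using insert.hyps by (simp add: mult.commute)
    qed simp
    finally show ?case using insert.hyps by simp
  qed
  from this[of UNIV] show ?thesis
    by (simp add: basis_expansion[of y, unfolded scalar_mult_eq_scaleR])
qed

section \<open>A subcritical Sobolev bound from translation estimates\<close>

text \<open>Average $f(x)^2 \le (f(x+y)-f(x))^2 + 2f(x)f(x+y)$ over \<open>y\<close> in a cube of side \<open>r\<close>.\<close>

lemma nash_inequality:
  fixes f :: "'a::euclidean_space \<Rightarrow> real"
  assumes [measurable]: "f \<in> borel_measurable borel" and f0: "\<And>x. 0 \<le> f x" and r: "r > 0"
    and L: "\<And>y. y \<in> cbox 0 (r *\<^sub>R One) \<Longrightarrow> (\<integral>\<^sup>+x. ennreal ((f (x + y) - f x)\<^sup>2) \<partial>lborel) \<le> L"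
  shows "ennreal (r ^ DIM('a)) * (\<integral>\<^sup>+x. ennreal ((f x)\<^sup>2) \<partial>lborel) \<le>
    ennreal (r ^ DIM('a)) * L + 2 * (\<integral>\<^sup>+x. ennreal (f x) \<partial>lborel)\<^sup>2"
proof -
  let ?Q = "cbox 0 (r *\<^sub>R One) :: 'a set"
  let ?F = "\<integral>\<^sup>+x. ennreal ((f x)\<^sup>2) \<partial>lborel" and ?I = "\<integral>\<^sup>+x. ennreal (f x) \<partial>lborel"
  let ?C = "\<lambda>y. \<integral>\<^sup>+x. ennreal (f x) * ennreal (f (x + y)) \<partial>lborel"
  have vol: "emeasure lborel ?Q = ennreal (r ^ DIM('a))"
    using r by (subst emeasure_lborel_cbox) (auto simp: inner_Basis)
  have le: "?F \<le> L + 2 * ?C y" if y: "y \<in> ?Q" for y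
  proof -
    have "(f x)\<^sup>2 \<le> (f (x + y) - f x)\<^sup>2 + 2 * (f x * f (x + y))" for x
      by (simp add: power2_diff)
    then have "ennreal ((f x)\<^sup>2) \<le> ennreal ((f (x + y) - f x)\<^sup>2 + 2 * (f x * f (x + y)))" for x
      by (rule ennreal_leI)
    moreover have "ennreal ((f (x + y) - f x)\<^sup>2 + 2 * (f x * f (x + y))) =
      ennreal ((f (x + y) - f x)\<^sup>2) + 2 * (ennreal (f x) * ennreal (f (x + y)))" for x
      using f0 by (simp add: ennreal_plus ennreal_mult' ennreal_mult)
    ultimately have "?F \<le> (\<integral>\<^sup>+x. ennreal ((f (x + y) - f x)\<^sup>2) + 2 * (ennreal (f x) * ennreal (f (x + y))) \<partial>lborel)"
      by (intro nn_integral_mono) simp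
    also have "\<dots> = (\<integral>\<^sup>+x. ennreal ((f (x + y) - f x)\<^sup>2) \<partial>lborel) + 2 * ?C y"
      by (simp add: nn_integral_add nn_integral_cmult)
    also have "\<dots> \<le> L + 2 * ?C y" using L[OF y] by (rule add_right_mono)
    finally show ?thesis .
  qed
  have "ennreal (r ^ DIM('a)) * ?F = (\<integral>\<^sup>+y. ?F * indicator ?Q y \<partial>lborel)"
    by (subst nn_integral_cmult_indicator) (auto simp: vol mult.commute)
  \<comment> \<open>The indicator is kept on the first term and dropped on the correlation term:
    integrated over all \<open>y\<close>, the latter factors into the square of
    \<open>?I\<close>.\<close>
  also have "\<dots> \<le> (\<integral>\<^sup>+y. L * indicator ?Q y + 2 * ?C y \<partial>lborel)"
  proof (rule nn_integral_mono)
    fix y show "?F * indicator ?Q y \<le> L * indicator ?Q y + 2 * ?C y"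
      using le[of y] by (cases "y \<in> ?Q") auto
  qed
  also have "\<dots> = L * ennreal (r ^ DIM('a)) + 2 * (\<integral>\<^sup>+y. ?C y \<partial>lborel)"
    by (simp add: nn_integral_add nn_integral_cmult nn_integral_cmult_indicator vol)
  also have "(\<integral>\<^sup>+y. ?C y \<partial>lborel) = (\<integral>\<^sup>+x. (\<integral>\<^sup>+y. ennreal (f x) * ennreal (f (x + y)) \<partial>lborel) \<partial>lborel)"
    by (rule lborel_pair.Fubini'[where f="\<lambda>x y. ennreal (f x) * ennreal (f (x + y))"]) measurable
  also have "\<dots> = (\<integral>\<^sup>+x. ennreal (f x) * ?I \<partial>lborel)"
  proof -
    have "(\<integral>\<^sup>+y. ennreal (f (x + y)) \<partial>lborel) = ?I" for x
      using nn_integral_translate[of "\<lambda>x. ennreal (f x)" x] by (simp add: add.commute)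
    then show ?thesis by (simp add: nn_integral_cmult)
  qed
  also have "\<dots> = ?I\<^sup>2" by (simp add: nn_integral_multc power2_eq_square)
  finally show ?thesis by (simp add: mult.commute)
qed

text \<open>A derivative-free form of a bound for the squared L^2 norm of the gradient. It passes to
  any function whose increments are dominated by those of \<open>v\<close>, and the cube is the one
  over which the Nash inequality averages.\<close>

definition translation_bounded :: "real \<Rightarrow> ('a::euclidean_space \<Rightarrow> real) \<Rightarrow> bool" where
  "translation_bounded \<Lambda> v \<longleftrightarrow> (\<forall>r>0. \<forall>y\<in>cbox 0 (r *\<^sub>R One).
     (\<integral>\<^sup>+x. ennreal ((v (x + y) - v x)\<^sup>2) \<partial>lborel) \<le> ennreal (\<Lambda> * r\<^sup>2))"

text \<open>Chebyshev's inequality. Finiteness is recorded separately because \<open>measure\<close>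
  assigns 0 to sets of infinite measure.\<close>

lemma superlevel_finite:
  fixes v :: "'a::euclidean_space \<Rightarrow> real"
  assumes [measurable]: "v \<in> borel_measurable borel" and v1: "(\<integral>\<^sup>+x. ennreal (v x) \<partial>lborel) \<le> 1" and l: "l > 0"
  shows "emeasure lborel {x. l \<le> v x} < \<infinity>" "measure lborel {x. l \<le> v x} \<le> 1 / l"
proof -
  have "ennreal l * emeasure lborel {x. l \<le> v x} = (\<integral>\<^sup>+x. ennreal l * indicator {x. l \<le> v x} x \<partial>lborel)"
    by (subst nn_integral_cmult_indicator) auto
  also have "\<dots> \<le> (\<integral>\<^sup>+x. ennreal (v x) \<partial>lborel)"
    by (intro nn_integral_mono) (auto simp: indicator_def intro: ennreal_leI)
  finally have le: "ennreal l * emeasure lborel {x. l \<le> v x} \<le> 1" using v1 by (rule order_trans)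
  then have "ennreal l * emeasure lborel {x. l \<le> v x} < top" by (simp add: le_less_trans)
  then show fin: "emeasure lborel {x. l \<le> v x} < \<infinity>"
    using l by (auto simp: ennreal_mult_less_top)
  then have "emeasure lborel {x. l \<le> v x} = ennreal (measure lborel {x. l \<le> v x})"
    by (intro emeasure_eq_ennreal_measure) auto
  with le l have "ennreal (l * measure lborel {x. l \<le> v x}) \<le> ennreal 1"
    by (simp add: ennreal_mult)
  then show "measure lborel {x. l \<le> v x} \<le> 1 / l" using l by (subst (asm) ennreal_le_iff) (auto simp: field_simps)
qed

text \<open>The Nash inequality is applied to the truncation $\min((v-l)^+, l)$, whose increments are
  dominated by those of \<open>v\<close>.\<close>

lemma superlevel_recursion:
  fixes v :: "'a::euclidean_space \<Rightarrow> real"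
  assumes [measurable]: "v \<in> borel_measurable borel" and v1: "(\<integral>\<^sup>+x. ennreal (v x) \<partial>lborel) \<le> 1"
    and tb: "translation_bounded \<Lambda> v" and \<Lambda>: "\<Lambda> \<ge> 0" and l: "l > 0" and r: "r > 0"
  shows "measure lborel {x. 2 * l \<le> v x} \<le> \<Lambda> * r\<^sup>2 / l\<^sup>2 + 2 * (measure lborel {x. l \<le> v x})\<^sup>2 / r ^ DIM('a)"
proof -
  define f where "f x = min (max (v x - l) 0) l" for x
  have [measurable]: "f \<in> borel_measurable borel" unfolding f_def[abs_def] by measurable
  have f0: "0 \<le> f x" for x using l by (simp add: f_def)
  let ?m1 = "measure lborel {x. l \<le> v x}" and ?m2 = "measure lborel {x. 2 * l \<le> v x}"
  have m: "emeasure lborel {x. l \<le> v x} = ennreal ?m1" "emeasure lborel {x. 2 * l \<le> v x} = ennreal ?m2"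
    using superlevel_finite(1)[OF assms(1) v1, of l] superlevel_finite(1)[OF assms(1) v1, of "2 * l"] l
    by (auto intro!: emeasure_eq_ennreal_measure)
  have L: "(\<integral>\<^sup>+x. ennreal ((f (x + y) - f x)\<^sup>2) \<partial>lborel) \<le> ennreal (\<Lambda> * r\<^sup>2)" if "y \<in> cbox 0 (r *\<^sub>R One)" for y
  proof -
    have "(f (x + y) - f x)\<^sup>2 \<le> (v (x + y) - v x)\<^sup>2" for x
    proof -
      have "\<bar>f (x + y) - f x\<bar> \<le> \<bar>v (x + y) - v x\<bar>" unfolding f_def by linarith
      then show ?thesis by (simp add: abs_le_square_iff)
    qed
    then have "(\<integral>\<^sup>+x. ennreal ((f (x + y) - f x)\<^sup>2) \<partial>lborel) \<le> (\<integral>\<^sup>+x. ennreal ((v (x + y) - v x)\<^sup>2) \<partial>lborel)"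
      by (intro nn_integral_mono ennreal_leI)
    also have "\<dots> \<le> ennreal (\<Lambda> * r\<^sup>2)" using tb that r by (auto simp: translation_bounded_def)
    finally show ?thesis .
  qed
  \<comment> \<open>The truncation equals \<open>l\<close> on the higher superlevel set and vanishes
    off the lower one, so its L^2 norm sees the first measure and its L^1 norm the second.\<close>
  have lower: "ennreal (l\<^sup>2 * ?m2) \<le> (\<integral>\<^sup>+x. ennreal ((f x)\<^sup>2) \<partial>lborel)"
  proof -
    have "ennreal (l\<^sup>2 * ?m2) = (\<integral>\<^sup>+x. ennreal (l\<^sup>2) * indicator {x. 2 * l \<le> v x} x \<partial>lborel)"
      by (subst nn_integral_cmult_indicator) (auto simp: m ennreal_mult)
    also have "\<dots> \<le> (\<integral>\<^sup>+x. ennreal ((f x)\<^sup>2) \<partial>lborel)"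
      using l by (intro nn_integral_mono) (auto simp: indicator_def f_def)
    finally show ?thesis .
  qed
  have upper: "(\<integral>\<^sup>+x. ennreal (f x) \<partial>lborel) \<le> ennreal (l * ?m1)"
  proof -
    have "(\<integral>\<^sup>+x. ennreal (f x) \<partial>lborel) \<le> (\<integral>\<^sup>+x. ennreal l * indicator {x. l \<le> v x} x \<partial>lborel)"
      using l by (intro nn_integral_mono) (auto simp: indicator_def f_def intro!: ennreal_leI)
    also have "\<dots> = ennreal (l * ?m1)"
      using l by (subst nn_integral_cmult_indicator) (auto simp: m ennreal_mult)
    finally show ?thesis .
  qed
  have "ennreal (r ^ DIM('a) * (l\<^sup>2 * ?m2)) = ennreal (r ^ DIM('a)) * ennreal (l\<^sup>2 * ?m2)"
    using r by (simp add: ennreal_mult)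
  also have "\<dots> \<le> ennreal (r ^ DIM('a)) * (\<integral>\<^sup>+x. ennreal ((f x)\<^sup>2) \<partial>lborel)"
    by (rule mult_left_mono[OF lower]) simp
  also have "\<dots> \<le> ennreal (r ^ DIM('a)) * ennreal (\<Lambda> * r\<^sup>2) + 2 * (\<integral>\<^sup>+x. ennreal (f x) \<partial>lborel)\<^sup>2"
    by (rule nash_inequality) (use f0 r L in auto)
  also have "\<dots> \<le> ennreal (r ^ DIM('a)) * ennreal (\<Lambda> * r\<^sup>2) + 2 * (ennreal (l * ?m1))\<^sup>2"
    by (intro add_left_mono mult_left_mono power_mono upper) auto
  also have "\<dots> = ennreal (r ^ DIM('a) * (\<Lambda> * r\<^sup>2) + 2 * (l * ?m1)\<^sup>2)"
  proof -
    have "(ennreal (l * ?m1))\<^sup>2 = ennreal ((l * ?m1)\<^sup>2)" using l by (intro ennreal_power) simp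
    moreover have "2 * ennreal ((l * ?m1)\<^sup>2) = ennreal (2 * (l * ?m1)\<^sup>2)"
      by (subst ennreal_mult) auto
    ultimately show ?thesis using r \<Lambda> by (simp add: ennreal_plus ennreal_mult'[symmetric] del: ennreal_mult')
  qed
  finally have "r ^ DIM('a) * (l\<^sup>2 * ?m2) \<le> r ^ DIM('a) * (\<Lambda> * r\<^sup>2) + 2 * (l * ?m1)\<^sup>2"
    using r \<Lambda> by (subst (asm) ennreal_le_iff) auto
  then show ?thesis using r l by (simp add: field_simps power_mult_distrib)
qed

text \<open>The radius $r = R\,2^{-2k/(N-2)}$ makes both terms of the recursion scale like $2^{-\sigma k}$;
  then \<open>K\<close> and \<open>R\<close> only have to satisfy $\Lambda R^2 + 2K^2/R^N \le 2^{-\sigma}K$.\<close>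

lemma superlevel_decay:
  assumes N: "CARD('n::finite) \<ge> 3" and \<Lambda>: "\<Lambda> \<ge> 0"
  defines "\<sigma> \<equiv> critical_exponent CARD('n)"
  shows "\<exists>K\<ge>1. \<forall>v :: real ^ 'n \<Rightarrow> real. v \<in> borel_measurable borel \<longrightarrow> (\<integral>\<^sup>+x. ennreal (v x) \<partial>lborel) \<le> 1 \<longrightarrow>
    translation_bounded \<Lambda> v \<longrightarrow> (\<forall>k. measure lborel {x. 2 ^ k \<le> v x} \<le> K * 2 powr (- (\<sigma> * real k)))"
proof -
  let ?N = "CARD('n)"
  define c where "c = 2 powr (- \<sigma>)"
  have c: "c > 0" by (simp add: c_def)
  \<comment> \<open>\<open>K\<close> is chosen so that 2 K^2 / R^N is exactly half of K c. The other
    half must absorb \<Lambda> R^2: since N \<ge> 3 gives R^3 \<le> R^N, the bound R \<ge> 8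
    \<Lambda> / c^2 is enough. R \<ge> 4 / c yields K \<ge> 1, which starts the induction by
    Chebyshev at level 1.\<close>
  define R where "R = max 1 (max (8 * \<Lambda> / c\<^sup>2) (4 / c))"
  define K where "K = c * R ^ ?N / 4"
  have R: "R \<ge> 1" "R \<ge> 8 * \<Lambda> / c\<^sup>2" "R \<ge> 4 / c" by (auto simp: R_def)
  have RN: "R \<le> R ^ (?N - 2)" "R \<le> R ^ ?N" using R(1) N by (auto intro!: self_le_power)
  have "c * R \<ge> 4" using R(3) c by (simp add: field_simps)
  moreover have "c * R \<le> c * R ^ ?N" using RN(2) c by simp
  ultimately have K: "K \<ge> 1" by (simp add: K_def)
  have "?N = (?N - 2) + 2" using N by simp
  then have "R ^ ?N = R ^ (?N - 2) * R\<^sup>2" by (metis power_add)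
  moreover have "R * R\<^sup>2 \<le> R ^ (?N - 2) * R\<^sup>2" using RN(1) by (rule mult_right_mono) simp
  moreover have "8 * \<Lambda> * R\<^sup>2 \<le> c\<^sup>2 * (R * R\<^sup>2)"
    using mult_right_mono[OF R(2), of "c\<^sup>2 * R\<^sup>2"] c by (simp add: field_simps)
  moreover have "c\<^sup>2 * (R * R\<^sup>2) \<le> c\<^sup>2 * R ^ ?N"
    using calculation(1,2) by (intro mult_left_mono) auto
  ultimately have "8 * \<Lambda> * R\<^sup>2 \<le> c\<^sup>2 * R ^ ?N" by linarith
  moreover have "K * c / 2 = c\<^sup>2 * R ^ ?N / 8" by (simp add: K_def power2_eq_square)
  ultimately have 1: "\<Lambda> * R\<^sup>2 \<le> K * c / 2" by simp
  have 2: "2 * K\<^sup>2 / R ^ ?N = K * c / 2" using R(1) by (simp add: K_def power2_eq_square field_simps)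
  have step: "\<Lambda> * R\<^sup>2 + 2 * K\<^sup>2 / R ^ ?N \<le> K * c" using 1 2 by simp
  have \<sigma>: "\<sigma> * (real ?N - 2) = 2 * real ?N" using N by (simp add: \<sigma>_def critical_exponent_def)
  have "measure lborel {x. 2 ^ k \<le> v x} \<le> K * 2 powr (- (\<sigma> * real k))"
    if [measurable]: "v \<in> borel_measurable borel" and v1: "(\<integral>\<^sup>+x. ennreal (v x) \<partial>lborel) \<le> 1" and tb: "translation_bounded \<Lambda> v"
    for v :: "real ^ 'n \<Rightarrow> real" and k
  proof (induction k)
    case 0
    then show ?case using superlevel_finite(2)[OF that(1) v1, of 1] K by simp
  next
    case (Suc k)
    \<comment> \<open>For this \<open>t\<close> both 2t + 2k and tN equal \<sigma> k. The squared
      induction bound contributes 2^(-2 \<sigma> k), of which the denominator r^N takes back one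
      factor 2^(-\<sigma> k).\<close>
    define t where "t = 2 * real k / (real ?N - 2)"
    define r where "r = R * 2 powr (- t)"
    have r: "r > 0" using R(1) by (simp add: r_def)
    have tN: "t * (real ?N - 2) = 2 * real k" using N by (simp add: t_def)
    have e1: "2 * t + 2 * real k = \<sigma> * real k"
    proof -
      have "(2 * t + 2 * real k) * (real ?N - 2) = 2 * (t * (real ?N - 2)) + 2 * real k * (real ?N - 2)"
        by (simp add: algebra_simps)
      also have "\<dots> = real k * (2 * real ?N)" unfolding tN by (simp add: algebra_simps)
      also have "\<dots> = \<sigma> * real k * (real ?N - 2)" unfolding \<sigma>[symmetric] by simp
      finally have "(2 * t + 2 * real k) * (real ?N - 2) = \<sigma> * real k * (real ?N - 2)" .
      then show ?thesis using N by simp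
    qed
    have e2: "t * real ?N = \<sigma> * real k"
    proof -
      have "(t * real ?N) * (real ?N - 2) = (t * (real ?N - 2)) * real ?N" by simp
      also have "\<dots> = real k * (2 * real ?N)" unfolding tN by simp
      also have "\<dots> = \<sigma> * real k * (real ?N - 2)" unfolding \<sigma>[symmetric] by simp
      finally have "(t * real ?N) * (real ?N - 2) = \<sigma> * real k * (real ?N - 2)" .
      then show ?thesis using N by simp
    qed
    have p1: "r\<^sup>2 / (2 ^ k)\<^sup>2 = R\<^sup>2 * 2 powr (- (\<sigma> * real k))"
    proof -
      have "(2 powr (- t))\<^sup>2 = 2 powr (- (2 * t))" using powr_add[of 2 "- t" "- t"] by (simp add: power2_eq_square)
      then have r2: "r\<^sup>2 = R\<^sup>2 * 2 powr (- (2 * t))" by (simp only: r_def power_mult_distrib)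
      have "(2 ^ k :: real)\<^sup>2 = 2 ^ (2 * k)" by (simp only: power_mult[symmetric] mult.commute)
      then have k2: "(2 ^ k :: real)\<^sup>2 = 2 powr (2 * real k)" using powr_realpow[of 2 "2 * k"] by simp
      have "2 powr (- (2 * t)) / 2 powr (2 * real k) = 2 powr (- (\<sigma> * real k))"
        unfolding powr_diff[symmetric] e1[symmetric] by (rule arg_cong[where f="\<lambda>y. 2 powr y"]) simp
      then show ?thesis unfolding r2 k2 by (metis times_divide_eq_right)
    qed
    have p2: "r ^ ?N = R ^ ?N * 2 powr (- (\<sigma> * real k))"
    proof -
      have "(2 powr (- t)) ^ ?N = 2 powr (- (t * real ?N))" by (simp add: powr_power mult.commute)
      then show ?thesis unfolding e2 r_def power_mult_distrib by simp
    qed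
    have "measure lborel {x. 2 ^ Suc k \<le> v x} \<le> \<Lambda> * r\<^sup>2 / (2 ^ k)\<^sup>2 + 2 * (measure lborel {x. 2 ^ k \<le> v x})\<^sup>2 / r ^ ?N"
      using superlevel_recursion[OF that(1) v1 tb \<Lambda> _ r, of "2 ^ k"] by simp
    also have "\<dots> \<le> \<Lambda> * r\<^sup>2 / (2 ^ k)\<^sup>2 + 2 * (K * 2 powr (- (\<sigma> * real k)))\<^sup>2 / r ^ ?N"
      using r Suc.IH by (intro add_left_mono divide_right_mono mult_left_mono power_mono) auto
    also have "\<dots> = \<Lambda> * (r\<^sup>2 / (2 ^ k)\<^sup>2) + 2 * (K * 2 powr (- (\<sigma> * real k)))\<^sup>2 / r ^ ?N" by simp
    also have "\<dots> = (\<Lambda> * R\<^sup>2 + 2 * K\<^sup>2 / R ^ ?N) * 2 powr (- (\<sigma> * real k))"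
      unfolding p1 p2 using R(1) by (simp add: field_simps power2_eq_square)
    also have "\<dots> \<le> (K * c) * 2 powr (- (\<sigma> * real k))" by (rule mult_right_mono[OF step]) simp
    also have "\<dots> = K * 2 powr (- (\<sigma> * real (Suc k)))"
      by (simp add: c_def powr_add[symmetric] algebra_simps)
    finally show ?case .
  qed
  with K show ?thesis by blast
qed

text \<open>Values up to 1 are absorbed by \<open>t\<close> itself because q \<ge> 1; a value in
  [2^k, 2^(k+1)) is covered by the k-th summand alone.\<close>

lemma powr_le_dyadic_sum:
  fixes t q :: real
  assumes "q \<ge> 1" "t \<ge> 0"
  shows "ennreal (t powr q) \<le> ennreal t + (\<Sum>k. ennreal (2 powr ((real k + 1) * q)) * indicator {x. 2 ^ k \<le> x} t)"
proof (cases "t \<le> 1")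
  case True
  then have "t powr q \<le> t powr 1" using assms powr_mono'[of 1 q t] by simp
  then have "ennreal (t powr q) \<le> ennreal t" using assms by (intro ennreal_leI) simp
  also have "\<dots> \<le> ennreal t + (\<Sum>k. ennreal (2 powr ((real k + 1) * q)) * indicator {x. 2 ^ k \<le> x} t)"
    by simp
  finally show ?thesis .
next
  case False
  define k where "k = nat \<lfloor>log 2 t\<rfloor>"
  have l0: "log 2 t \<ge> 0" using False by simp
  then have k: "real k \<le> log 2 t" "log 2 t < real k + 1" unfolding k_def by linarith+
  have "2 ^ k \<le> t" using k(1) False by (simp add: le_log_iff powr_realpow)
  have "t < 2 powr (real k + 1)" using k(2) False by (simp add: log_less_iff)
  then have "t powr q \<le> (2 powr (real k + 1)) powr q" using assms by (intro powr_mono2) auto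
  then have "ennreal (t powr q) \<le> ennreal (2 powr ((real k + 1) * q)) * indicator {x. 2 ^ k \<le> x} t"
    using \<open>2 ^ k \<le> t\<close> by (simp add: powr_powr ennreal_leI)
  also have "\<dots> = (\<Sum>i\<in>{k}. ennreal (2 powr ((real i + 1) * q)) * indicator {x. 2 ^ i \<le> x} t)"
    by (subst sum.insert) auto
  also have "\<dots> \<le> (\<Sum>i. ennreal (2 powr ((real i + 1) * q)) * indicator {x. 2 ^ i \<le> x} t)"
    by (rule sum_le_suminf) auto
  also have "\<dots> \<le> ennreal t + \<dots>" by simp
  finally show ?thesis .
qed

text \<open>Summing the superlevel bounds over dyadic levels gives a geometric series of ratio 2^(q
  - \<sigma>), convergent exactly because \<open>q\<close> is below the critical exponent; the L^1
  bound handles the small values of \<open>v\<close>.\<close>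

lemma subcritical_bound:
  assumes N: "CARD('n::finite) \<ge> 3" and \<Lambda>: "\<Lambda> \<ge> 0" and q: "1 \<le> q" "q < critical_exponent CARD('n)"
  shows "\<exists>M\<ge>0. \<forall>v :: real ^ 'n \<Rightarrow> real. v \<in> borel_measurable borel \<longrightarrow> (\<forall>x. 0 \<le> v x) \<longrightarrow> (\<integral>\<^sup>+x. ennreal (v x) \<partial>lborel) \<le> 1 \<longrightarrow>
    translation_bounded \<Lambda> v \<longrightarrow> (\<integral>\<^sup>+x. ennreal (v x powr q) \<partial>lborel) \<le> ennreal M"
proof -
  define \<sigma> where "\<sigma> = critical_exponent CARD('n)"
  obtain K where K: "K \<ge> 1" and decay: "\<And>v :: real ^ 'n \<Rightarrow> real. \<lbrakk>v \<in> borel_measurable borel; (\<integral>\<^sup>+x. ennreal (v x) \<partial>lborel) \<le> 1;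
    translation_bounded \<Lambda> v\<rbrakk> \<Longrightarrow> (\<forall>k. measure lborel {x. 2 ^ k \<le> v x} \<le> K * 2 powr (- (\<sigma> * real k)))"
    using superlevel_decay[OF N \<Lambda>] unfolding \<sigma>_def by metis
  define \<rho> where "\<rho> = 2 powr (q - \<sigma>)"
  have \<rho>: "0 < \<rho>" "\<rho> < 1" using q by (auto simp: \<rho>_def \<sigma>_def powr_less_one)
  define M where "M = 1 + 2 powr q * K * (1 / (1 - \<rho>))"
  have M: "M \<ge> 0" using K \<rho> by (simp add: M_def)
  have "(\<integral>\<^sup>+x. ennreal (v x powr q) \<partial>lborel) \<le> ennreal M"
    if [measurable]: "v \<in> borel_measurable borel" and v0: "\<And>x. 0 \<le> v x" and v1: "(\<integral>\<^sup>+x. ennreal (v x) \<partial>lborel) \<le> 1" and tb: "translation_bounded \<Lambda> v"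
    for v :: "real ^ 'n \<Rightarrow> real"
  proof -
    have "(\<integral>\<^sup>+x. ennreal (v x powr q) \<partial>lborel) \<le>
      (\<integral>\<^sup>+x. ennreal (v x) + (\<Sum>k. ennreal (2 powr ((real k + 1) * q)) * indicator {x. 2 ^ k \<le> v x} x) \<partial>lborel)"
    proof (rule nn_integral_mono)
      fix x
      have "indicator {x. 2 ^ k \<le> v x} x = (indicator {x. 2 ^ k \<le> x} (v x) :: ennreal)" for k by (simp add: indicator_def)
      then show "ennreal (v x powr q) \<le> ennreal (v x) + (\<Sum>k. ennreal (2 powr ((real k + 1) * q)) * indicator {x. 2 ^ k \<le> v x} x)"
        using powr_le_dyadic_sum[OF q(1) v0[of x]] by simp
    qed
    also have "\<dots> = (\<integral>\<^sup>+x. ennreal (v x) \<partial>lborel) + (\<Sum>k. ennreal (2 powr ((real k + 1) * q)) * emeasure lborel {x. 2 ^ k \<le> v x})"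
      by (subst nn_integral_add) (auto simp: nn_integral_suminf nn_integral_cmult_indicator)
    also have "\<dots> \<le> 1 + (\<Sum>k. ennreal (2 powr q * K * \<rho> ^ k))"
    proof (intro add_mono v1 suminf_le)
      fix k
      have "emeasure lborel {x. 2 ^ k \<le> v x} = ennreal (measure lborel {x. 2 ^ k \<le> v x})"
        using superlevel_finite(1)[OF that(1) v1, of "2 ^ k"] by (intro emeasure_eq_ennreal_measure) auto
      also have "\<dots> \<le> ennreal (K * 2 powr (- (\<sigma> * real k)))"
        using decay[OF that(1) v1 tb] by (intro ennreal_leI) blast
      finally have "ennreal (2 powr ((real k + 1) * q)) * emeasure lborel {x. 2 ^ k \<le> v x} \<le>
        ennreal (2 powr ((real k + 1) * q)) * ennreal (K * 2 powr (- (\<sigma> * real k)))"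
        by (rule mult_left_mono) simp
      also have "\<dots> = ennreal (2 powr ((real k + 1) * q) * (K * 2 powr (- (\<sigma> * real k))))"
        using K by (simp add: ennreal_mult)
      also have "2 powr ((real k + 1) * q) * (K * 2 powr (- (\<sigma> * real k))) = 2 powr q * K * \<rho> ^ k"
        by (simp add: \<rho>_def powr_power powr_add[symmetric] algebra_simps)
      finally show "ennreal (2 powr ((real k + 1) * q)) * emeasure lborel {x. 2 ^ k \<le> v x} \<le> ennreal (2 powr q * K * \<rho> ^ k)" .
    qed auto
    also have "(\<Sum>k. ennreal (2 powr q * K * \<rho> ^ k)) = ennreal (\<Sum>k. 2 powr q * K * \<rho> ^ k)"
      using K \<rho> by (intro suminf_ennreal2) (auto intro!: summable_mult summable_geometric)
    also have "(\<Sum>k. 2 powr q * K * \<rho> ^ k) = 2 powr q * K * (1 / (1 - \<rho>))"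
      using \<rho> by (simp add: suminf_mult suminf_geometric summable_geometric)
    also have "1 + ennreal (2 powr q * K * (1 / (1 - \<rho>))) = ennreal M"
      using K \<rho> by (simp add: M_def ennreal_plus)
    finally show ?thesis .
  qed
  with M show ?thesis by blast
qed

section \<open>Scaling\<close>

lemma lebesgue_scale:
  assumes "c > 0"
  shows "(lebesgue :: 'a::euclidean_space measure) = density (distr lebesgue lebesgue (\<lambda>x. c *\<^sub>R x)) (\<lambda>_. ennreal (c ^ DIM('a)))"
    "(\<lambda>x::'a. c *\<^sub>R x) \<in> lebesgue \<rightarrow>\<^sub>M lebesgue"
proof -
  have T: "(\<lambda>x::'a. 0 + (\<Sum>j\<in>Basis. (c * (x \<bullet> j)) *\<^sub>R j)) = (\<lambda>x. c *\<^sub>R x)"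
    by (simp add: scaleR_sum_right[symmetric] scaleR_scaleR[symmetric] euclidean_representation del: scaleR_scaleR)
  show "(lebesgue :: 'a measure) = density (distr lebesgue lebesgue (\<lambda>x. c *\<^sub>R x)) (\<lambda>_. ennreal (c ^ DIM('a)))"
    using lebesgue_affine_euclidean[of "\<lambda>_::'a. c" 0] assms unfolding T by simp
  show "(\<lambda>x::'a. c *\<^sub>R x) \<in> lebesgue \<rightarrow>\<^sub>M lebesgue"
    using lebesgue_affine_measurable[of "\<lambda>_::'a. c" 0] assms unfolding T by simp
qed

lemma measurable_scale:
  fixes f :: "'a::euclidean_space \<Rightarrow> 'b::topological_space"
  assumes "f \<in> borel_measurable lebesgue" "c > 0"
  shows "(\<lambda>x. f (c *\<^sub>R x)) \<in> borel_measurable lebesgue"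
  by (rule measurable_compose[OF lebesgue_scale(2)[OF assms(2)] assms(1)])

lemma integral_scale:
  fixes f :: "'a::euclidean_space \<Rightarrow> real"
  assumes f: "f \<in> borel_measurable lebesgue" and c: "c > 0"
  shows "(\<integral>x. f (c *\<^sub>R x) \<partial>lebesgue) = (\<integral>x. f x \<partial>lebesgue) / c ^ DIM('a)"
    "integrable lebesgue (\<lambda>x. f (c *\<^sub>R x)) \<longleftrightarrow> integrable lebesgue f"
proof -
  note [measurable] = lebesgue_scale(2)[OF c, where 'a='a] f
  have "(\<integral>x. f x \<partial>lebesgue) = (\<integral>x. f x \<partial>(density (distr lebesgue lebesgue (\<lambda>x. c *\<^sub>R x)) (\<lambda>_. ennreal (c ^ DIM('a)))))"
    by (simp flip: lebesgue_scale(1)[OF c])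
  also have "\<dots> = (\<integral>x. c ^ DIM('a) * f x \<partial>(distr lebesgue lebesgue (\<lambda>x. c *\<^sub>R x)))"
    using c by (subst integral_density) auto
  also have "\<dots> = c ^ DIM('a) * (\<integral>x. f (c *\<^sub>R x) \<partial>lebesgue)"
    by (subst integral_distr) auto
  finally show "(\<integral>x. f (c *\<^sub>R x) \<partial>lebesgue) = (\<integral>x. f x \<partial>lebesgue) / c ^ DIM('a)"
    using c by simp
  have "integrable lebesgue f \<longleftrightarrow> integrable (density (distr lebesgue lebesgue (\<lambda>x. c *\<^sub>R x)) (\<lambda>_. ennreal (c ^ DIM('a)))) f"
    by (simp flip: lebesgue_scale(1)[OF c])
  also have "\<dots> \<longleftrightarrow> integrable (distr lebesgue lebesgue (\<lambda>x. c *\<^sub>R x)) (\<lambda>x. c ^ DIM('a) * f x)"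
    using c by (subst integrable_density) auto
  also have "\<dots> \<longleftrightarrow> integrable lebesgue (\<lambda>x. c ^ DIM('a) * f (c *\<^sub>R x))"
    by (subst integrable_distr_eq) auto
  also have "\<dots> \<longleftrightarrow> integrable lebesgue (\<lambda>x. f (c *\<^sub>R x))"
    using c by simp
  finally show "integrable lebesgue (\<lambda>x. f (c *\<^sub>R x)) \<longleftrightarrow> integrable lebesgue f" by simp
qed

lemma test_function_scale:
  assumes \<phi>: "test_function \<phi>" and c: "c > 0"
  shows "test_function (\<lambda>x. \<phi> (c *\<^sub>R x))"
proof -
  have "bounded {x. \<phi> x \<noteq> 0}" using \<phi> by (simp add: test_function_def)
  then have "bounded ((\<lambda>x. (1 / c) *\<^sub>R x) ` {x. \<phi> x \<noteq> 0})" by (rule bounded_scaling)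
  moreover have "{x. \<phi> (c *\<^sub>R x) \<noteq> 0} \<subseteq> (\<lambda>x. (1 / c) *\<^sub>R x) ` {x. \<phi> x \<noteq> 0}"
  proof
    fix x assume "x \<in> {x. \<phi> (c *\<^sub>R x) \<noteq> 0}"
    then show "x \<in> (\<lambda>x. (1 / c) *\<^sub>R x) ` {x. \<phi> x \<noteq> 0}"
      using c by (intro image_eqI[of _ _ "c *\<^sub>R x"]) auto
  qed
  ultimately have "bounded {x. \<phi> (c *\<^sub>R x) \<noteq> 0}" by (rule bounded_subset)
  moreover have "C_k k (\<lambda>x. \<phi> (c *\<^sub>R x))" for k
    using \<phi> by (intro C_k_scale) (simp add: test_function_def)
  ultimately show ?thesis by (simp add: test_function_def)
qed

lemma locally_integrable_scale:
  assumes f: "locally_integrable f" and c: "c > 0"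
  shows "locally_integrable (\<lambda>x. d *\<^sub>R f (c *\<^sub>R x))"
  unfolding locally_integrable_def
proof (intro conjI allI impI)
  have m: "f \<in> borel_measurable lebesgue" using f by (simp add: locally_integrable_def)
  show m': "(\<lambda>x. d *\<^sub>R f (c *\<^sub>R x)) \<in> borel_measurable lebesgue"
    using measurable_scale[OF m c] by simp
  fix K :: "(real ^ 'a) set" assume K: "compact K"
  have K': "compact ((\<lambda>x. c *\<^sub>R x) ` K)" using K by (rule compact_scaling)
  have "integrable lebesgue (\<lambda>x. norm (indicator ((\<lambda>x. c *\<^sub>R x) ` K) x *\<^sub>R f x))"
    using f K' unfolding locally_integrable_def set_integrable_def by (intro integrable_norm) blast
  moreover have "(\<lambda>x. norm (indicator ((\<lambda>x. c *\<^sub>R x) ` K) x *\<^sub>R f x)) \<in> borel_measurable lebesgue"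
    using calculation by (rule borel_measurable_integrable)
  ultimately have "integrable lebesgue (\<lambda>x. norm (indicator ((\<lambda>x. c *\<^sub>R x) ` K) (c *\<^sub>R x) *\<^sub>R f (c *\<^sub>R x)))"
    using integral_scale(2)[OF _ c, of "\<lambda>x. norm (indicator ((\<lambda>x. c *\<^sub>R x) ` K) x *\<^sub>R f x)"] by blast
  moreover have "indicator ((\<lambda>x. c *\<^sub>R x) ` K) (c *\<^sub>R x) = (indicator K x :: real)" for x
    using c by (auto simp: indicator_def)
  ultimately have "integrable lebesgue (\<lambda>x. \<bar>d\<bar> * norm (indicator K x *\<^sub>R f (c *\<^sub>R x)))" by simp
  then show "set_integrable lebesgue K (\<lambda>x. d *\<^sub>R f (c *\<^sub>R x))"
    unfolding set_integrable_def
  proof (rule Bochner_Integration.integrable_bound)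
    have "K \<in> sets lborel" using K borel_compact by simp
    then have "K \<in> sets lebesgue" by (rule sets_completionI_sets)
    then show "(\<lambda>x. indicator K x *\<^sub>R d *\<^sub>R f (c *\<^sub>R x)) \<in> borel_measurable lebesgue"
      by (intro borel_measurable_scaleR[OF borel_measurable_indicator m'])
  qed (auto intro!: AE_I2 simp: indicator_def)
qed

text \<open>Every test function is the dilate of another one, and the change of variables puts the
  same Jacobian on both sides of the identity for \<open>u\<close>.\<close>

lemma has_weak_gradient_scale:
  fixes u :: "real ^ 'n \<Rightarrow> real"
  assumes wg: "has_weak_gradient u G" and c: "c > 0"
  shows "has_weak_gradient (\<lambda>x. s * u (c *\<^sub>R x)) (\<lambda>x. (s * c) *\<^sub>R G (c *\<^sub>R x))"
  unfolding has_weak_gradient_def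
proof (intro conjI allI impI)
  have li: "locally_integrable u" "locally_integrable G" using wg by (auto simp: has_weak_gradient_def)
  then show "locally_integrable (\<lambda>x. s * u (c *\<^sub>R x))" "locally_integrable (\<lambda>x. (s * c) *\<^sub>R G (c *\<^sub>R x))"
    using locally_integrable_scale[OF li(1) c, of s] locally_integrable_scale[OF li(2) c] by auto
  have mu: "u \<in> borel_measurable lebesgue" and mG: "G \<in> borel_measurable lebesgue"
    using li by (auto simp: locally_integrable_def)
  have mGi: "(\<lambda>x. G x $ i) \<in> borel_measurable lebesgue" for i
    by (rule measurable_compose[OF mG]) simp
  fix \<phi> :: "real ^ 'n \<Rightarrow> real" and i
  assume \<phi>: "test_function \<phi>"
  define \<psi> where "\<psi> x = \<phi> ((1 / c) *\<^sub>R x)" for x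
  have \<psi>: "test_function \<psi>" unfolding \<psi>_def[abs_def] using \<phi> c by (intro test_function_scale) auto
  have ml: "\<psi> \<in> borel_measurable lebesgue" "(\<lambda>x. frechet_derivative \<psi> (at x) v) \<in> borel_measurable lebesgue" for v
    by (rule measurable_completion; use test_function_borel[OF \<psi>] test_function_derivative(3)[OF \<psi>] in simp)+
  have eq: "\<phi> x = \<psi> (c *\<^sub>R x)" for x using c by (simp add: \<psi>_def)
  have d: "frechet_derivative \<phi> (at x) v = c * frechet_derivative \<psi> (at (c *\<^sub>R x)) v" for x v
  proof -
    have "((\<lambda>x. \<psi> (c *\<^sub>R x)) has_derivative (\<lambda>v. frechet_derivative \<psi> (at (c *\<^sub>R x)) (c *\<^sub>R v))) (at x)"
      by (rule has_derivative_compose[where f="\<lambda>x. c *\<^sub>R x" and g=\<psi>])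
        (auto intro!: derivative_eq_intros test_function_derivative(1)[OF \<psi>])
    moreover have "\<phi> = (\<lambda>x. \<psi> (c *\<^sub>R x))" using eq by (rule ext)
    ultimately have "frechet_derivative \<phi> (at x) = (\<lambda>v. frechet_derivative \<psi> (at (c *\<^sub>R x)) (c *\<^sub>R v))"
      by (simp only: frechet_derivative_at[symmetric])
    moreover have "linear (frechet_derivative \<psi> (at (c *\<^sub>R x)))"
      using test_function_derivative(1)[OF \<psi>] by (rule has_derivative_linear)
    ultimately show ?thesis by (simp add: linear_cmul)
  qed
  have "(\<integral>x. s * u (c *\<^sub>R x) * frechet_derivative \<phi> (at x) (axis i 1) \<partial>lebesgue) =
    (\<integral>x. (s * c) * (\<lambda>y. u y * frechet_derivative \<psi> (at y) (axis i 1)) (c *\<^sub>R x) \<partial>lebesgue)"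
    by (simp add: d mult_ac)
  also have "\<dots> = (s * c) * ((\<integral>y. u y * frechet_derivative \<psi> (at y) (axis i 1) \<partial>lebesgue) / c ^ DIM(real ^ 'n))"
    by (subst integral_mult_right_zero, subst integral_scale(1)[OF _ c]) (use mu ml in auto)
  also have "\<dots> = - ((s * c) * ((\<integral>y. G y $ i * \<psi> y \<partial>lebesgue) / c ^ DIM(real ^ 'n)))"
    using wg \<psi> by (simp add: has_weak_gradient_def)
  also have "(s * c) * ((\<integral>y. G y $ i * \<psi> y \<partial>lebesgue) / c ^ DIM(real ^ 'n)) = (\<integral>x. (s * c) * (\<lambda>y. G y $ i * \<psi> y) (c *\<^sub>R x) \<partial>lebesgue)"
    by (subst integral_mult_right_zero, subst integral_scale(1)[OF _ c]) (use mGi ml in auto)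
  also have "\<dots> = (\<integral>x. ((s * c) *\<^sub>R G (c *\<^sub>R x)) $ i * \<phi> x \<partial>lebesgue)"
    by (simp add: eq mult_ac)
  finally show "(\<integral>x. s * u (c *\<^sub>R x) * frechet_derivative \<phi> (at x) (axis i 1) \<partial>lebesgue) = - (\<integral>x. ((s * c) *\<^sub>R G (c *\<^sub>R x)) $ i * \<phi> x \<partial>lebesgue)" .
qed

definition dirichlet :: "(real ^ 'n \<Rightarrow> real) \<Rightarrow> real" where
  "dirichlet u = (\<integral>x. (norm (weak_gradient u x))\<^sup>2 \<partial>lebesgue)"

definition quasilinear :: "(real ^ 'n \<Rightarrow> real) \<Rightarrow> real" where
  "quasilinear u = (\<integral>x. \<bar>u x\<bar>\<^sup>2 * (norm (weak_gradient u x))\<^sup>2 \<partial>lebesgue)"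

definition lp_power :: "real \<Rightarrow> (real ^ 'n \<Rightarrow> real) \<Rightarrow> real" where
  "lp_power p u = (\<integral>x. \<bar>u x\<bar> powr p \<partial>lebesgue)"

lemma has_weak_gradient_weak_gradient:
  "has_weak_gradient u G \<Longrightarrow> has_weak_gradient u (weak_gradient u)"
  unfolding weak_gradient_def by (rule someI[of "has_weak_gradient u" G])

text \<open>Lets any explicitly known weak gradient stand in for the chosen one.\<close>

lemma weak_gradient_integrals:
  assumes wg: "has_weak_gradient u G" and u: "u \<in> borel_measurable lebesgue"
  shows "dirichlet u = (\<integral>x. (norm (G x))\<^sup>2 \<partial>lebesgue)"
    "integrable lebesgue (\<lambda>x. (norm (weak_gradient u x))\<^sup>2) \<longleftrightarrow> integrable lebesgue (\<lambda>x. (norm (G x))\<^sup>2)"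
    "quasilinear u = (\<integral>x. \<bar>u x\<bar>\<^sup>2 * (norm (G x))\<^sup>2 \<partial>lebesgue)"
    "integrable lebesgue (\<lambda>x. \<bar>u x\<bar>\<^sup>2 * (norm (weak_gradient u x))\<^sup>2) \<longleftrightarrow> integrable lebesgue (\<lambda>x. \<bar>u x\<bar>\<^sup>2 * (norm (G x))\<^sup>2)"
proof -
  note wg' = has_weak_gradient_weak_gradient[OF wg]
  have [measurable]: "G \<in> borel_measurable lebesgue" "weak_gradient u \<in> borel_measurable lebesgue"
    using wg wg' by (auto simp: has_weak_gradient_def locally_integrable_def)
  note [measurable] = u
  have AE: "AE x in lebesgue. weak_gradient u x = G x" using has_weak_gradient_unique[OF wg' wg] .
  have 1: "AE x in lebesgue. (norm (weak_gradient u x))\<^sup>2 = (norm (G x))\<^sup>2" using AE by eventually_elim simp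
  have 2: "AE x in lebesgue. \<bar>u x\<bar>\<^sup>2 * (norm (weak_gradient u x))\<^sup>2 = \<bar>u x\<bar>\<^sup>2 * (norm (G x))\<^sup>2" using AE by eventually_elim simp
  show "dirichlet u = (\<integral>x. (norm (G x))\<^sup>2 \<partial>lebesgue)"
    unfolding dirichlet_def using 1 by (intro integral_cong_AE) measurable
  show "integrable lebesgue (\<lambda>x. (norm (weak_gradient u x))\<^sup>2) \<longleftrightarrow> integrable lebesgue (\<lambda>x. (norm (G x))\<^sup>2)"
    using 1 by (intro integrable_cong_AE) measurable
  show "quasilinear u = (\<integral>x. \<bar>u x\<bar>\<^sup>2 * (norm (G x))\<^sup>2 \<partial>lebesgue)"
    unfolding quasilinear_def using 2 by (intro integral_cong_AE) measurable
  show "integrable lebesgue (\<lambda>x. \<bar>u x\<bar>\<^sup>2 * (norm (weak_gradient u x))\<^sup>2) \<longleftrightarrow> integrable lebesgue (\<lambda>x. \<bar>u x\<bar>\<^sup>2 * (norm (G x))\<^sup>2)"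
    using 2 by (intro integrable_cong_AE) measurable
qed

text \<open>Each integral scales by a monomial: the squared gradient brings c^2, the Jacobian 1 /
  c^N, and the quasilinear integrand is quartic in the function. Used for normalization, for a pure
  amplitude change (c = 1), and for the mass-preserving dilation s = c^(N/2).\<close>

lemma mass_sphere_scale:
  fixes u :: "real ^ 'n \<Rightarrow> real"
  assumes u: "u \<in> mass_sphere a" and c: "c > 0" and s: "s > 0" and b: "b\<^sup>2 = s\<^sup>2 * a\<^sup>2 / c ^ CARD('n)"
  defines "w \<equiv> \<lambda>x. s * u (c *\<^sub>R x)"
  shows "w \<in> mass_sphere b"
    "dirichlet w = s\<^sup>2 * c\<^sup>2 / c ^ CARD('n) * dirichlet u"
    "quasilinear w = s ^ 4 * c\<^sup>2 / c ^ CARD('n) * quasilinear u"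
    "lp_power p w = s powr p / c ^ CARD('n) * lp_power p u"
    "integrable lebesgue (\<lambda>x. \<bar>w x\<bar> powr p) \<longleftrightarrow> integrable lebesgue (\<lambda>x. \<bar>u x\<bar> powr p)"
proof -
  from u have mu: "u \<in> borel_measurable lebesgue" and iu: "integrable lebesgue (\<lambda>x. (u x)\<^sup>2)"
    and ig: "integrable lebesgue (\<lambda>x. (norm (weak_gradient u x))\<^sup>2)"
    and iq: "integrable lebesgue (\<lambda>x. \<bar>u x\<bar>\<^sup>2 * (norm (weak_gradient u x))\<^sup>2)"
    and m: "(\<integral>x. \<bar>u x\<bar>\<^sup>2 \<partial>lebesgue) = a\<^sup>2"
    by (auto simp: mass_sphere_def sobolev_H1_def)
  define G where "G = weak_gradient u"
  have wg: "has_weak_gradient u G" unfolding G_def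
    using u has_weak_gradient_weak_gradient by (auto simp: mass_sphere_def sobolev_H1_def)
  have mG: "G \<in> borel_measurable lebesgue" using wg by (auto simp: has_weak_gradient_def locally_integrable_def)
  note [measurable] = mu mG
  have wgw: "has_weak_gradient w (\<lambda>x. (s * c) *\<^sub>R G (c *\<^sub>R x))"
    unfolding w_def by (rule has_weak_gradient_scale[OF wg c])
  have mw: "w \<in> borel_measurable lebesgue" unfolding w_def using measurable_scale[OF mu c] by simp
  have e1: "(norm ((s * c) *\<^sub>R G (c *\<^sub>R x)))\<^sup>2 = (s\<^sup>2 * c\<^sup>2) * (\<lambda>y. (norm (G y))\<^sup>2) (c *\<^sub>R x)" for x
    by (simp add: power_mult_distrib)
  have e2: "\<bar>w x\<bar>\<^sup>2 * (norm ((s * c) *\<^sub>R G (c *\<^sub>R x)))\<^sup>2 = (s ^ 4 * c\<^sup>2) * (\<lambda>y. \<bar>u y\<bar>\<^sup>2 * (norm (G y))\<^sup>2) (c *\<^sub>R x)" for x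
    by (simp add: w_def power_mult_distrib power4_eq_xxxx power2_eq_square)
  have e3: "\<bar>w x\<bar> powr p = s powr p * (\<lambda>y. \<bar>u y\<bar> powr p) (c *\<^sub>R x)" for x
    using s by (simp add: w_def abs_mult powr_mult)
  have e4: "\<bar>w x\<bar>\<^sup>2 = s\<^sup>2 * (\<lambda>y. \<bar>u y\<bar>\<^sup>2) (c *\<^sub>R x)" for x
    by (simp add: w_def power_mult_distrib)
  have N: "DIM(real ^ 'n) = CARD('n)" by simp
  note D = integral_scale[OF _ c, where 'a="real ^ 'n", unfolded N]
  have gi: "integrable lebesgue (\<lambda>x. (norm (weak_gradient w x))\<^sup>2)"
    unfolding weak_gradient_integrals(2)[OF wgw mw] e1
    using ig[folded G_def] by (intro integrable_mult_right, subst D(2)) auto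
  have qi: "integrable lebesgue (\<lambda>x. \<bar>w x\<bar>\<^sup>2 * (norm (weak_gradient w x))\<^sup>2)"
    unfolding weak_gradient_integrals(4)[OF wgw mw] e2
    using iq[folded G_def] by (intro integrable_mult_right, subst D(2)) auto
  have wi: "integrable lebesgue (\<lambda>x. \<bar>w x\<bar>\<^sup>2)"
    unfolding e4 using iu by (intro integrable_mult_right, subst D(2)) auto
  have "(\<integral>x. \<bar>w x\<bar>\<^sup>2 \<partial>lebesgue) = s\<^sup>2 * (a\<^sup>2 / c ^ CARD('n))"
    unfolding e4 integral_mult_right_zero by (subst D(1)) (use m in auto)
  then show "w \<in> mass_sphere b"
    using gi qi wi mw wgw b by (auto simp: mass_sphere_def sobolev_H1_def)
  show "dirichlet w = s\<^sup>2 * c\<^sup>2 / c ^ CARD('n) * dirichlet u"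
    unfolding weak_gradient_integrals(1)[OF wgw mw] e1 integral_mult_right_zero
    by (subst D(1)) (measurable, simp add: dirichlet_def G_def)
  show "quasilinear w = s ^ 4 * c\<^sup>2 / c ^ CARD('n) * quasilinear u"
    unfolding weak_gradient_integrals(3)[OF wgw mw] e2 integral_mult_right_zero
    by (subst D(1)) (measurable, simp add: quasilinear_def G_def)
  show "lp_power p w = s powr p / c ^ CARD('n) * lp_power p u"
    unfolding lp_power_def e3 integral_mult_right_zero by (subst D(1)) auto
  show "integrable lebesgue (\<lambda>x. \<bar>w x\<bar> powr p) \<longleftrightarrow> integrable lebesgue (\<lambda>x. \<bar>u x\<bar> powr p)"
  proof -
    have "integrable lebesgue (\<lambda>x. \<bar>w x\<bar> powr p) \<longleftrightarrow> integrable lebesgue (\<lambda>x. (\<lambda>y. \<bar>u y\<bar> powr p) (c *\<^sub>R x))"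
      unfolding e3 using s by simp
    also have "\<dots> \<longleftrightarrow> integrable lebesgue (\<lambda>x. \<bar>u x\<bar> powr p)"
      by (rule D(2)) measurable
    finally show ?thesis .
  qed
qed

section \<open>The Gagliardo--Nirenberg inequality\<close>

lemma nn_integral_lebesgue_eq_lborel:
  fixes f g :: "'a::euclidean_space \<Rightarrow> real"
  assumes "g \<in> borel_measurable borel" "AE x in lborel. f x = g x"
  shows "(\<integral>\<^sup>+x. ennreal (g x) \<partial>lborel) = (\<integral>\<^sup>+x. ennreal (f x) \<partial>lebesgue)"
proof -
  have "(\<integral>\<^sup>+x. ennreal (g x) \<partial>lborel) = (\<integral>\<^sup>+x. ennreal (g x) \<partial>lebesgue)"
    using assms(1) by (intro nn_integral_completion[symmetric])
  also have "\<dots> = (\<integral>\<^sup>+x. ennreal (f x) \<partial>lebesgue)"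
  proof (rule nn_integral_cong_AE)
    show "AE x in lebesgue. ennreal (g x) = ennreal (f x)"
      using AE_completion[OF assms(2)] by eventually_elim simp
  qed
  finally show ?thesis .
qed

text \<open>Applied to the square \<open>v\<close> of \<open>u\<close>: its L^1 norm is the mass,
  its increments along axis i come from 2 u g_i, whose squared L^2 norm is at most four times the
  quasilinear integral, and its exponent p/2 is subcritical.\<close>

lemma normalized_bound:
  assumes N: "CARD('n::finite) \<ge> 3" and p: "2 \<le> p" "p < 2 * critical_exponent CARD('n)"
  shows "\<exists>M>0. \<forall>u :: real ^ 'n \<Rightarrow> real. u \<in> mass_sphere 1 \<longrightarrow> quasilinear u \<le> 1 \<longrightarrow>
    integrable lebesgue (\<lambda>x. \<bar>u x\<bar> powr p) \<and> lp_power p u \<le> M"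
proof -
  \<comment> \<open>4^N is the cost of shifting coordinate by coordinate, 4 that of the factor in 2
    u g_i.\<close>
  define \<Lambda> where "\<Lambda> = 4 ^ CARD('n) * (4::real)"
  obtain M where M: "M \<ge> 0" and bound: "\<And>v :: real ^ 'n \<Rightarrow> real. \<lbrakk>v \<in> borel_measurable borel; \<And>x. 0 \<le> v x;
    (\<integral>\<^sup>+x. ennreal (v x) \<partial>lborel) \<le> 1; translation_bounded \<Lambda> v\<rbrakk> \<Longrightarrow> (\<integral>\<^sup>+x. ennreal (v x powr (p / 2)) \<partial>lborel) \<le> ennreal M"
    using subcritical_bound[OF N, of \<Lambda> "p / 2"] p by (auto simp: \<Lambda>_def)
  \<comment> \<open>\<open>M + 1\<close> instead of \<open>M\<close> makes the constant strictly
    positive, as later divisions demand.\<close>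
  have "integrable lebesgue (\<lambda>x. \<bar>u x\<bar> powr p) \<and> lp_power p u \<le> M + 1"
    if u: "u \<in> mass_sphere 1" and q: "quasilinear u \<le> 1" for u :: "real ^ 'n \<Rightarrow> real"
  proof -
    from u have mu: "u \<in> borel_measurable lebesgue" and iu: "integrable lebesgue (\<lambda>x. (u x)\<^sup>2)"
      and iq: "integrable lebesgue (\<lambda>x. \<bar>u x\<bar>\<^sup>2 * (norm (weak_gradient u x))\<^sup>2)"
      and m: "(\<integral>x. \<bar>u x\<bar>\<^sup>2 \<partial>lebesgue) = 1"
      by (auto simp: mass_sphere_def sobolev_H1_def)
    define G where "G = weak_gradient u"
    have wg: "has_weak_gradient u G" unfolding G_def
      using u has_weak_gradient_weak_gradient by (auto simp: mass_sphere_def sobolev_H1_def)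
    obtain u' g where bw: "borel_weak_gradient u' g" and AEu: "AE x in lborel. u x = u' x"
      and AEG: "AE x in lborel. \<forall>i. G x $ i = g i x"
      using has_weak_gradient_borel[OF wg] .
    from bw have [measurable]: "u' \<in> borel_measurable borel" "\<And>i. g i \<in> borel_measurable borel"
      by (auto simp: borel_weak_gradient_def)
    have li: "\<And>i a b. integrable lborel (\<lambda>x. indicator (cbox a b) x * g i x)"
      using bw by (auto simp: borel_weak_gradient_def)
    define v where "v x = (u' x)\<^sup>2" for x
    have v [measurable]: "v \<in> borel_measurable borel" unfolding v_def[abs_def] by measurable
    have v1: "(\<integral>\<^sup>+x. ennreal (v x) \<partial>lborel) \<le> 1"
    proof -
      have "(\<integral>\<^sup>+x. ennreal (v x) \<partial>lborel) = (\<integral>\<^sup>+x. ennreal ((u x)\<^sup>2) \<partial>lebesgue)"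
        by (rule nn_integral_lebesgue_eq_lborel, simp, use AEu in eventually_elim) (simp add: v_def)
      also have "\<dots> = 1" using nn_integral_eq_integral[OF iu] m by simp
      finally show ?thesis by simp
    qed
    have Q: "(\<integral>\<^sup>+x. ennreal ((2 * (u' x * g i x))\<^sup>2) \<partial>lborel) \<le> 4" for i
    proof -
      have "(\<integral>\<^sup>+x. ennreal ((2 * (u' x * g i x))\<^sup>2) \<partial>lborel) = (\<integral>\<^sup>+x. ennreal ((2 * (u x * G x $ i))\<^sup>2) \<partial>lebesgue)"
        by (rule nn_integral_lebesgue_eq_lborel, simp, use AEu AEG in eventually_elim) simp
      also have "\<dots> \<le> (\<integral>\<^sup>+x. ennreal (4 * (\<bar>u x\<bar>\<^sup>2 * (norm (G x))\<^sup>2)) \<partial>lebesgue)"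
      proof (intro nn_integral_mono ennreal_leI)
        fix x
        have "(G x $ i)\<^sup>2 \<le> (norm (G x))\<^sup>2" using component_le_norm_cart[of "G x" i] by (simp add: abs_le_square_iff[symmetric])
        then have "(u x)\<^sup>2 * (G x $ i)\<^sup>2 \<le> (u x)\<^sup>2 * (norm (G x))\<^sup>2" by (rule mult_left_mono) simp
        then show "(2 * (u x * G x $ i))\<^sup>2 \<le> 4 * (\<bar>u x\<bar>\<^sup>2 * (norm (G x))\<^sup>2)" by (simp add: power_mult_distrib)
      qed
      also have "\<dots> = ennreal (\<integral>x. 4 * (\<bar>u x\<bar>\<^sup>2 * (norm (G x))\<^sup>2) \<partial>lebesgue)"
        using iq by (intro nn_integral_eq_integral) (auto simp: G_def)
      also have "\<dots> = ennreal (4 * quasilinear u)" by (simp add: quasilinear_def G_def)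
      also have "\<dots> \<le> 4" using q by (metis ennreal_leI ennreal_numeral mult.right_neutral mult_left_mono zero_le_numeral)
      finally show ?thesis .
    qed
    have axis: "(\<integral>\<^sup>+x. ennreal ((v (x + h *\<^sub>R axis i 1) - v x)\<^sup>2) \<partial>lborel) \<le> ennreal (h\<^sup>2) * 4" if "0 \<le> h" for i h
    proof -
      have "(\<integral>\<^sup>+x. ennreal ((v (x + h *\<^sub>R axis i 1) - v x)\<^sup>2) \<partial>lborel) \<le>
        ennreal (h\<^sup>2) * (\<integral>\<^sup>+x. ennreal ((2 * (u' x * g i x))\<^sup>2) \<partial>lborel)"
      proof (rule translation_L2_bound[OF v _ _ that])
        show "AE x in lborel. v (x + h *\<^sub>R axis i 1) - v x =
          (\<integral>s. indicator {0..h} s * (2 * (u' (x + s *\<^sub>R axis i 1) * g i (x + s *\<^sub>R axis i 1))) \<partial>lborel)"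
          unfolding v_def
          by (rule line_identity_square) (use that line_identity[OF bw] AE_line_integrable[OF _ li] in auto)
      qed simp
      also have "\<dots> \<le> ennreal (h\<^sup>2) * 4" using Q by (rule mult_left_mono) simp
      finally show ?thesis .
    qed
    have tb: "translation_bounded \<Lambda> v"
      unfolding translation_bounded_def
    proof (intro allI ballI impI)
      fix r :: real and y :: "real ^ 'n" assume r: "r > 0" and y: "y \<in> cbox 0 (r *\<^sub>R One)"
      have "0 \<le> y $ i \<and> y $ i \<le> r" for i
      proof -
        have b: "axis i 1 \<in> (Basis :: (real ^ 'n) set)" by simp
        have "(r *\<^sub>R One :: real ^ 'n) \<bullet> axis i 1 = r"
          using b by (simp only: inner_scaleR_left inner_sum_left_Basis) simp
        then show ?thesis using y b unfolding mem_box by (fastforce simp: inner_axis)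
      qed
      then have "(\<integral>\<^sup>+x. ennreal ((v (x + y) - v x)\<^sup>2) \<partial>lborel) \<le> ennreal (4 ^ CARD('n) * r\<^sup>2) * 4"
        by (intro cube_translation_L2_bound v axis) auto
      also have "\<dots> = ennreal (\<Lambda> * r\<^sup>2)" by (simp add: \<Lambda>_def ennreal_mult' mult_ac)
      finally show "(\<integral>\<^sup>+x. ennreal ((v (x + y) - v x)\<^sup>2) \<partial>lborel) \<le> ennreal (\<Lambda> * r\<^sup>2)" .
    qed
    have "v x powr (p / 2) = \<bar>u' x\<bar> powr p" for x
    proof -
      have "v x = \<bar>u' x\<bar> powr 2" by (cases "u' x = 0") (simp_all add: v_def)
      then show ?thesis by (simp only: powr_powr) simp
    qed
    then have "(\<integral>\<^sup>+x. ennreal (\<bar>u' x\<bar> powr p) \<partial>lborel) \<le> ennreal M"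
      using bound[OF v _ v1 tb] by (simp add: v_def)
    also have "(\<integral>\<^sup>+x. ennreal (\<bar>u' x\<bar> powr p) \<partial>lborel) = (\<integral>\<^sup>+x. ennreal (\<bar>u x\<bar> powr p) \<partial>lebesgue)"
      by (rule nn_integral_lebesgue_eq_lborel, simp, use AEu in eventually_elim) simp
    finally have le: "(\<integral>\<^sup>+x. ennreal (\<bar>u x\<bar> powr p) \<partial>lebesgue) \<le> ennreal M" .
    have i: "integrable lebesgue (\<lambda>x. \<bar>u x\<bar> powr p)"
      by (rule integrableI_bounded) (use mu le in \<open>auto intro: le_less_trans\<close>)
    then have "lp_power p u \<le> M"
      using le M nn_integral_eq_integral[OF i] by (simp add: lp_power_def)
    with i show ?thesis by simp
  qed
  moreover have "M + 1 > 0" using M by simp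
  ultimately show ?thesis by blast
qed

text \<open>\<open>normalized_bound\<close> transported by the two-parameter scaling. The free bound
  \<open>B\<close> in place of the quasilinear integral admits a vanishing integral;
  \<open>quasilinear_pos\<close> then exploits arbitrarily small \<open>B\<close>.\<close>

lemma gagliardo_nirenberg:
  assumes N: "CARD('n::finite) \<ge> 3" and p: "2 \<le> p" "p < 2 * critical_exponent CARD('n)"
  defines "\<beta> \<equiv> real CARD('n) * (p - 2) / (2 * (real CARD('n) + 2))"
  shows "\<exists>M>0. \<forall>(u :: real ^ 'n \<Rightarrow> real) a B. a > 0 \<longrightarrow> u \<in> mass_sphere a \<longrightarrow> B > 0 \<longrightarrow> quasilinear u \<le> B \<longrightarrow>
    integrable lebesgue (\<lambda>x. \<bar>u x\<bar> powr p) \<and> lp_power p u \<le> M * a powr (p - 4 * \<beta>) * B powr \<beta>"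
proof -
  let ?N = "CARD('n)"
  obtain M where M: "M > 0" and bound: "\<And>u :: real ^ 'n \<Rightarrow> real. u \<in> mass_sphere 1 \<Longrightarrow> quasilinear u \<le> 1 \<Longrightarrow>
    integrable lebesgue (\<lambda>x. \<bar>u x\<bar> powr p) \<and> lp_power p u \<le> M"
    using normalized_bound[OF N p] by blast
  have "integrable lebesgue (\<lambda>x. \<bar>u x\<bar> powr p) \<and> lp_power p u \<le> M * a powr (p - 4 * \<beta>) * B powr \<beta>"
    if a: "a > 0" and u: "u \<in> mass_sphere a" and B: "B > 0" and q: "quasilinear u \<le> B" for u :: "real ^ 'n \<Rightarrow> real" and a B
  proof -
    \<comment> \<open>For s u(c x) to have mass 1 and quasilinear integral at most 1, one asks for
      s^2 a^2 = c^N and s^4 c^2 / c^N = 1 / B, hence c^(N+2) = a^4 / B.\<close>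
    define c where "c = (a powr 4 / B) powr (1 / (real ?N + 2))"
    define s where "s = c powr (real ?N / 2) / a"
    have c: "c > 0" using a B by (simp add: c_def)
    have s: "s > 0" using a c by (simp add: s_def)
    have cN: "c ^ ?N = c powr real ?N" using c by (simp add: powr_realpow)
    have s2: "s\<^sup>2 = c ^ ?N / a\<^sup>2"
    proof -
      have "(c powr (real ?N / 2))\<^sup>2 = c ^ ?N"
        unfolding cN power2_eq_square powr_add[symmetric] by simp
      then show ?thesis by (simp add: s_def power_divide)
    qed
    have mass: "1\<^sup>2 = s\<^sup>2 * a\<^sup>2 / c ^ ?N" using s2 a c by simp
    note sc = mass_sphere_scale[OF u c s mass]
    have c2: "c ^ ?N * c\<^sup>2 = a ^ 4 / B"
    proof -
      have "c ^ ?N * c\<^sup>2 = c powr (real ?N + 2)" using c by (simp add: powr_add cN)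
      also have "\<dots> = a powr 4 / B" using a B by (simp add: c_def powr_powr)
      finally show ?thesis using a by simp
    qed
    have "s ^ 4 * c\<^sup>2 / c ^ ?N = c ^ ?N * c\<^sup>2 / a ^ 4"
    proof -
      have "s ^ 4 = (s\<^sup>2)\<^sup>2" by simp
      also have "\<dots> = (c ^ ?N)\<^sup>2 / a ^ 4" unfolding s2 by (simp add: power_divide)
      finally show ?thesis using c by (simp add: power2_eq_square field_simps)
    qed
    also have "\<dots> = 1 / B" using a B by (simp add: c2)
    finally have qs: "quasilinear (\<lambda>x. s * u (c *\<^sub>R x)) \<le> 1" using sc(3) q B by simp
    have 1: "integrable lebesgue (\<lambda>x. \<bar>u x\<bar> powr p)" and 2: "s powr p / c ^ ?N * lp_power p u \<le> M"
      using bound[OF sc(1) qs] sc(4)[of p] sc(5)[of p] by auto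
    have "s powr p / c ^ ?N = c powr (real ?N * (p - 2) / 2) / a powr p"
    proof -
      have "s powr p = c powr (real ?N / 2 * p) / a powr p"
        using a c by (simp add: s_def powr_divide powr_powr)
      then have "s powr p / c ^ ?N = c powr (real ?N / 2 * p) / c powr real ?N / a powr p"
        unfolding cN by (simp only: divide_divide_eq_left mult.commute)
      moreover have "c powr (real ?N / 2 * p) / c powr real ?N = c powr (real ?N * (p - 2) / 2)"
        unfolding powr_diff[symmetric] by (rule arg_cong[where f="\<lambda>y. c powr y"]) (simp add: field_simps)
      ultimately show ?thesis by (simp only:)
    qed
    also have "c powr (real ?N * (p - 2) / 2) = (a powr 4 / B) powr \<beta>"
      unfolding c_def powr_powr \<beta>_def by (rule arg_cong[where f="\<lambda>y. _ powr y"]) (simp add: field_simps)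
    also have "\<dots> = a powr (4 * \<beta>) / B powr \<beta>" using a B by (simp only: powr_powr[symmetric] powr_divide less_imp_le powr_ge_zero)
    finally have "s powr p / c ^ ?N = a powr (4 * \<beta>) / B powr \<beta> / a powr p" .
    with 2 have "a powr (4 * \<beta>) / B powr \<beta> / a powr p * lp_power p u \<le> M" by simp
    then have "lp_power p u \<le> M * (a powr p / a powr (4 * \<beta>)) * B powr \<beta>"
      using a B by (simp add: field_simps)
    then show ?thesis using 1 by (simp add: powr_diff)
  qed
  with M show ?thesis by blast
qed

lemma lp_power_pos:
  assumes u: "u \<in> mass_sphere a" and a: "a > 0" and i: "integrable lebesgue (\<lambda>x. \<bar>u x\<bar> powr p)"
  shows "lp_power p u > 0"
proof (rule ccontr)
  assume "\<not> lp_power p u > 0"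
  moreover have "lp_power p u \<ge> 0" unfolding lp_power_def by (rule Bochner_Integration.integral_nonneg) simp
  ultimately have "lp_power p u = 0" by linarith
  then have "AE x in lebesgue. \<bar>u x\<bar> powr p = 0"
    using integral_nonneg_eq_0_iff_AE[OF i] by (simp add: lp_power_def)
  then have "AE x in lebesgue. \<bar>u x\<bar>\<^sup>2 = 0" by eventually_elim simp
  then have "(\<integral>x. \<bar>u x\<bar>\<^sup>2 \<partial>lebesgue) = 0" by (rule integral_eq_zero_AE)
  with u a show False by (simp add: mass_sphere_def)
qed

lemma dirichlet_nonneg: "dirichlet u \<ge> 0" and quasilinear_nonneg: "quasilinear u \<ge> 0"
  unfolding dirichlet_def quasilinear_def by (auto intro!: Bochner_Integration.integral_nonneg)

text \<open>Otherwise \<open>gagliardo_nirenberg\<close> holds with every B > 0, and since \<beta> >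
  0 a small \<open>B\<close> pushes the L^p integral below itself.\<close>

lemma quasilinear_pos:
  fixes u :: "real ^ 'n \<Rightarrow> real"
  assumes N: "CARD('n) \<ge> 3" and p: "2 < p" "p < 2 * critical_exponent CARD('n)"
    and u: "u \<in> mass_sphere a" and a: "a > 0"
  shows "quasilinear u > 0"
proof (rule ccontr)
  assume "\<not> quasilinear u > 0"
  then have q: "quasilinear u \<le> B" if "B > 0" for B using that by simp
  define \<beta> where "\<beta> = real CARD('n) * (p - 2) / (2 * (real CARD('n) + 2))"
  have \<beta>: "\<beta> > 0" using p N by (simp add: \<beta>_def)
  obtain M where M: "M > 0" and gn: "\<And>B. B > 0 \<Longrightarrow>
    integrable lebesgue (\<lambda>x. \<bar>u x\<bar> powr p) \<and> lp_power p u \<le> M * a powr (p - 4 * \<beta>) * B powr \<beta>"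
    using gagliardo_nirenberg[OF N, of p] p u a q unfolding \<beta>_def by fastforce
  have D: "lp_power p u > 0" using lp_power_pos[OF u a] gn[of 1] by simp
  define C where "C = M * a powr (p - 4 * \<beta>)"
  have C: "C > 0" using M a by (simp add: C_def)
  \<comment> \<open>Chosen so that C B^\<beta> is half of the L^p integral.\<close>
  define B where "B = (lp_power p u / (2 * C)) powr (1 / \<beta>)"
  have "B > 0" using D C by (simp add: B_def)
  with gn have "lp_power p u \<le> C * B powr \<beta>" unfolding C_def by blast
  also have "\<dots> = lp_power p u / 2" using D C \<beta> by (simp add: B_def powr_powr)
  finally show False using D by simp
qed

section \<open>Test functions lie in the constraint sets\<close>

lemma test_function_support:
  assumes \<phi>: "test_function \<phi>" and x: "x \<notin> closure {x. \<phi> x \<noteq> 0}"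
  shows "\<phi> x = 0" "frechet_derivative \<phi> (at x) v = 0"
proof -
  show "\<phi> x = 0" using x closure_subset[of "{x. \<phi> x \<noteq> 0}"] by blast
  have "(\<phi> has_derivative (\<lambda>v. 0)) (at x)"
  proof (rule has_derivative_transform_within_open[of "\<lambda>x. 0"])
    show "open (- closure {x. \<phi> x \<noteq> 0})" by (rule open_Compl) (rule closed_closure)
    show "0 = \<phi> y" if "y \<in> - closure {x. \<phi> x \<noteq> 0}" for y
      using that closure_subset[of "{x. \<phi> x \<noteq> 0}"] by auto
  qed (use x in auto)
  then show "frechet_derivative \<phi> (at x) v = 0" by (simp add: frechet_derivative_at[symmetric])
qed

lemma integrable_compact_support:
  fixes f :: "'a::euclidean_space \<Rightarrow> 'b::euclidean_space"
  assumes "continuous_on UNIV f" "compact K" "\<And>x. x \<notin> K \<Longrightarrow> f x = 0"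
  shows "integrable lborel f" "integrable lebesgue f"
proof -
  have "integrable lborel (\<lambda>x. indicator K x *\<^sub>R f x)"
    by (rule borel_integrable_compact[OF assms(2) continuous_on_subset[OF assms(1)]]) simp
  moreover have "(\<lambda>x. indicator K x *\<^sub>R f x) = f" using assms(3) by (auto simp: indicator_def)
  ultimately show i: "integrable lborel f" by simp
  then show "integrable lebesgue f"
    using integrable_completion[of f lborel] borel_measurable_integrable[OF i] by simp
qed

text \<open>By translation invariance the increment of \<open>\<phi>\<close> by \<open>e\<close> has
  integral 0; by the fundamental theorem of calculus and Fubini the same integral is that of the
  derivative.\<close>

lemma integral_derivative_test_function:
  assumes \<phi>: "test_function \<phi>"
  shows "(\<integral>x. frechet_derivative \<phi> (at x) e \<partial>lborel) = 0"
proof -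
  define D where "D x = frechet_derivative \<phi> (at x) e" for x
  have cD: "continuous_on UNIV D" unfolding D_def[abs_def] by (rule test_function_derivative(2)[OF \<phi>])
  then have [measurable]: "D \<in> borel_measurable borel" by (rule borel_measurable_continuous_onI)
  note [measurable] = test_function_borel[OF \<phi>]
  have K: "compact (closure {x. \<phi> x \<noteq> 0})" using \<phi> by (simp add: test_function_def)
  have iD: "integrable lborel D"
    by (rule integrable_compact_support(1)[OF cD K]) (simp add: D_def test_function_support(2)[OF \<phi>])
  have i\<phi>: "integrable lborel \<phi>"
    by (rule integrable_compact_support(1)[OF test_function_continuous[OF \<phi>] K]) (rule test_function_support(1)[OF \<phi>])
  have line: "\<phi> (x + e) - \<phi> x = (\<integral>s. indicator {0..1} s * D (x + s *\<^sub>R e) \<partial>lborel)" for x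
  proof -
    have "(\<integral>s. D (x + s *\<^sub>R e) * indicator {0..1} s \<partial>lborel) = \<phi> (x + 1 *\<^sub>R e) - \<phi> (x + 0 *\<^sub>R e)"
    proof (rule integral_FTC_Icc_real)
      fix s :: real
      have "((\<lambda>s. \<phi> (x + s *\<^sub>R e)) has_derivative (\<lambda>v. frechet_derivative \<phi> (at (x + s *\<^sub>R e)) (v *\<^sub>R e))) (at s)"
        by (rule has_derivative_compose[where f="\<lambda>s. x + s *\<^sub>R e" and g=\<phi>])
          (auto intro!: derivative_eq_intros test_function_derivative(1)[OF \<phi>])
      moreover have "frechet_derivative \<phi> (at (x + s *\<^sub>R e)) (v *\<^sub>R e) = D (x + s *\<^sub>R e) * v" for v
        using has_derivative_linear[OF test_function_derivative(1)[OF \<phi>]] by (simp add: D_def linear_cmul)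
      ultimately show "((\<lambda>s. \<phi> (x + s *\<^sub>R e)) has_real_derivative D (x + s *\<^sub>R e)) (at s)"
        by (simp add: has_field_derivative_def)
      have "isCont D y" for y using cD by (simp add: continuous_on_eq_continuous_at)
      then show "isCont (\<lambda>s. D (x + s *\<^sub>R e)) s"
        by (rule isCont_o2[where g=D and f="\<lambda>s. x + s *\<^sub>R e", rotated]) (intro continuous_intros)
    qed simp
    then show ?thesis by (simp add: mult.commute)
  qed
  have "(\<integral>x. \<phi> (x + e) - \<phi> x \<partial>lborel) = 0"
    using integrable_translate[OF _ i\<phi>, of e] i\<phi> integral_translate[of \<phi> e] by simp
  then have "0 = (\<integral>x. (\<integral>s. indicator {0..1} s * D (x + s *\<^sub>R e) \<partial>lborel) \<partial>lborel)" by (simp add: line)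
  also have "\<dots> = (\<integral>s. (\<integral>x. indicator {0..1} s * D (x + s *\<^sub>R e) \<partial>lborel) \<partial>lborel)"
  proof (rule lborel_pair.Fubini_integral)
    show "integrable (lborel \<Otimes>\<^sub>M lborel) (\<lambda>(s, x). indicator {0..1} s * D (x + s *\<^sub>R e))"
    proof (rule integrable_pair_bounded)
      show "(\<integral>\<^sup>+x. ennreal \<bar>D x\<bar> \<partial>lborel) < \<infinity>" using iD by (simp add: integrable_iff_bounded)
      fix s :: real
      show "(\<integral>\<^sup>+x. ennreal \<bar>indicator {0..1} s * D (x + s *\<^sub>R e)\<bar> \<partial>lborel) \<le> (\<integral>\<^sup>+x. ennreal \<bar>D x\<bar> \<partial>lborel) * indicator {0..1} s"
        using nn_integral_translate[of "\<lambda>x. ennreal \<bar>D x\<bar>" "s *\<^sub>R e"] by (cases "s \<in> {0..1}") auto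
    qed simp
  qed
  also have "\<dots> = (\<integral>s. indicator {0..1::real} s * (\<integral>x. D x \<partial>lborel) \<partial>lborel)"
    using integral_translate[of D] by (simp add: content_real)
  also have "\<dots> = (\<integral>x. D x \<partial>lborel)" by (simp add: content_real)
  finally show ?thesis by (simp add: D_def)
qed

lemma test_function_mult:
  assumes "test_function \<phi>" "test_function \<psi>"
  shows "test_function (\<lambda>x. \<phi> x * \<psi> x)"
proof -
  have "bounded {x. \<phi> x \<noteq> 0}" using assms(1) by (simp add: test_function_def)
  then have "bounded {x. \<phi> x * \<psi> x \<noteq> 0}" by (rule bounded_subset) auto
  then show ?thesis using assms by (auto simp: test_function_def intro: C_k_mult)
qed

definition gradient :: "(real ^ 'n \<Rightarrow> real) \<Rightarrow> real ^ 'n \<Rightarrow> real ^ 'n" where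
  "gradient \<phi> x = (\<chi> i. frechet_derivative \<phi> (at x) (axis i 1))"

lemma gradient_test_function:
  assumes \<phi>: "test_function \<phi>"
  shows "continuous_on UNIV (gradient \<phi>)" "x \<notin> closure {x. \<phi> x \<noteq> 0} \<Longrightarrow> gradient \<phi> x = 0"
proof -
  show "continuous_on UNIV (gradient \<phi>)"
    unfolding gradient_def[abs_def] by (intro continuous_on_vec_lambda test_function_derivative(2)[OF \<phi>])
  show "x \<notin> closure {x. \<phi> x \<noteq> 0} \<Longrightarrow> gradient \<phi> x = 0"
    by (simp add: gradient_def test_function_support(2)[OF \<phi>] vec_eq_iff)
qed

lemma continuous_locally_integrable:
  assumes "continuous_on UNIV f"
  shows "locally_integrable f"
  unfolding locally_integrable_def
proof (intro conjI allI impI)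
  have "f \<in> borel_measurable lborel" using borel_measurable_continuous_onI[OF assms] by simp
  then show "f \<in> borel_measurable lebesgue" by (rule measurable_completion)
  fix K :: "(real ^ 'a) set" assume "compact K"
  then have i: "integrable lborel (\<lambda>x. indicator K x *\<^sub>R f x)"
    using continuous_on_subset[OF assms, of K] by (intro borel_integrable_compact) auto
  then show "set_integrable lebesgue K f"
    unfolding set_integrable_def using integrable_completion[OF borel_measurable_integrable[OF i]] by simp
qed

text \<open>Integration by parts: the product of two test functions is a test function, so its
  derivative has integral 0, and the product rule splits it.\<close>

lemma has_weak_gradient_test_function:
  assumes \<phi>: "test_function \<phi>"
  shows "has_weak_gradient \<phi> (gradient \<phi>)"
  unfolding has_weak_gradient_def
proof (intro conjI allI impI)
  show "locally_integrable \<phi>" "locally_integrable (gradient \<phi>)"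
    by (intro continuous_locally_integrable test_function_continuous[OF \<phi>] gradient_test_function[OF \<phi>])+
  fix \<psi> :: "real ^ 'a \<Rightarrow> real" and i
  assume \<psi>: "test_function \<psi>"
  let ?e = "axis i 1 :: real ^ 'a"
  have K: "compact (closure {x. \<phi> x \<noteq> 0})" using \<phi> by (simp add: test_function_def)
  have d: "frechet_derivative (\<lambda>x. \<phi> x * \<psi> x) (at x) ?e = \<phi> x * frechet_derivative \<psi> (at x) ?e + frechet_derivative \<phi> (at x) ?e * \<psi> x" for x
  proof -
    have "((\<lambda>x. \<phi> x * \<psi> x) has_derivative (\<lambda>v. \<phi> x * frechet_derivative \<psi> (at x) v + frechet_derivative \<phi> (at x) v * \<psi> x)) (at x)"
      by (rule has_derivative_mult[OF test_function_derivative(1)[OF \<phi>] test_function_derivative(1)[OF \<psi>]])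
    then show ?thesis by (simp add: frechet_derivative_at[symmetric])
  qed
  have c: "continuous_on UNIV (\<lambda>x. \<phi> x * frechet_derivative \<psi> (at x) ?e)" "continuous_on UNIV (\<lambda>x. frechet_derivative \<phi> (at x) ?e * \<psi> x)"
    by (intro continuous_intros test_function_continuous test_function_derivative(2) \<phi> \<psi>)+
  have i: "integrable lborel (\<lambda>x. \<phi> x * frechet_derivative \<psi> (at x) ?e)" "integrable lborel (\<lambda>x. frechet_derivative \<phi> (at x) ?e * \<psi> x)"
  proof -
    have "\<phi> x * frechet_derivative \<psi> (at x) ?e = 0" "frechet_derivative \<phi> (at x) ?e * \<psi> x = 0"
      if "x \<notin> closure {x. \<phi> x \<noteq> 0}" for x
      unfolding test_function_support[OF \<phi> that] by simp_all
    then show "integrable lborel (\<lambda>x. \<phi> x * frechet_derivative \<psi> (at x) ?e)" "integrable lborel (\<lambda>x. frechet_derivative \<phi> (at x) ?e * \<psi> x)"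
      using integrable_compact_support(1)[OF c(1) K] integrable_compact_support(1)[OF c(2) K] by blast+
  qed
  have "0 = (\<integral>x. \<phi> x * frechet_derivative \<psi> (at x) ?e + frechet_derivative \<phi> (at x) ?e * \<psi> x \<partial>lborel)"
    using integral_derivative_test_function[OF test_function_mult[OF \<phi> \<psi>], of ?e] by (simp add: d)
  then have "(\<integral>x. \<phi> x * frechet_derivative \<psi> (at x) ?e \<partial>lborel) = - (\<integral>x. frechet_derivative \<phi> (at x) ?e * \<psi> x \<partial>lborel)"
    using i by simp
  moreover have "(\<lambda>x. gradient \<phi> x $ i * \<psi> x) = (\<lambda>x. frechet_derivative \<phi> (at x) ?e * \<psi> x)"
    by (simp add: gradient_def)
  ultimately show "(\<integral>x. \<phi> x * frechet_derivative \<psi> (at x) ?e \<partial>lebesgue) = - (\<integral>x. gradient \<phi> x $ i * \<psi> x \<partial>lebesgue)"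
    using integral_completion[OF borel_measurable_integrable[OF i(1)]] integral_completion[OF borel_measurable_integrable[OF i(2)]] by simp
qed

lemma test_function_mass_sphere:
  assumes \<phi>: "test_function \<phi>" and a: "a\<^sup>2 = (\<integral>x. \<bar>\<phi> x\<bar>\<^sup>2 \<partial>lebesgue)"
  shows "\<phi> \<in> mass_sphere a"
proof -
  have K: "compact (closure {x. \<phi> x \<noteq> 0})" using \<phi> by (simp add: test_function_def)
  note wg = has_weak_gradient_test_function[OF \<phi>]
  have m: "\<phi> \<in> borel_measurable lebesgue" using wg by (auto simp: has_weak_gradient_def locally_integrable_def)
  note c = test_function_continuous[OF \<phi>] gradient_test_function(1)[OF \<phi>]
  have "integrable lebesgue (\<lambda>x. (\<phi> x)\<^sup>2)"
  proof (rule integrable_compact_support(2)[OF _ K])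
    show "(\<phi> x)\<^sup>2 = 0" if "x \<notin> closure {x. \<phi> x \<noteq> 0}" for x using test_function_support(1)[OF \<phi> that] by simp
  qed (intro continuous_intros c)
  moreover have "integrable lebesgue (\<lambda>x. (norm (weak_gradient \<phi> x))\<^sup>2)"
    unfolding weak_gradient_integrals(2)[OF wg m]
  proof (rule integrable_compact_support(2)[OF _ K])
    show "(norm (gradient \<phi> x))\<^sup>2 = 0" if "x \<notin> closure {x. \<phi> x \<noteq> 0}" for x
      using gradient_test_function(2)[OF \<phi> that] by simp
  qed (intro continuous_intros c)
  moreover have "integrable lebesgue (\<lambda>x. \<bar>\<phi> x\<bar>\<^sup>2 * (norm (weak_gradient \<phi> x))\<^sup>2)"
    unfolding weak_gradient_integrals(4)[OF wg m]
  proof (rule integrable_compact_support(2)[OF _ K])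
    show "\<bar>\<phi> x\<bar>\<^sup>2 * (norm (gradient \<phi> x))\<^sup>2 = 0" if "x \<notin> closure {x. \<phi> x \<noteq> 0}" for x
      using test_function_support(1)[OF \<phi> that] by simp
  qed (intro continuous_intros c)
  ultimately show ?thesis using m wg a by (auto simp: mass_sphere_def sobolev_H1_def)
qed

text \<open>A box bump is positive on the open unit box, so a multiple of it has the right mass.
  With \<open>pohozaev_dilation\<close> this keeps the infimum from being taken over an empty
  set.\<close>

lemma mass_sphere_nonempty:
  assumes a: "a > 0"
  shows "(mass_sphere a :: (real ^ 'n \<Rightarrow> real) set) \<noteq> {}"
proof -
  define \<phi> :: "real ^ 'n \<Rightarrow> real" where "\<phi> = box_bump 0 0 One"
  have \<phi>: "test_function \<phi>" unfolding \<phi>_def by (rule test_function_box_bump)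
  define a0 where "a0 = sqrt (\<integral>x. \<bar>\<phi> x\<bar>\<^sup>2 \<partial>lebesgue)"
  have a02: "a0\<^sup>2 = (\<integral>x. \<bar>\<phi> x\<bar>\<^sup>2 \<partial>lebesgue)" by (simp add: a0_def)
  then have u: "\<phi> \<in> mass_sphere a0" by (rule test_function_mass_sphere[OF \<phi>])
  then have i: "integrable lebesgue (\<lambda>x. \<bar>\<phi> x\<bar>\<^sup>2)" by (simp add: mass_sphere_def sobolev_H1_def)
  have "a0 \<noteq> 0"
  proof
    assume "a0 = 0"
    then have "(\<integral>x. \<bar>\<phi> x\<bar>\<^sup>2 \<partial>lebesgue) = 0" using a02 by simp
    then have "AE x in lebesgue. \<bar>\<phi> x\<bar>\<^sup>2 = 0" using integral_nonneg_eq_0_iff_AE[OF i] by simp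
    then have "AE x in lborel. \<bar>\<phi> x\<bar>\<^sup>2 = 0" by (simp add: AE_completion_iff)
    then have "AE x in lborel. x \<notin> box 0 (One :: real ^ 'n)"
    proof eventually_elim
      case (elim x)
      then show ?case using box_bump_pos[of x 0 One 0] by (auto simp: \<phi>_def)
    qed
    then have "emeasure lborel (box 0 (One :: real ^ 'n)) = 0" by (subst (asm) AE_iff_measurable[of "box 0 One"]) auto
    moreover have "emeasure lborel (box 0 (One :: real ^ 'n)) = 1" by (subst emeasure_lborel_box) (auto simp: inner_Basis)
    ultimately show False by simp
  qed
  then have a0: "a0 > 0" by (simp add: a0_def order_less_le)
  have "(\<lambda>x. (a / a0) * \<phi> (1 *\<^sub>R x)) \<in> mass_sphere a"
    by (rule mass_sphere_scale(1)[OF u]) (use a a0 in \<open>auto simp: power_divide\<close>)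
  then show ?thesis by blast
qed

section \<open>Rescaling between the constraint sets\<close>

lemma energy_eq: "energy p u = 1 / 2 * dirichlet u + quasilinear u - 1 / p * lp_power p u"
  by (simp add: energy_def dirichlet_def quasilinear_def lp_power_def)

lemma pohozaev_eq:
  "pohozaev p (u :: real ^ 'n \<Rightarrow> real) =
     dirichlet u + (real CARD('n) + 2) * quasilinear u - gamma_exp CARD('n) p * lp_power p u"
  by (simp add: pohozaev_def dirichlet_def quasilinear_def lp_power_def)

text \<open>N(p-2)/2, called \<open>r\<close> below, is the exponent by which a mass-preserving
  dilation scales the L^p integral; p > 4 + 4/N says that it exceeds the exponent N + 2 of the
  quasilinear integral.\<close>

lemma exponent_bounds:
  assumes N: "N \<ge> 3" and p: "4 + 4 / real N < p"
  shows "p > 4" "real N * (p - 2) / 2 > real N + 2" "gamma_exp N p > 0" "gamma_exp N p * p = real N * (p - 2) / 2"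
proof -
  show p4: "p > 4" using p N by (smt (verit) divide_nonneg_nonneg of_nat_0_le_iff)
  have "(4 + 4 / real N) * real N < p * real N" using p N by (intro mult_strict_right_mono) auto
  moreover have "(4 + 4 / real N) * real N = 4 * real N + 4" using N by (simp add: algebra_simps)
  ultimately show "real N * (p - 2) / 2 > real N + 2" by (simp add: algebra_simps)
  show "gamma_exp N p > 0" "gamma_exp N p * p = real N * (p - 2) / 2" using p4 N by (simp_all add: gamma_exp_def)
qed

text \<open>The constraint eliminates the L^p integral. Since r > N + 2, both remaining coefficients
  are positive, so the energy is coercive on the constraint set.\<close>

lemma energy_pohozaev:
  fixes u :: "real ^ 'n \<Rightarrow> real"
  assumes N: "CARD('n) \<ge> 3" and p: "4 + 4 / real CARD('n) < p" and P: "pohozaev p u = 0"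
  defines "r \<equiv> real CARD('n) * (p - 2) / 2"
  shows "energy p u = (1 / 2 - 1 / r) * dirichlet u + (1 - (real CARD('n) + 2) / r) * quasilinear u"
proof -
  note eb = exponent_bounds[OF N p]
  have r: "gamma_exp CARD('n) p * p = r" "r > 0" using eb by (auto simp: r_def)
  have "gamma_exp CARD('n) p * lp_power p u = dirichlet u + (real CARD('n) + 2) * quasilinear u"
    using P by (simp add: pohozaev_eq)
  then have "1 / p * lp_power p u = (dirichlet u + (real CARD('n) + 2) * quasilinear u) / r"
    using eb r by (simp add: field_simps flip: r(1))
  then show ?thesis unfolding energy_eq by (simp add: algebra_simps add_divide_distrib)
qed

text \<open>Along t^(N/2) u(t x) the mass is constant and the Pohozaev functional is t^(N+2) F(t).
  As r > N + 2, the L^p term prevails for large t, and the intermediate value theorem yields a zero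
  of F.\<close>

lemma pohozaev_dilation:
  fixes u :: "real ^ 'n \<Rightarrow> real"
  assumes N: "CARD('n) \<ge> 3" and p: "4 + 4 / real CARD('n) < p" "p < 2 * critical_exponent CARD('n)"
    and u: "u \<in> mass_sphere a" and a: "a > 0"
  obtains t and v :: "real ^ 'n \<Rightarrow> real" where "t > 0" "v \<in> pohozaev_set p a" "dirichlet v = t\<^sup>2 * dirichlet u"
    "quasilinear v = t ^ (CARD('n) + 2) * quasilinear u"
    "lp_power p v = t powr (real CARD('n) * (p - 2) / 2) * lp_power p u"
proof -
  let ?N = "CARD('n)"
  note eb = exponent_bounds[OF N p(1)]
  define r where "r = real ?N * (p - 2) / 2"
  have r: "r > real ?N + 2" using eb by (simp add: r_def)
  define \<gamma> where "\<gamma> = gamma_exp ?N p"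
  have \<gamma>: "\<gamma> > 0" using eb by (simp add: \<gamma>_def)
  have dil: "\<exists>v\<in>(mass_sphere a :: (real ^ 'n \<Rightarrow> real) set). dirichlet v = t\<^sup>2 * dirichlet u \<and> quasilinear v = t ^ (?N + 2) * quasilinear u \<and>
    lp_power p v = t powr r * lp_power p u" if t: "t > 0" for t
  proof -
    define s where "s = t powr (real ?N / 2)"
    have s: "s > 0" using t by (simp add: s_def)
    have tN: "t ^ ?N = t powr real ?N" using t by (simp add: powr_realpow)
    have s2: "s\<^sup>2 = t ^ ?N" unfolding tN s_def power2_eq_square powr_add[symmetric] by simp
    have s4: "s ^ 4 = t ^ ?N * t ^ ?N"
    proof -
      have "s ^ 4 = s\<^sup>2 * s\<^sup>2" by simp
      then show ?thesis by (simp only: s2)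
    qed
    have mass: "a\<^sup>2 = s\<^sup>2 * a\<^sup>2 / t ^ ?N" using t by (simp add: s2)
    note sc = mass_sphere_scale[OF u t s mass]
    have "s powr p / t ^ ?N = t powr r"
      unfolding tN s_def powr_powr powr_diff[symmetric] r_def by (rule arg_cong[where f="\<lambda>y. t powr y"]) (simp add: field_simps)
    then have "lp_power p (\<lambda>x. s * u (t *\<^sub>R x)) = t powr r * lp_power p u" by (simp only: sc(4))
    moreover have "s\<^sup>2 * t\<^sup>2 / t ^ ?N = t\<^sup>2" "s ^ 4 * t\<^sup>2 / t ^ ?N = t ^ (?N + 2)"
      unfolding s2 s4 using t by (simp_all add: power_add power2_eq_square)
    ultimately have "dirichlet (\<lambda>x. s * u (t *\<^sub>R x)) = t\<^sup>2 * dirichlet u \<and>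
      quasilinear (\<lambda>x. s * u (t *\<^sub>R x)) = t ^ (?N + 2) * quasilinear u \<and>
      lp_power p (\<lambda>x. s * u (t *\<^sub>R x)) = t powr r * lp_power p u"
      unfolding sc(2,3) by simp
    from bexI[where P="\<lambda>v. dirichlet v = t\<^sup>2 * dirichlet u \<and> quasilinear v = t ^ (?N + 2) * quasilinear u \<and> lp_power p v = t powr r * lp_power p u", OF this sc(1)]
    show ?thesis .
  qed
  have B: "quasilinear u > 0" using quasilinear_pos[OF N _ p(2) u a] eb by simp
  have A: "dirichlet u \<ge> 0" by (rule dirichlet_nonneg)
  have "integrable lebesgue (\<lambda>x. \<bar>u x\<bar> powr p)"
    using gagliardo_nirenberg[OF N, of p] eb(1) p(2) a u B by fastforce
  then have D: "lp_power p u > 0" by (rule lp_power_pos[OF u a])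
  \<comment> \<open>Division by t^(N+2) makes the quasilinear term constant, so that it can be
    balanced explicitly against the L^p term.\<close>
  define F where "F t = dirichlet u * t powr (- real ?N) + (real ?N + 2) * quasilinear u - \<gamma> * lp_power p u * t powr (r - (real ?N + 2))" for t
  define \<delta> where "\<delta> = r - (real ?N + 2)"
  have \<delta>: "\<delta> > 0" using r by (simp add: \<delta>_def)
  \<comment> \<open>At \<open>t0\<close> the last two terms cancel and F is nonnegative. At
    \<open>t1\<close> the L^p term outweighs both others, where t1 \<ge> 1 bounds t1^(-N) by
    1.\<close>
  define t0 where "t0 = ((real ?N + 2) * quasilinear u / (\<gamma> * lp_power p u)) powr (1 / \<delta>)"
  define t1 where "t1 = max 1 (((dirichlet u + (real ?N + 2) * quasilinear u) / (\<gamma> * lp_power p u)) powr (1 / \<delta>))"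
  have t0: "t0 > 0" using B D \<gamma> by (simp add: t0_def)
  have t01: "t0 \<le> t1" unfolding t0_def t1_def
    using A B D \<gamma> \<delta> by (intro max.coboundedI2 powr_mono2) (auto intro!: divide_right_mono)
  have "t0 powr \<delta> = (real ?N + 2) * quasilinear u / (\<gamma> * lp_power p u)"
    unfolding t0_def powr_powr using \<delta> B D \<gamma> by simp
  then have "F t0 = dirichlet u * t0 powr (- real ?N)"
    using D \<gamma> by (simp add: F_def \<delta>_def)
  then have F0: "F t0 \<ge> 0" using A by simp
  have F1: "F t1 \<le> 0"
  proof -
    have "(((dirichlet u + (real ?N + 2) * quasilinear u) / (\<gamma> * lp_power p u)) powr (1 / \<delta>)) powr \<delta> \<le> t1 powr \<delta>"
      unfolding t1_def using \<delta> by (intro powr_mono2) auto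
    then have "(dirichlet u + (real ?N + 2) * quasilinear u) / (\<gamma> * lp_power p u) \<le> t1 powr \<delta>"
      unfolding powr_powr using \<delta> A B D \<gamma> by simp
    then have "dirichlet u + (real ?N + 2) * quasilinear u \<le> \<gamma> * lp_power p u * t1 powr \<delta>"
      using D \<gamma> by (simp add: field_simps)
    moreover have "dirichlet u * t1 powr (- real ?N) \<le> dirichlet u * 1"
    proof (rule mult_left_mono)
      have "t1 \<ge> 1" by (simp add: t1_def)
      then show "t1 powr (- real ?N) \<le> 1" using powr_mono[of "- real ?N" 0 t1] by simp
    qed (rule A)
    ultimately show ?thesis by (simp add: F_def \<delta>_def)
  qed
  have "continuous_on {t0..t1} F" unfolding F_def[abs_def] using t0 by (intro continuous_intros) auto
  then obtain t where t: "t0 \<le> t" "F t = 0" using IVT2'[of F t1 0 t0] F0 F1 t01 by auto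
  have t_pos: "t > 0" using t t0 by simp
  obtain v :: "real ^ 'n \<Rightarrow> real" where v: "v \<in> mass_sphere a" "dirichlet v = t\<^sup>2 * dirichlet u" "quasilinear v = t ^ (?N + 2) * quasilinear u"
    "lp_power p v = t powr r * lp_power p u" using dil[OF t_pos] by blast
  have tp: "t ^ (?N + 2) * t powr (- real ?N) = t\<^sup>2" "t ^ (?N + 2) * t powr (r - (real ?N + 2)) = t powr r"
  proof -
    have tN: "t ^ (?N + 2) = t powr (real ?N + 2)" using t_pos powr_realpow[of t "?N + 2"] by (simp add: algebra_simps)
    have t2: "t\<^sup>2 = t powr 2" using t_pos by simp
    show "t ^ (?N + 2) * t powr (- real ?N) = t\<^sup>2" unfolding tN t2 powr_add[symmetric] by (rule arg_cong[where f="\<lambda>y. t powr y"]) simp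
    show "t ^ (?N + 2) * t powr (r - (real ?N + 2)) = t powr r" unfolding tN powr_add[symmetric] by (rule arg_cong[where f="\<lambda>y. t powr y"]) simp
  qed
  have "pohozaev p v = t ^ (?N + 2) * F t"
  proof -
    have "t ^ (?N + 2) * F t = dirichlet u * (t ^ (?N + 2) * t powr (- real ?N)) + (real ?N + 2) * (t ^ (?N + 2) * quasilinear u)
      - \<gamma> * lp_power p u * (t ^ (?N + 2) * t powr (r - (real ?N + 2)))"
    proof -
      have "x * (A * y + n * b - g * z) = A * (x * y) + n * (x * b) - g * (x * z)" for x A y n b g z :: real
        by (simp add: algebra_simps)
      then show ?thesis unfolding F_def .
    qed
    also have "\<dots> = pohozaev p v" unfolding tp pohozaev_eq v \<gamma>_def by simp
    finally show ?thesis by simp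
  qed
  then have "v \<in> pohozaev_set p a" using v t by (simp add: pohozaev_set_def)
  then show thesis using that t_pos v unfolding r_def by blast
qed

lemma powr_balance_le:
  fixes s t :: real
  assumes "s > 0" "t > 0" "k < q" "s powr p * t powr q \<le> s powr j * t powr k"
  shows "t \<le> s powr (- ((p - j) / (q - k)))"
proof -
  have "t powr (q - k) \<le> s powr (j - p)"
    using assms by (simp add: powr_diff field_simps)
  then have "(t powr (q - k)) powr (1 / (q - k)) \<le> (s powr (j - p)) powr (1 / (q - k))"
    using assms by (intro powr_mono2) auto
  also have "(t powr (q - k)) powr (1 / (q - k)) = t" using assms by (simp add: powr_powr)
  also have "(s powr (j - p)) powr (1 / (q - k)) = s powr (- ((p - j) / (q - k)))"
    unfolding powr_powr by (rule arg_cong[where f="\<lambda>y. s powr y"]) (simp add: minus_divide_left)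
  finally show ?thesis .
qed

text \<open>With r = N(p-2)/2, the entries are the largest t allowed by s^p t^r \<le> s^2 t^2 and by
  s^p t^r \<le> s^4 t^(N+2).\<close>

definition dilation_bound :: "nat \<Rightarrow> real \<Rightarrow> real \<Rightarrow> real" where
  "dilation_bound N p s = max (s powr (- ((p - 2) / (real N * (p - 2) / 2 - 2))))
     (s powr (- ((p - 4) / (real N * (p - 2) / 2 - (real N + 2)))))"

text \<open>The factor \<kappa>(s) of the overview: the larger of the growth factors of the
  Dirichlet and quasilinear integrals under amplitude s and the largest admissible dilation.\<close>

definition rescaling_factor :: "nat \<Rightarrow> real \<Rightarrow> real \<Rightarrow> real" where
  "rescaling_factor N p s = max (s\<^sup>2 * (dilation_bound N p s)\<^sup>2) (s ^ 4 * (dilation_bound N p s) ^ (N + 2))"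

lemma rescaling_factor_pos: "s > 0 \<Longrightarrow> rescaling_factor N p s > 0"
  by (auto simp: rescaling_factor_def dilation_bound_def less_max_iff_disj)

text \<open>Multiply by $a/b$ to correct the mass, then dilate back to the Pohozaev constraint. The
  Pohozaev identity for \<open>u\<close> bounds the dilation parameter in terms of $a/b$ alone.\<close>

lemma pohozaev_set_rescale:
  fixes u :: "real ^ 'n \<Rightarrow> real"
  assumes N: "CARD('n) \<ge> 3" and p: "4 + 4 / real CARD('n) < p" "p < 2 * critical_exponent CARD('n)"
    and u: "u \<in> pohozaev_set p b" and a: "a > 0" and b: "b > 0"
  shows "\<exists>v\<in>(pohozaev_set p a :: (real ^ 'n \<Rightarrow> real) set). energy p v \<le> rescaling_factor CARD('n) p (a / b) * energy p u"
proof -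
  let ?N = "CARD('n)"
  note eb = exponent_bounds[OF N p(1)]
  define r where "r = real ?N * (p - 2) / 2"
  have r: "r > real ?N + 2" using eb by (simp add: r_def)
  define s where "s = a / b"
  have s: "s > 0" using a b by (simp add: s_def)
  have um: "u \<in> mass_sphere b" and uP: "pohozaev p u = 0" using u by (auto simp: pohozaev_set_def)
  have mass: "a\<^sup>2 = s\<^sup>2 * b\<^sup>2 / 1 ^ ?N" using b by (simp add: s_def power_divide)
  define w where "w = (\<lambda>x. s * u (1 *\<^sub>R x))"
  have w: "w \<in> mass_sphere a" "dirichlet w = s\<^sup>2 * dirichlet u" "quasilinear w = s ^ 4 * quasilinear u"
    "lp_power p w = s powr p * lp_power p u"
    using mass_sphere_scale[OF um zero_less_one s mass] unfolding w_def by simp_all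
  obtain t and v :: "real ^ 'n \<Rightarrow> real" where t: "t > 0" and vP: "v \<in> pohozaev_set p a"
    and v: "dirichlet v = t\<^sup>2 * dirichlet w" "quasilinear v = t ^ (?N + 2) * quasilinear w"
      "lp_power p v = t powr r * lp_power p w"
    using pohozaev_dilation[OF N p w(1) a] unfolding r_def by blast
  define A where "A = dirichlet u"
  define B where "B = quasilinear u"
  have A: "A \<ge> 0" unfolding A_def by (rule dirichlet_nonneg)
  have B: "B > 0" unfolding B_def using quasilinear_pos[OF N _ p(2) um b] eb by simp
  define m where "m = max (s\<^sup>2 * t\<^sup>2) (s ^ 4 * t ^ (?N + 2))"
  have vA: "dirichlet v = (s\<^sup>2 * t\<^sup>2) * A" and vB: "quasilinear v = (s ^ 4 * t ^ (?N + 2)) * B"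
    using v w by (simp_all add: A_def B_def)
  have vAm: "dirichlet v \<le> m * A" unfolding vA m_def using A by (intro mult_right_mono) auto
  have vBm: "quasilinear v \<le> m * B" unfolding vB m_def using B by (intro mult_right_mono) auto
  have E: "A + (real ?N + 2) * B > 0" using A B by (intro add_nonneg_pos) auto
  have gD: "gamma_exp ?N p * lp_power p u = A + (real ?N + 2) * B"
    using uP by (simp add: pohozaev_eq A_def B_def)
  \<comment> \<open>The Pohozaev identities of \<open>u\<close> and \<open>v\<close> evaluate the
    same L^p integral. Both sides carry the factor A + (N+2) B; cancelling it leaves a relation
    between s and t free of \<open>u\<close>, and the maximum in \<open>m\<close> splits it into the
    two branches of \<open>dilation_bound\<close>.\<close>
  have "s powr p * t powr r * (A + (real ?N + 2) * B) = gamma_exp ?N p * lp_power p v"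
    unfolding gD[symmetric] v w by simp
  also have "\<dots> = dirichlet v + (real ?N + 2) * quasilinear v"
    using vP by (simp add: pohozaev_set_def pohozaev_eq)
  also have "\<dots> \<le> m * A + (real ?N + 2) * (m * B)" using vAm vBm by (intro add_mono mult_left_mono) auto
  also have "\<dots> = m * (A + (real ?N + 2) * B)" by (simp add: algebra_simps)
  finally have "s powr p * t powr r \<le> m" using E by (simp add: mult_le_cancel_right)
  then have "s powr p * t powr r \<le> s powr 2 * t powr 2 \<or> s powr p * t powr r \<le> s powr 4 * t powr (real ?N + 2)"
    using s t powr_realpow[of t "?N + 2"] by (auto simp: m_def le_max_iff_disj algebra_simps)
  then have "t \<le> dilation_bound ?N p s"
    using powr_balance_le[OF s t, of 2 r p 2] powr_balance_le[OF s t, of "real ?N + 2" r p 4] r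
    unfolding dilation_bound_def r_def[symmetric] by (auto simp: le_max_iff_disj)
  then have mk: "m \<le> rescaling_factor ?N p s"
    unfolding m_def rescaling_factor_def using s t by (intro max.mono mult_left_mono power_mono) auto
  have c: "0 \<le> 1 / 2 - 1 / r" "0 \<le> 1 - (real ?N + 2) / r" using r by (auto simp: field_simps)
  have "energy p v = (1 / 2 - 1 / r) * dirichlet v + (1 - (real ?N + 2) / r) * quasilinear v"
    using energy_pohozaev[OF N p(1), of v] vP by (simp add: pohozaev_set_def r_def)
  also have "\<dots> \<le> (1 / 2 - 1 / r) * (m * A) + (1 - (real ?N + 2) / r) * (m * B)"
    using vAm vBm c by (intro add_mono mult_left_mono) auto
  also have "\<dots> = m * energy p u"
    unfolding energy_pohozaev[OF N p(1) uP] A_def B_def r_def by (simp only: distrib_left mult_ac)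
  also have "\<dots> \<le> rescaling_factor ?N p s * energy p u"
  proof (rule mult_right_mono[OF mk])
    show "energy p u \<ge> 0"
      using energy_pohozaev[OF N p(1) uP] c A B by (simp add: A_def B_def r_def)
  qed
  finally show ?thesis using vP unfolding s_def by blast
qed

text \<open>The constraint and \<open>gagliardo_nirenberg\<close> give k B \<le> a^\<alpha>
  B^\<beta> for the quasilinear integral B. Dividing by B > 0 and using \<beta> > 1 turns this upper
  bound into a lower bound for B, with e = \<alpha> / (\<beta> - 1).\<close>

lemma energy_lower_bound:
  assumes N: "CARD('n::finite) \<ge> 3" and p: "4 + 4 / real CARD('n) < p" "p < 2 * critical_exponent CARD('n)"
  shows "\<exists>C>0. \<exists>e>0. \<forall>a>0. \<forall>u \<in> (pohozaev_set p a :: (real ^ 'n \<Rightarrow> real) set). C * a powr (- e) \<le> energy p u"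
proof -
  let ?N = "CARD('n)"
  note eb = exponent_bounds[OF N p(1)]
  define r where "r = real ?N * (p - 2) / 2"
  have r: "r > real ?N + 2" using eb by (simp add: r_def)
  define \<beta> where "\<beta> = real ?N * (p - 2) / (2 * (real ?N + 2))"
  have \<beta>r: "\<beta> = r / (real ?N + 2)" by (simp add: \<beta>_def r_def)
  have \<beta>: "\<beta> > 1" unfolding \<beta>r using r by (simp add: field_simps)
  define \<alpha> where "\<alpha> = p - 4 * \<beta>"
  have \<alpha>: "\<alpha> > 0"
  proof -
    have "p * (real ?N - 2) < 4 * real ?N" using p(2) N by (simp add: critical_exponent_def field_simps)
    \<comment> \<open>The right side is positive exactly when p is below twice the critical
      exponent.\<close>
    moreover have "\<alpha> * (real ?N + 2) = 4 * real ?N - p * (real ?N - 2)"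
    proof -
      have "4 * \<beta> * (real ?N + 2) = 2 * real ?N * (p - 2)" unfolding \<beta>_def by (simp add: field_simps)
      then show ?thesis by (simp add: \<alpha>_def algebra_simps)
    qed
    ultimately have "\<alpha> * (real ?N + 2) > 0" by simp
    then show ?thesis by (simp add: zero_less_mult_iff)
  qed
  define \<gamma> where "\<gamma> = gamma_exp ?N p"
  have \<gamma>: "\<gamma> > 0" using eb by (simp add: \<gamma>_def)
  obtain M where M: "M > 0" and gn: "\<And>(u :: real ^ 'n \<Rightarrow> real) a B. a > 0 \<Longrightarrow> u \<in> mass_sphere a \<Longrightarrow> B > 0 \<Longrightarrow> quasilinear u \<le> B \<Longrightarrow>
    lp_power p u \<le> M * a powr \<alpha> * B powr \<beta>"
    using gagliardo_nirenberg[OF N, of p] eb(1) p(2) unfolding \<alpha>_def \<beta>_def by fastforce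
  define k where "k = (real ?N + 2) / (\<gamma> * M)"
  have k: "k > 0" using \<gamma> M by (simp add: k_def add_nonneg_pos)
  define c2 where "c2 = 1 - (real ?N + 2) / r"
  have c2: "c2 > 0" unfolding c2_def using r by (simp add: field_simps)
  define C where "C = c2 * k powr (1 / (\<beta> - 1))"
  define e where "e = \<alpha> / (\<beta> - 1)"
  have "C * a powr (- e) \<le> energy p u" if a: "a > 0" and u: "u \<in> pohozaev_set p a" for a and u :: "real ^ 'n \<Rightarrow> real"
  proof -
    have um: "u \<in> mass_sphere a" and uP: "pohozaev p u = 0" using u by (auto simp: pohozaev_set_def)
    define B where "B = quasilinear u"
    have B: "B > 0" unfolding B_def using quasilinear_pos[OF N _ p(2) um a] eb by simp
    have "(real ?N + 2) * B \<le> \<gamma> * lp_power p u"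
      using uP dirichlet_nonneg[of u] by (simp add: pohozaev_eq B_def \<gamma>_def)
    also have "\<dots> \<le> \<gamma> * (M * a powr \<alpha> * B powr \<beta>)"
      using gn[OF a um B] \<gamma> by (intro mult_left_mono) (auto simp: B_def)
    finally have "k * B \<le> a powr \<alpha> * B powr \<beta>"
      using \<gamma> M by (simp add: k_def field_simps)
    moreover have "B powr \<beta> = B powr (\<beta> - 1) * B" using B by (simp add: powr_diff)
    ultimately have "k * B \<le> (a powr \<alpha> * B powr (\<beta> - 1)) * B" by simp
    then have "k \<le> a powr \<alpha> * B powr (\<beta> - 1)" using B by (simp add: mult_le_cancel_right)
    then have "k * a powr (- \<alpha>) \<le> B powr (\<beta> - 1)"
      using a by (simp add: powr_minus field_simps)
    then have "(k * a powr (- \<alpha>)) powr (1 / (\<beta> - 1)) \<le> (B powr (\<beta> - 1)) powr (1 / (\<beta> - 1))"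
      using \<beta> k by (intro powr_mono2) auto
    also have "\<dots> = B" using \<beta> B by (simp add: powr_powr)
    also have "(k * a powr (- \<alpha>)) powr (1 / (\<beta> - 1)) = k powr (1 / (\<beta> - 1)) * a powr (- e)"
      using k by (simp add: powr_mult powr_powr e_def)
    finally have "k powr (1 / (\<beta> - 1)) * a powr (- e) \<le> B" .
    then have "C * a powr (- e) \<le> c2 * B" unfolding C_def using c2 by (simp add: mult.assoc)
    also have "\<dots> \<le> energy p u"
    proof -
      have "0 \<le> (1 / 2 - 1 / r) * dirichlet u"
        using r dirichlet_nonneg[of u] by (intro mult_nonneg_nonneg) (auto simp: field_simps)
      then show ?thesis using energy_pohozaev[OF N p(1) uP] by (simp add: B_def c2_def r_def)
    qed
    finally show ?thesis .
  qed
  moreover have "C > 0" using c2 k by (simp add: C_def)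
  moreover have "e > 0" using \<alpha> \<beta> by (simp add: e_def)
  ultimately show ?thesis by blast
qed

section \<open>Limits of the rescaling factor and the conclusion\<close>

lemma rescaling_factor_tendsto_1:
  assumes "x > 0"
  shows "((\<lambda>y. rescaling_factor N p (x / y)) \<longlongrightarrow> 1) (at x within S)"
proof -
  have q: "((\<lambda>y. x / y) \<longlongrightarrow> x / x) (at x within S)" using assms by (intro tendsto_intros) auto
  then have q: "((\<lambda>y. x / y) \<longlongrightarrow> 1) (at x within S)" using assms by simp
  have T: "((\<lambda>y. dilation_bound N p (x / y)) \<longlongrightarrow> dilation_bound N p 1) (at x within S)"
    unfolding dilation_bound_def by (intro tendsto_max tendsto_powr q tendsto_const) auto
  have "((\<lambda>y. rescaling_factor N p (x / y)) \<longlongrightarrow> rescaling_factor N p 1) (at x within S)"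
    unfolding rescaling_factor_def by (intro tendsto_max tendsto_mult tendsto_power q T)
  then show ?thesis by (simp add: rescaling_factor_def dilation_bound_def)
qed

text \<open>Below the critical exponent both exponents in \<open>dilation_bound\<close> exceed 1 in
  absolute value, so the dilation is at most s^(-e) with e > 1 for large s. The factor becomes the
  larger of s^(2 - 2e) and s^(4 - e(N+2)), and N + 2 > 4 makes the second exponent negative
  too.\<close>

lemma rescaling_factor_tendsto_0:
  assumes N: "N \<ge> 3" and p: "4 + 4 / real N < p" "p < critical_exponent N"
  shows "(rescaling_factor N p \<longlongrightarrow> 0) at_top"
proof -
  note eb = exponent_bounds[OF N p(1)]
  define r where "r = real N * (p - 2) / 2"
  have r: "r > real N + 2" using eb by (simp add: r_def)
  define e where "e = min ((p - 2) / (r - 2)) ((p - 4) / (r - (real N + 2)))"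
  have crit: "(p - 2) * (real N - 2) < 4" using p(2) N by (simp add: critical_exponent_def field_simps)
  have e1: "(p - 2) / (r - 2) > 1"
  proof -
    have "p - 2 > r - 2" using crit by (simp add: r_def field_simps)
    then show ?thesis using r by simp
  qed
  have e2: "(p - 4) / (r - (real N + 2)) > 1"
  proof -
    have "p - 4 > r - (real N + 2)" using crit N by (simp add: r_def field_simps)
    then show ?thesis using r by simp
  qed
  have e: "e > 1" using e1 e2 by (simp add: e_def)
  \<comment> \<open>For s \<ge> 1 the larger of two negative powers is the one with the smaller
    absolute exponent, which is why \<open>e\<close> is a minimum.\<close>
  have T: "dilation_bound N p s = s powr (- e)" if "s \<ge> 1" for s
  proof -
    have "s powr (- x) \<le> s powr (- y) \<or> x < y" for x y using that by (auto intro: powr_mono)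
    then show ?thesis unfolding dilation_bound_def e_def r_def[symmetric]
      using that by (auto simp: min_def max_def intro!: antisym powr_mono)
  qed
  have "((\<lambda>s. max (s powr (2 - 2 * e)) (s powr (4 - e * (real N + 2)))) \<longlongrightarrow> max 0 (0::real)) at_top"
  proof (intro tendsto_max tendsto_neg_powr filterlim_ident)
    show "2 - 2 * e < 0" using e by simp
    have "1 * (real N + 2) \<le> e * (real N + 2)" using e by (intro mult_right_mono) auto
    moreover have "4 < 1 * (real N + 2)" using N by simp
    ultimately have "4 < e * (real N + 2)" by (rule less_le_trans[rotated])
    then show "4 - e * (real N + 2) < 0" by simp
  qed
  moreover have "\<forall>\<^sub>F s in at_top. max (s powr (2 - 2 * e)) (s powr (4 - e * (real N + 2))) = rescaling_factor N p s"
    using eventually_ge_at_top[of 1]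
  proof eventually_elim
    case (elim s)
    have pw: "s ^ i * (s powr (- e)) ^ j = s powr (real i - e * real j)" for i j
    proof -
      have "s ^ i = s powr real i" using elim by (simp add: powr_realpow)
      moreover have "(s powr (- e)) ^ j = s powr (- e * real j)" using elim by (simp add: powr_power mult.commute)
      ultimately show ?thesis by (simp add: powr_add[symmetric])
    qed
    show ?case using pw[of 2 2] pw[of 4 "N + 2"]
      by (simp add: rescaling_factor_def T[OF elim] mult.commute add.commute)
  qed
  ultimately show ?thesis by (simp cong: filterlim_cong)
qed

text \<open>Finiteness excludes the value \<infinity> of an infimum over the empty set. The target
  filter \<open>at_right 0\<close> encodes convergence to 0 through strictly positive
  values.\<close>

theorem theorem1p6:
  fixes p :: real
  assumes "CARD('n::finite) \<ge> 3"
  shows "(4 + 4 / real CARD('n) < p \<and> p < 2 * critical_exponent CARD('n) \<longrightarrow>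
           (\<forall>a>0. 0 < ground_level TYPE('n) p a \<and> ground_level TYPE('n) p a < \<infinity>) \<and>
           lower_semicontinuous_on {0<..} (ground_level TYPE('n) p)) \<and>
         (4 + 4 / real CARD('n) < p \<and> p < critical_exponent CARD('n) \<longrightarrow>
           filterlim (ground_level TYPE('n) p) (at_right 0) at_top) \<and>
         (4 + 4 / real CARD('n) < p \<and> p < 2 * critical_exponent CARD('n) \<longrightarrow>
           (ground_level TYPE('n) p \<longlongrightarrow> \<infinity>) (at_right 0))"
proof -
  let ?m = "ground_level TYPE('n) p" and ?N = "CARD('n)"
  note N = assms
  \<comment> \<open>All three claims are read off from this: m is a real function
    \<open>\<mu>\<close> with a lower bound by a negative power of a and the comparison inequality
    between any two masses.\<close>
  have main: "\<exists>\<mu> C e. C > 0 \<and> e > 0 \<and> (\<forall>a>0. ?m a = ereal (\<mu> a) \<and> C * a powr (- e) \<le> \<mu> a \<and>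
      (\<forall>b>0. \<mu> a \<le> rescaling_factor ?N p (a / b) * \<mu> b))"
    if p: "4 + 4 / real ?N < p" "p < 2 * critical_exponent ?N"
  proof -
    obtain C e where C: "C > 0" "e > 0" and lower: "\<And>a u. a > 0 \<Longrightarrow> u \<in> (pohozaev_set p a :: (real ^ 'n \<Rightarrow> real) set) \<Longrightarrow> C * a powr (- e) \<le> energy p u"
      using energy_lower_bound[OF N p] by blast
    define \<mu> where "\<mu> a = real_of_ereal (?m a)" for a
    have lo: "ereal (C * a powr (- e)) \<le> ?m a" if "a > 0" for a
      unfolding ground_level_def using lower[OF that] by (intro INF_greatest) simp
    have fin: "?m a < \<infinity>" if a: "a > 0" for a
    proof -
      obtain u :: "real ^ 'n \<Rightarrow> real" where "u \<in> mass_sphere a" using mass_sphere_nonempty[OF a] by blast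
      then obtain v :: "real ^ 'n \<Rightarrow> real" where "v \<in> pohozaev_set p a" using pohozaev_dilation[OF N p _ a] by blast
      then have "?m a \<le> ereal (energy p v)" unfolding ground_level_def by (rule INF_lower)
      then show ?thesis by (rule le_less_trans) simp
    qed
    have \<mu>: "?m a = ereal (\<mu> a)" if "a > 0" for a
      using lo[OF that] fin[OF that] unfolding \<mu>_def by (cases "?m a") auto
    have cmp: "\<mu> a \<le> rescaling_factor ?N p (a / b) * \<mu> b" if a: "a > 0" and b: "b > 0" for a b
    proof -
      have k: "rescaling_factor ?N p (a / b) > 0" using a b by (intro rescaling_factor_pos) simp
      \<comment> \<open>The factor is moved to the left because a lower bound valid for every energy
        at mass \<open>b\<close> passes to the infimum.\<close>
      have "ereal (\<mu> a / rescaling_factor ?N p (a / b)) \<le> ?m b"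
        unfolding ground_level_def
      proof (rule INF_greatest)
        fix u :: "real ^ 'n \<Rightarrow> real" assume "u \<in> pohozaev_set p b"
        then obtain v :: "real ^ 'n \<Rightarrow> real" where v: "v \<in> pohozaev_set p a" "energy p v \<le> rescaling_factor ?N p (a / b) * energy p u"
          using pohozaev_set_rescale[OF N p _ a b] by blast
        have "?m a \<le> ereal (energy p v)" unfolding ground_level_def by (rule INF_lower[OF v(1)])
        then have "\<mu> a \<le> energy p v" using \<mu>[OF a] by simp
        with v(2) k show "ereal (\<mu> a / rescaling_factor ?N p (a / b)) \<le> ereal (energy p u)"
          by (simp add: divide_le_eq mult.commute)
      qed
      then show ?thesis using \<mu>[OF b] k by (simp add: divide_le_eq mult.commute)
    qed
    have low: "C * a powr (- e) \<le> \<mu> a" if "a > 0" for a using lo[OF that] \<mu>[OF that] by simp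
    have "\<forall>a>0. ?m a = ereal (\<mu> a) \<and> C * a powr (- e) \<le> \<mu> a \<and> (\<forall>b>0. \<mu> a \<le> rescaling_factor ?N p (a / b) * \<mu> b)"
      by (intro allI impI conjI) (assumption | rule \<mu> low cmp)+
    with C show ?thesis by (intro exI conjI)
  qed
  have part1: "(\<forall>a>0. 0 < ?m a \<and> ?m a < \<infinity>) \<and> lower_semicontinuous_on {0<..} ?m"
    if p: "4 + 4 / real ?N < p" "p < 2 * critical_exponent ?N"
  proof -
    obtain \<mu> C e where C: "C > 0" "e > 0" and \<mu>: "\<And>a. a > 0 \<Longrightarrow> ?m a = ereal (\<mu> a)" "\<And>a. a > 0 \<Longrightarrow> C * a powr (- e) \<le> \<mu> a"
      "\<And>a b. a > 0 \<Longrightarrow> b > 0 \<Longrightarrow> \<mu> a \<le> rescaling_factor ?N p (a / b) * \<mu> b"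
      using main[OF p] by blast
    have pos: "\<mu> a > 0" if "a > 0" for a using \<mu>(2)[OF that] C(1) that by (smt (verit) mult_pos_pos powr_gt_zero)
    have "?m x \<le> Liminf (at x within {0<..}) ?m" if x: "x > 0" for x
    proof -
      \<comment> \<open>Fix x and let y vary: the comparison bounds m(y) below by a quantity tending
        to m(x), because the factor tends to 1.\<close>
      have "((\<lambda>y. ereal (\<mu> x / rescaling_factor ?N p (x / y))) \<longlongrightarrow> ereal (\<mu> x / 1)) (at x within {0<..})"
        by (intro tendsto_intros rescaling_factor_tendsto_1 x) auto
      moreover have "at x within {0<..} \<noteq> bot" using x at_within_open[of x "{0<..}"] by simp
      ultimately have "Liminf (at x within {0<..}) (\<lambda>y. ereal (\<mu> x / rescaling_factor ?N p (x / y))) = ereal (\<mu> x / 1)"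
        by (intro lim_imp_Liminf)
      moreover have "Liminf (at x within {0<..}) (\<lambda>y. ereal (\<mu> x / rescaling_factor ?N p (x / y))) \<le> Liminf (at x within {0<..}) ?m"
      proof (rule Liminf_mono)
        show "\<forall>\<^sub>F y in at x within {0<..}. ereal (\<mu> x / rescaling_factor ?N p (x / y)) \<le> ?m y"
          unfolding eventually_at_filter
        proof (intro always_eventually allI impI)
          fix y :: real assume "y \<in> {0<..}"
          then have y: "y > 0" by simp
          have "rescaling_factor ?N p (x / y) > 0" using x y by (intro rescaling_factor_pos) simp
          then show "ereal (\<mu> x / rescaling_factor ?N p (x / y)) \<le> ?m y"
            using \<mu>(3)[OF x y] \<mu>(1)[OF y] by (simp add: divide_le_eq mult.commute)
        qed
      qed
      ultimately show ?thesis using \<mu>(1)[OF x] by simp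
    qed
    then show ?thesis using \<mu>(1) pos by (auto simp: lower_semicontinuous_on_def)
  qed
  have part2: "filterlim ?m (at_right 0) at_top"
    if p: "4 + 4 / real ?N < p" "p < critical_exponent ?N"
  proof -
    have p2: "p < 2 * critical_exponent ?N" using p exponent_bounds(1)[OF N p(1)] by simp
    obtain \<mu> C e where C: "C > 0" "e > 0" and \<mu>: "\<And>a. a > 0 \<Longrightarrow> ?m a = ereal (\<mu> a)" "\<And>a. a > 0 \<Longrightarrow> C * a powr (- e) \<le> \<mu> a"
      "\<And>a b. a > 0 \<Longrightarrow> b > 0 \<Longrightarrow> \<mu> a \<le> rescaling_factor ?N p (a / b) * \<mu> b"
      using main[OF p(1) p2] by blast
    have pos: "\<mu> a > 0" if "a > 0" for a using \<mu>(2)[OF that] C(1) that by (smt (verit) mult_pos_pos powr_gt_zero)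
    have ev: "\<forall>\<^sub>F a in at_top. a > (0::real)" by (rule eventually_gt_at_top)
    have "(\<mu> \<longlongrightarrow> 0) at_top"
    proof (rule tendsto_sandwich)
      show "\<forall>\<^sub>F a in at_top. 0 \<le> \<mu> a" using ev by eventually_elim (simp add: pos less_imp_le)
      \<comment> \<open>Comparison with the fixed mass 1, so that only the factor depends on
        a.\<close>
      show "\<forall>\<^sub>F a in at_top. \<mu> a \<le> rescaling_factor ?N p a * \<mu> 1" using ev by eventually_elim (use \<mu>(3)[of _ 1] in simp)
      show "((\<lambda>a. rescaling_factor ?N p a * \<mu> 1) \<longlongrightarrow> 0) at_top"
        using tendsto_mult_right[OF rescaling_factor_tendsto_0[OF N p], of "\<mu> 1"] by simp
    qed simp
    then have "((\<lambda>a. ereal (\<mu> a)) \<longlongrightarrow> 0) at_top" by (simp add: zero_ereal_def)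
    moreover have "\<forall>\<^sub>F a in at_top. ereal (\<mu> a) = ?m a" using ev by eventually_elim (simp add: \<mu>(1))
    ultimately have "(?m \<longlongrightarrow> 0) at_top" by (rule Lim_transform_eventually)
    \<comment> \<open>The limit 0 alone does not give \<open>at_right 0\<close>; strict positivity
      of m must be added.\<close>
    moreover have "\<forall>\<^sub>F a in at_top. ?m a \<in> {0<..} \<and> ?m a \<noteq> 0" using ev
    proof eventually_elim
      case (elim a)
      then show ?case using \<mu>(1) pos[OF elim] by simp
    qed
    ultimately show ?thesis by (simp add: filterlim_at)
  qed
  have part3: "(?m \<longlongrightarrow> \<infinity>) (at_right 0)"
    if p: "4 + 4 / real ?N < p" "p < 2 * critical_exponent ?N"
  proof -
    obtain \<mu> C e where C: "C > 0" "e > 0" and \<mu>: "\<And>a. a > 0 \<Longrightarrow> ?m a = ereal (\<mu> a)" "\<And>a. a > 0 \<Longrightarrow> C * a powr (- e) \<le> \<mu> a"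
      using main[OF p] by blast
    have "filterlim (\<lambda>a. C * a powr (- e)) at_top (at_right 0)"
    proof (rule filterlim_tendsto_pos_mult_at_top[OF tendsto_const C(1)])
      have "filterlim (\<lambda>a. inverse a powr e) at_top (at_right (0::real))"
        by (rule filterlim_compose[OF real_powr_at_top[OF C(2)] filterlim_inverse_at_top_right])
      then show "filterlim (\<lambda>a::real. a powr (- e)) at_top (at_right 0)"
      proof (rule filterlim_cong[THEN iffD1, OF refl refl, rotated])
        show "\<forall>\<^sub>F a in at_right 0. inverse a powr e = a powr (- e)"
          by (intro eventually_at_rightI[of 0 1]) (auto simp: powr_minus inverse_powr)
      qed
    qed
    then have "filterlim \<mu> at_top (at_right 0)"
    proof (rule filterlim_at_top_mono)
      show "\<forall>\<^sub>F a in at_right 0. C * a powr (- e) \<le> \<mu> a"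
        by (intro eventually_at_rightI[of 0 1]) (auto intro: \<mu>(2))
    qed
    then have "((\<lambda>a. ereal (\<mu> a)) \<longlongrightarrow> \<infinity>) (at_right 0)" by (simp add: tendsto_PInfty_eq_at_top)
    moreover have "\<forall>\<^sub>F a in at_right 0. ereal (\<mu> a) = ?m a"
      by (intro eventually_at_rightI[of 0 1]) (auto simp: \<mu>(1))
    ultimately show ?thesis by (rule Lim_transform_eventually)
  qed
  show ?thesis using part1 part2 part3 by blast
qed

end
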